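(* Let $F$ be a germ of biholomorphism of $\mathbb{C}^n$ fixing $0$, with diagonal differential $dF_0=\mathrm{Diag}(\lambda_1,\dots,\lambda_n)$, which is one-resonant with respect to all eigenvalues $\{\lambda_1,\dots,\lambda_n\}$ with generator $\alpha=(\alpha_1,\dots,\alpha_n)\in\mathbb{N}^n$. Assume that $F$ is holomorphically conjugated to one of its Poincaré–Dulac normal forms. Suppose that $|\lambda_j|=1$ for $j=1,\dots,n$ and that $F$ is parabolically attracting. Then for each $j\in\{1,\dots,n\}$ such that $\alpha_j\neq0$ there exists a germ $M_j$ of a complex manifold tangent to $\{z_j=0\}$ at $0$ such that $F(M_j)\subset M_j$ and $F|_{M_j}$ is holomorphically linearizable. Moreover, there exists an open neighborhood $W$ of $0$ such that $W\setminus\bigcup_{j:\,\alpha_j\ne0}M_j$ is the union of attracting and repelling basins of $F$.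
   Context: Conventions: $\mathbb{N}=\{0,1,2,\dots\}$; for $Q\in\mathbb{N}^n$, $|Q|=\sum_hq_h$ and $z^Q=\prod_hz_h^{q_h}$; $e_j$ is the $j$-th unit vector. $F$ is one-resonant with respect to all eigenvalues with generator $\alpha\in\mathbb{N}^n\setminus\{0\}$ if the resonances, i.e. the pairs $(j,L)$ with $1\le j\le n$, $L\in\mathbb{N}^n$, $|L|\ge2$ and $\lambda_j=\lambda^L$, are precisely the pairs with $L=e_j+k\alpha$, $k\in\mathbb{N}$, $k\ge1$. By the Poincaré–Dulac theorem, a (possibly formal) change of coordinates tangent to the identity conjugates such an $F$ to a (possibly formal) Poincaré–Dulac normal form $$\widetilde F(z)=\mathrm{Diag}(\lambda_1,\dots,\lambda_n)z+\sum_{s=1}^n\sum_{k\ge1}a_{k,s}\,z^{k\alpha}z_s\,e_s .$$ The weighted order $k_0$ of $F$ is the minimal $k\ge 1$ such that $a_{k,s}\ne0$ for some $s$; it does not depend on the normal form. If $k_0<\infty$, the associated parabolic shadow is $f(u)=u+H_{k_0+1}(u)$, $u\in\mathbb{C}$, with $H_{k_0+1}(u)=\big(\sum_{s=1}^n\alpha_s\frac{a_{k_0,s}}{\lambda_s}\big)u^{k_0+1}$. $F$ is parabolically attracting if, for some normal form, $\sum_{s=1}^n\alpha_s\frac{a_{k_0,s}}{\lambda_s}\neq0$ and there is $v\in\mathbb{C}\setminus\{0\}$ with $H_{k_0+1}(v)=-\frac1{k_0}v$ and $$\mathrm{Re}\Big(\frac{a_{k_0,j}}{\lambda_j}v^{k_0}\Big)<0,\qquad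 j=1,\dots,n.$$ An attracting basin (basin of attraction) for $F$ at $0$ is a nonempty (not necessarily connected) open set $U\subset\mathbb{C}^n$ with $0\in\overline U$, contained in the domain of definition of $F$, with $F(U)\subseteq U$ and $F^{\circ\ell}(z)\to0$ as $\ell\to\infty$ for every $z\in U$. A repelling basin for $F$ is a basin of attraction for $F^{-1}$. *)

theory Defs
  imports "HOL-Analysis.Analysis"
begin

section \<open>Holomorphic maps in several variables\<close>

text \<open>Complex differentiability: the Frechet derivative is given by a complex matrix.\<close>

definition holo_on :: "(complex^'n \<Rightarrow> complex^'n) \<Rightarrow> (complex^'n) set \<Rightarrow> bool" where
  "holo_on f U \<longleftrightarrow> open U \<and> (\<forall>z\<in>U. \<exists>A :: complex^'n^'n. (f has_derivative (\<lambda>v. A *v v)) (at z))"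

definition biholo_on :: "(complex^'n \<Rightarrow> complex^'n) \<Rightarrow> (complex^'n) set \<Rightarrow> bool" where
  "biholo_on f U \<longleftrightarrow> holo_on f U \<and> inj_on f U \<and> holo_on (inv_into U f) (f ` U)"

text \<open>A germ of biholomorphism at 0 fixing 0 is represented by a map together with
  an open neighbourhood \<open>D\<close> of 0, its domain of definition.\<close>

definition biholo_germ :: "(complex^'n \<Rightarrow> complex^'n) \<Rightarrow> (complex^'n) set \<Rightarrow> bool" where
  "biholo_germ F D \<longleftrightarrow> 0 \<in> D \<and> biholo_on F D \<and> F 0 = 0"


section \<open>Multi-indices and formal power series maps\<close>

definition mdeg :: "nat^'n \<Rightarrow> nat" where
  "mdeg Q = (\<Sum>h\<in>UNIV. Q $ h)"

definition monom_at :: "complex^'n \<Rightarrow> nat^'n \<Rightarrow> complex" where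
  "monom_at z Q = (\<Prod>h\<in>UNIV. (z $ h) ^ (Q $ h))"

text \<open>A formal power series map is a function \<open>f :: nat^'n \<Rightarrow> complex^'n\<close>; \<open>f Q\<close> is the vector
  coefficient of the monomial with exponent \<open>Q\<close>.\<close>

definition has_taylor :: "(complex^'n \<Rightarrow> complex^'n) \<Rightarrow> (nat^'n \<Rightarrow> complex^'n) \<Rightarrow> bool" where
  "has_taylor F f \<longleftrightarrow>
     (\<forall>\<^sub>F z in nhds 0. ((\<lambda>Q. monom_at z Q *s f Q) has_sum F z) UNIV)"

text \<open>Coefficient of \<open>z^Q\<close> in the product of the powers \<open>(T_j)^(P_j)\<close> over all \<open>j\<close>. The factors
  are indexed by the pairs \<open>(j, i)\<close> with \<open>i < P_j\<close>, and \<open>m\<close> selects one monomial from each factor.\<close>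

definition factors :: "nat^'n \<Rightarrow> ('n \<times> nat) set" where
  "factors P = (SIGMA j:UNIV. {..<P $ j})"

definition fpow_coeff :: "(nat^'n \<Rightarrow> complex^'n) \<Rightarrow> nat^'n \<Rightarrow> nat^'n \<Rightarrow> complex" where
  "fpow_coeff T P Q =
     (\<Sum>m | m \<in> factors P \<rightarrow>\<^sub>E UNIV \<and> (\<Sum>x\<in>factors P. m x) = Q.
        \<Prod>x\<in>factors P. T (m x) $ fst x)"

text \<open>Formal composition of \<open>G\<close> with \<open>T\<close>, meant for \<open>T 0 = 0\<close>: then the powers of \<open>T\<close> with
  \<open>mdeg P > mdeg Q\<close> have no term of exponent \<open>Q\<close>.\<close>

definition fcomp :: "(nat^'n \<Rightarrow> complex^'n) \<Rightarrow> (nat^'n \<Rightarrow> complex^'n) \<Rightarrow> (nat^'n \<Rightarrow> complex^'n)" where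
  "fcomp G T = (\<lambda>Q. \<Sum>P | mdeg P \<le> mdeg Q. fpow_coeff T P Q *s G P)"

definition tangent_to_id :: "(nat^'n \<Rightarrow> complex^'n) \<Rightarrow> bool" where
  "tangent_to_id T \<longleftrightarrow> T 0 = 0 \<and> (\<forall>h. T (axis h 1) = axis h 1)"


section \<open>One-resonance and Poincare--Dulac normal forms\<close>

definition one_resonant :: "complex^'n \<Rightarrow> nat^'n \<Rightarrow> bool" where
  "one_resonant lam \<alpha> \<longleftrightarrow> \<alpha> \<noteq> 0 \<and>
     {(j, L). mdeg L \<ge> 2 \<and> lam $ j = monom_at lam L} =
     {(j, L). \<exists>k\<ge>1. L = axis j 1 + k *s \<alpha>}"

text \<open>The formal map \<open>Diag(lam) z + (\<Sum>s. \<Sum>k\<ge>1. a k s z^(k \<alpha>) z_s e_s)\<close>. For \<open>\<alpha> \<noteq> 0\<close> the inner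
  index set below has at most one element.\<close>

definition pd_form :: "complex^'n \<Rightarrow> nat^'n \<Rightarrow> (nat \<Rightarrow> 'n \<Rightarrow> complex) \<Rightarrow> (nat^'n \<Rightarrow> complex^'n)" where
  "pd_form lam \<alpha> a = (\<lambda>Q. \<chi> s. (if Q = axis s 1 then lam $ s else 0) +
     (\<Sum>k | 1 \<le> k \<and> Q = axis s 1 + k *s \<alpha>. a k s))"

text \<open>The conjugation is allowed to be formal; a convergent one induces a formal one.\<close>

definition pd_normal_form_of ::
  "(complex^'n \<Rightarrow> complex^'n) \<Rightarrow> complex^'n \<Rightarrow> nat^'n \<Rightarrow> (nat \<Rightarrow> 'n \<Rightarrow> complex) \<Rightarrow> bool" where
  "pd_normal_form_of F lam \<alpha> a \<longleftrightarrow>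
     (\<exists>f T. has_taylor F f \<and> tangent_to_id T \<and> fcomp T f = fcomp (pd_form lam \<alpha> a) T)"

text \<open>The holomorphic conjugation is not required to be tangent to the identity.\<close>

definition holo_conj_to_pd :: "(complex^'n \<Rightarrow> complex^'n) \<Rightarrow> complex^'n \<Rightarrow> nat^'n \<Rightarrow> bool" where
  "holo_conj_to_pd F lam \<alpha> \<longleftrightarrow>
     (\<exists>a G \<phi> V. pd_normal_form_of F lam \<alpha> a \<and> has_taylor G (pd_form lam \<alpha> a) \<and>
        biholo_germ \<phi> V \<and> (\<forall>\<^sub>F z in nhds 0. \<phi> (F z) = G (\<phi> z)))"

definition weighted_order :: "(nat \<Rightarrow> 'n \<Rightarrow> complex) \<Rightarrow> nat \<Rightarrow> bool" where
  "weighted_order a k0 \<longleftrightarrow> 1 \<le> k0 \<and> (\<exists>s. a k0 s \<noteq> 0) \<and> (\<forall>k. 1 \<le> k \<and> k < k0 \<longrightarrow> (\<forall>s. a k s = 0))"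

definition shadow_coeff :: "complex^'n \<Rightarrow> nat^'n \<Rightarrow> (nat \<Rightarrow> 'n \<Rightarrow> complex) \<Rightarrow> nat \<Rightarrow> complex" where
  "shadow_coeff lam \<alpha> a k0 = (\<Sum>s\<in>UNIV. of_nat (\<alpha> $ s) * (a k0 s / lam $ s))"

text \<open>The parabolic shadow is \<open>u + shadow_term lam \<alpha> a k0 u\<close>.\<close>

definition shadow_term ::
  "complex^'n \<Rightarrow> nat^'n \<Rightarrow> (nat \<Rightarrow> 'n \<Rightarrow> complex) \<Rightarrow> nat \<Rightarrow> complex \<Rightarrow> complex" where
  "shadow_term lam \<alpha> a k0 u = shadow_coeff lam \<alpha> a k0 * u ^ (k0 + 1)"

definition parabolically_attracting ::
  "(complex^'n \<Rightarrow> complex^'n) \<Rightarrow> complex^'n \<Rightarrow> nat^'n \<Rightarrow> bool" where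
  "parabolically_attracting F lam \<alpha> \<longleftrightarrow>
     (\<exists>a k0. pd_normal_form_of F lam \<alpha> a \<and> weighted_order a k0 \<and>
        shadow_coeff lam \<alpha> a k0 \<noteq> 0 \<and>
        (\<exists>v. v \<noteq> 0 \<and> shadow_term lam \<alpha> a k0 v = - (1 / of_nat k0) * v \<and>
             (\<forall>j. Re (a k0 j / lam $ j * v ^ k0) < 0)))"


section \<open>Complex submanifolds\<close>

definition complex_submanifold :: "nat \<Rightarrow> (complex^'n) set \<Rightarrow> bool" where
  "complex_submanifold d M \<longleftrightarrow>
     (\<forall>p\<in>M. \<exists>V \<Phi> S. p \<in> V \<and> biholo_on \<Phi> V \<and> vec.subspace S \<and> vec.dim S = d \<and>
        \<Phi> ` (M \<inter> V) = S \<inter> \<Phi> ` V)"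

definition tangent_space :: "(complex^'n) set \<Rightarrow> complex^'n \<Rightarrow> (complex^'n) set" where
  "tangent_space M p =
     {v. \<exists>\<gamma> :: real \<Rightarrow> complex^'n. \<gamma> 0 = p \<and> (\<forall>\<^sub>F t in nhds 0. \<gamma> t \<in> M) \<and>
         (\<gamma> has_vector_derivative v) (at 0)}"

text \<open>Holomorphic maps on a submanifold are locally restrictions of ambient holomorphic maps.\<close>

definition holo_on_sub :: "(complex^'n \<Rightarrow> complex^'n) \<Rightarrow> (complex^'n) set \<Rightarrow> bool" where
  "holo_on_sub f N \<longleftrightarrow>
     (\<forall>p\<in>N. \<exists>V g. p \<in> V \<and> holo_on g V \<and> (\<forall>z\<in>N \<inter> V. f z = g z))"

text \<open>The restriction of \<open>F\<close> to \<open>M\<close> is conjugate, by a germ at 0 of a biholomorphism of \<open>M\<close> onto a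
  complex vector space \<open>S\<close>, to a linear endomorphism \<open>A\<close> of \<open>S\<close>.\<close>

definition linearizable_on :: "(complex^'n \<Rightarrow> complex^'n) \<Rightarrow> (complex^'n) set \<Rightarrow> bool" where
  "linearizable_on F M \<longleftrightarrow>
     (\<exists>N S E \<phi> \<psi> (A :: complex^'n^'n).
        openin (top_of_set M) N \<and> 0 \<in> N \<and>
        vec.subspace S \<and> openin (top_of_set S) E \<and>
        homeomorphism N E \<phi> \<psi> \<and> holo_on_sub \<phi> N \<and> holo_on_sub \<psi> E \<and> \<phi> 0 = 0 \<and>
        (\<forall>w\<in>S. A *v w \<in> S) \<and>
        (\<forall>\<^sub>F z in at 0 within N. F z \<in> N \<and> \<phi> (F z) = A *v \<phi> z))"


section \<open>Basins\<close>

definition attracting_basin ::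
  "(complex^'n \<Rightarrow> complex^'n) \<Rightarrow> (complex^'n) set \<Rightarrow> (complex^'n) set \<Rightarrow> bool" where
  "attracting_basin F D U \<longleftrightarrow>
     U \<noteq> {} \<and> open U \<and> 0 \<in> closure U \<and> U \<subseteq> D \<and> F ` U \<subseteq> U \<and>
     (\<forall>z\<in>U. (\<lambda>l. (F ^^ l) z) \<longlonglongrightarrow> 0)"

definition repelling_basin ::
  "(complex^'n \<Rightarrow> complex^'n) \<Rightarrow> (complex^'n) set \<Rightarrow> (complex^'n) set \<Rightarrow> bool" where
  "repelling_basin F D U \<longleftrightarrow> attracting_basin (inv_into D F) (F ` D) U"

end

theory Submission
  imports Defs "HOL-Complex_Analysis.Complex_Singularities"
begin

text \<open>Let \<open>w = \<phi> z\<close> be coordinates in which \<open>F\<close> is a convergent normal form, and let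
\<open>u = w^\<alpha>\<close> be the resonant monomial. Then \<open>F\<close> acts by
\<open>w_s \<mapsto> \<lambda>_s w_s (1 + h_s(u))\<close>. Since \<open>\<lambda>^\<alpha> = 1\<close>, the monomial evolves
by itself, by a parabolic germ \<open>u \<mapsto> u + A u^(k+1) + \<dots>\<close>. On \<open>{w_j = 0}\<close> with \<open>\<alpha>_j \<noteq> 0\<close>
the monomial vanishes, so there the map is the linear isometry \<open>Diag(\<lambda>)\<close>. These hyperplanes,
pulled back by \<open>\<phi>\<close>, are the manifolds \<open>M_j\<close> (lemma \<open>straightened_hypersurface\<close>).

Off the hyperplanes, take the Fatou coordinate \<open>\<zeta> = -1/(k A u^k)\<close>. It satisfies
\<open>\<zeta> \<mapsto> \<zeta> + 1 + o(1)\<close>, while \<open>|w_s|\<close> is multiplied by \<open>|1 - (\<beta>_s + o(1))/\<zeta>|\<close>,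
where \<open>\<beta>_s = a_{k,s}/(\<lambda>_s k A)\<close>. Parabolic attraction says precisely that
\<open>Re \<beta>_s > 0\<close>. An orbit that starts with \<open>Re \<zeta> > -1\<close> needs a number of steps at most
proportional to \<open>|\<zeta>_0|\<close> to reach a narrow sector around the positive real axis. Each of these
steps multiplies \<open>|w_s|\<close> by at most \<open>1 + O(1/|\<zeta>_0|)\<close>, so the total growth is bounded by a
constant \<open>K\<close>. Inside the sector each step contracts by \<open>1 - c/|\<zeta>|\<close>, and since \<open>|\<zeta>|\<close> grows only
linearly the product of the contractions is \<open>0\<close>. This is lemma \<open>drifting_contraction\<close>. Consequently
points of the polydisc of radius \<open>\<rho>/K\<close> with \<open>Re \<zeta> > -1\<close> stay in the polydisc of radius \<open>\<rho>\<close> and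
tend to \<open>0\<close>. The inverse map satisfies the same estimates with \<open>-\<zeta>\<close> in place of \<open>\<zeta>\<close>, and the half-planes
\<open>Re \<zeta> > -1\<close> and \<open>Re (-\<zeta>) > -1\<close> cover the plane. The forward images of the first open set
under \<open>F\<close>, and of the second under the inverse, make up the basins, and \<open>W\<close> is the small polydisc together with them
(lemma \<open>basins_of_convergent_normal_form\<close>).

Parabolic attraction is assumed for some normal form, possibly only formal, whereas the dynamics is read off from a
convergent one. One-resonance forces the \<open>\<lambda>_j\<close> to be distinct, so the derivative of \<open>\<phi>\<close> at \<open>0\<close> is
diagonal. Let \<open>S\<close> be the composition of \<open>\<phi>\<^sup>-\<^sup>1\<close> with a truncation of the formal conjugation. It conjugates one
normal form to the other up to high order. Compare, on rays \<open>t x\<close> with \<open>|x_h| = 1\<close>, the coefficients of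
\<open>t^d\<close> with \<open>d = 1 + k |\<alpha>|\<close>: if \<open>q(x)\<close> is that of \<open>S_s(t x)\<close>, then
\<open>q(\<Lambda>x) - \<lambda>_s q(x) = \<gamma> x_s x^(k\<alpha>)\<close>. The right-hand side is multiplied by \<open>\<lambda>_s\<close> when \<open>x\<close> is
replaced by \<open>\<Lambda>x\<close>, so after \<open>l\<close> iterations \<open>q\<close> would have size \<open>l |\<gamma>|\<close>, against
Cauchy's estimate. Hence \<open>\<gamma> = 0\<close>: the leading coefficients of the two normal forms are proportional, with a factor that
cancels in \<open>\<beta>_s\<close> (lemmas \<open>resonant_coefficient_transforms\<close>, \<open>convergent_normal_form_attracting\<close>).\<close>

section \<open>Sequences drifting to the right\<close>

text \<open>After \<open>L\<close> steps the sequence is within \<open>\<delta> L\<close> of \<open>\<zeta> 0 + L\<close>. Starting to the right of \<open>-1\<close> it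
cannot come near the origin: the real part loses at most \<open>2\<close> in modulus, and what the imaginary part loses is less than what the
real part gains.\<close>

lemma right_drift_bounds:
  fixes \<zeta> :: "nat \<Rightarrow> complex"
  assumes start: "Re (\<zeta> 0) > -1" "norm (\<zeta> 0) \<ge> 4"
    and \<delta>: "\<delta> \<le> 1/4"
    and step: "\<And>l. l < L \<Longrightarrow> norm (\<zeta> (Suc l) - \<zeta> l - 1) \<le> \<delta>"
  shows "norm (\<zeta> L) \<ge> (norm (\<zeta> 0) + real L) / 4" "Re (\<zeta> L) \<ge> 3/4 * real L - 1"
    "\<bar>Im (\<zeta> L)\<bar> \<le> \<bar>Im (\<zeta> 0)\<bar> + \<delta> * real L" "norm (\<zeta> L) \<le> norm (\<zeta> 0) + 2 * real L"
proof -
  have "norm (\<zeta> L - \<zeta> 0 - of_nat L) \<le> \<delta> * real L"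
    using step
  proof (induction L)
    case (Suc L)
    have "\<zeta> (Suc L) - \<zeta> 0 - of_nat (Suc L) = (\<zeta> L - \<zeta> 0 - of_nat L) + (\<zeta> (Suc L) - \<zeta> L - 1)"
      by simp
    also have "norm \<dots> \<le> \<delta> * L + \<delta>"
      using Suc by (intro norm_triangle_mono) auto
    finally show ?case by (simp add: algebra_simps)
  qed simp
  then have re: "\<bar>Re (\<zeta> L) - Re (\<zeta> 0) - L\<bar> \<le> \<delta> * real L" and im: "\<bar>Im (\<zeta> L) - Im (\<zeta> 0)\<bar> \<le> \<delta> * real L"
    using abs_Re_le_cmod[of "\<zeta> L - \<zeta> 0 - of_nat L"] abs_Im_le_cmod[of "\<zeta> L - \<zeta> 0 - of_nat L"]
    by auto
  have \<delta>L: "\<delta> * L \<le> 1/4 * L" using \<delta> by (intro mult_right_mono) auto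
  show "Re (\<zeta> L) \<ge> 3/4 * real L - 1" using re \<delta>L start by linarith
  show "\<bar>Im (\<zeta> L)\<bar> \<le> \<bar>Im (\<zeta> 0)\<bar> + \<delta> * real L" using im by linarith
  have n: "norm (\<zeta> 0) \<le> \<bar>Re (\<zeta> 0)\<bar> + \<bar>Im (\<zeta> 0)\<bar>" by (rule cmod_le)
  have "(norm (\<zeta> 0) + real L) / 4 \<le> (\<bar>Re (\<zeta> L)\<bar> + \<bar>Im (\<zeta> L)\<bar>) / 2"
  proof -
    have "\<bar>Re (\<zeta> L)\<bar> \<ge> \<bar>Re (\<zeta> 0)\<bar> - 2 + 3/4 * L" using re \<delta>L start(1) by linarith
    moreover have "\<bar>Im (\<zeta> L)\<bar> \<ge> \<bar>Im (\<zeta> 0)\<bar> - 1/4 * L" using im \<delta>L by linarith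
    ultimately show ?thesis using n start(2) by argo
  qed
  also have "\<dots> \<le> norm (\<zeta> L)"
    using abs_Re_le_cmod[of "\<zeta> L"] abs_Im_le_cmod[of "\<zeta> L"] by argo
  finally show "norm (\<zeta> L) \<ge> (norm (\<zeta> 0) + real L) / 4" .
  have "norm (\<zeta> L) = norm ((\<zeta> L - \<zeta> 0 - of_nat L) + \<zeta> 0 + of_nat L)" by simp
  also have "\<dots> \<le> \<delta> * L + norm (\<zeta> 0) + L"
    using \<open>norm (\<zeta> L - \<zeta> 0 - of_nat L) \<le> \<delta> * L\<close>
    by (intro norm_triangle_mono) auto
  finally show "norm (\<zeta> L) \<le> norm (\<zeta> 0) + 2 * real L" using \<delta>L by linarith
qed

text \<open>If \<open>Re \<beta> > 0\<close> and \<open>\<zeta>\<close> is nearly positive, then \<open>Re (b/\<zeta>)\<close> is comparable with \<open>1/|\<zeta>|\<close> and dominates the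
quadratic term \<open>|b/\<zeta>|\<^sup>2\<close> of \<open>|1 - b/\<zeta>|\<^sup>2\<close> when \<open>|\<zeta>|\<close> is large.\<close>

lemma contraction_in_sector:
  fixes \<beta> :: complex
  assumes "Re \<beta> > 0"
  obtains \<kappa> c R where "\<kappa> \<ge> 1" "c > 0" "R > 0"
    "\<And>\<zeta> b. norm (b - \<beta>) \<le> Re \<beta> / 2 \<Longrightarrow> norm \<zeta> \<ge> R \<Longrightarrow> Re \<zeta> \<ge> \<kappa> * \<bar>Im \<zeta>\<bar> \<Longrightarrow>
       norm (1 - b / \<zeta>) \<le> 1 - c / norm \<zeta>"
proof -
  define p where "p = Re \<beta> / 2"
  define B where "B = norm \<beta> + p"
  define \<kappa> where "\<kappa> = 1 + 4 * B / p"
  define c where "c = p / 4"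
  define R where "R = 4 * B\<^sup>2 / p + p"
  have p: "p > 0" using assms by (simp add: p_def)
  have B: "B \<ge> 0" using p by (simp add: B_def)
  have "norm (1 - b / \<zeta>) \<le> 1 - c / norm \<zeta>"
    if b: "norm (b - \<beta>) \<le> Re \<beta> / 2" and n: "norm \<zeta> \<ge> R" and sec: "Re \<zeta> \<ge> \<kappa> * \<bar>Im \<zeta>\<bar>" for b \<zeta>
  proof -
    let ?n = "norm \<zeta>"
    have Rpos: "R > 0" using p by (simp add: R_def add_nonneg_pos)
    have n0: "?n > 0" using n Rpos by linarith
    have reb: "Re b \<ge> p" using b abs_Re_le_cmod[of "b - \<beta>"] by (simp add: p_def)
    have nb: "norm b \<le> B" using b norm_triangle_sub[of b \<beta>] by (simp add: B_def p_def)
    have \<kappa>: "\<kappa> \<ge> 1" using p B by (simp add: \<kappa>_def)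
    have ge1: "\<bar>Im \<zeta>\<bar> \<le> Re \<zeta>"
      using sec mult_right_mono[OF \<kappa>, of "\<bar>Im \<zeta>\<bar>"] by simp
    have "4 * B / p * \<bar>Im \<zeta>\<bar> \<le> Re \<zeta>"
      using sec by (simp add: \<kappa>_def algebra_simps)
    then have BI: "B * \<bar>Im \<zeta>\<bar> \<le> p * Re \<zeta> / 4"
      using p by (simp add: field_simps)
    have "?n \<le> 2 * Re \<zeta>" using cmod_le[of \<zeta>] ge1 by linarith
    have "\<bar>Im b * Im \<zeta>\<bar> \<le> B * \<bar>Im \<zeta>\<bar>"
      unfolding abs_mult using nb abs_Im_le_cmod[of b] by (intro mult_right_mono) auto
    moreover have "Re b * Re \<zeta> \<ge> p * Re \<zeta>"
      using reb ge1 by (intro mult_right_mono) auto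
    ultimately have "Re b * Re \<zeta> + Im b * Im \<zeta> \<ge> 3/4 * (p * Re \<zeta>)"
      using BI by linarith
    also have "3/4 * (p * Re \<zeta>) \<ge> 3/8 * p * ?n"
      using mult_left_mono[OF \<open>?n \<le> 2 * Re \<zeta>\<close>, of "3/8 * p"] p by simp
    finally have num: "Re b * Re \<zeta> + Im b * Im \<zeta> \<ge> 3/8 * p * ?n" by simp
    have "Re (b / \<zeta>) = (Re b * Re \<zeta> + Im b * Im \<zeta>) / ?n\<^sup>2"
      by (simp add: Re_divide cmod_power2)
    also have "\<dots> \<ge> (3/8 * p * ?n) / ?n\<^sup>2"
      using num by (intro divide_right_mono) auto
    finally have re: "Re (b / \<zeta>) \<ge> 3/8 * p / ?n" using n0 by (simp add: power2_eq_square)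
    have expand: "(norm (1 - b / \<zeta>))\<^sup>2 = 1 - 2 * Re (b / \<zeta>) + (norm (b / \<zeta>))\<^sup>2"
      unfolding cmod_power2 by (simp add: power2_eq_square algebra_simps)
    have "(norm (b / \<zeta>))\<^sup>2 \<le> (B / ?n)\<^sup>2"
      unfolding norm_divide using nb by (intro power_mono divide_right_mono) auto
    also have "(B / ?n)\<^sup>2 = B\<^sup>2 / ?n / ?n" by (simp add: power2_eq_square)
    also have "B\<^sup>2 / ?n / ?n \<le> (p / 4) / ?n"
    proof (rule divide_right_mono)
      have "4 * B\<^sup>2 / p \<le> ?n" using n p by (simp add: R_def)
      then show "B\<^sup>2 / ?n \<le> p / 4" using n0 p by (simp add: field_simps)
    qed simp
    finally have "(norm (1 - b / \<zeta>))\<^sup>2 \<le> 1 - 3/4 * p / ?n + (p / 4) / ?n"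
      using re expand by argo
    also have "\<dots> = 1 - 2 * (c / ?n)" using n0 by (simp add: c_def field_simps)
    also have "\<dots> \<le> (1 - c / ?n)\<^sup>2" by (simp add: power2_eq_square algebra_simps)
    finally have sq: "(norm (1 - b / \<zeta>))\<^sup>2 \<le> (1 - c / ?n)\<^sup>2" .
    have "p \<le> ?n" using n p by (simp add: R_def) (smt (verit) divide_nonneg_pos zero_le_power2)
    then have "c / ?n \<le> 1" using n0 p by (simp add: c_def)
    then show ?thesis using power2_le_imp_le[OF sq] by simp
  qed
  moreover have "R > 0" "\<kappa> \<ge> 1" "c > 0" using p B by (auto simp: R_def \<kappa>_def c_def add_nonneg_pos)
  ultimately show ?thesis using that by blast
qed

text \<open>The effect of one step of the dynamics on the modulus of a coordinate, seen from the Fatou coordinate \<open>\<zeta>\<close>.\<close>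

definition shrinks where
  "shrinks \<delta> \<beta> \<zeta> r r' \<longleftrightarrow> (\<exists>b. norm (b - \<beta>) \<le> \<delta> \<and> r' \<le> r * norm (1 - b / \<zeta>))"
  for \<beta> \<zeta> :: complex and r r' \<delta> :: real

lemma shrinks_mono: "shrinks \<delta> \<beta> \<zeta> r r' \<Longrightarrow> \<delta> \<le> \<delta>' \<Longrightarrow> shrinks \<delta>' \<beta> \<zeta> r r'"
  unfolding shrinks_def by (meson order_trans)

text \<open>The quantifier over \<open>L\<close> lets the bound be used as long as the orbit is known to satisfy the step estimates; this is
what makes an induction possible in which the bound itself keeps the orbit in the region where the estimates hold.\<close>

definition drift_control where
  "drift_control \<delta> R K \<beta> \<longleftrightarrow>
    (\<forall>\<zeta> r. Re (\<zeta> 0) > -1 \<longrightarrow> norm (\<zeta> 0) \<ge> R \<longrightarrow> (\<forall>l. 0 \<le> r l) \<longrightarrow>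
      (\<forall>L. (\<forall>l<L. norm (\<zeta> (Suc l) - \<zeta> l - 1) \<le> \<delta> \<and> shrinks \<delta> \<beta> (\<zeta> l) (r l) (r (Suc l))) \<longrightarrow>
        r L \<le> K * r 0) \<and>
      ((\<forall>l. norm (\<zeta> (Suc l) - \<zeta> l - 1) \<le> \<delta> \<and> shrinks \<delta> \<beta> (\<zeta> l) (r l) (r (Suc l))) \<longrightarrow>
        r \<longlonglongrightarrow> 0))"
  for \<beta> :: complex and \<delta> R K :: real

lemma drift_control_weaken:
  assumes d: "drift_control \<delta> R K \<beta>" and le: "\<delta>' \<le> \<delta>" "R \<le> R'" "K \<le> K'"
  shows "drift_control \<delta>' R' K' \<beta>"
  unfolding drift_control_def
proof (intro allI impI)
  fix \<zeta> :: "nat \<Rightarrow> complex" and r :: "nat \<Rightarrow> real"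
  assume st: "Re (\<zeta> 0) > -1" "norm (\<zeta> 0) \<ge> R'" "\<forall>l. 0 \<le> r l"
  have st': "norm (\<zeta> 0) \<ge> R" using st(2) le(2) by simp
  note d' = d[unfolded drift_control_def, THEN spec[of _ \<zeta>], THEN spec[of _ r], THEN mp, OF st(1),
      THEN mp, OF st', THEN mp, OF st(3)]
  have step: "norm (\<zeta> (Suc l) - \<zeta> l - 1) \<le> \<delta> \<and> shrinks \<delta> \<beta> (\<zeta> l) (r l) (r (Suc l))"
    if "norm (\<zeta> (Suc l) - \<zeta> l - 1) \<le> \<delta>' \<and> shrinks \<delta>' \<beta> (\<zeta> l) (r l) (r (Suc l))" for l
    using that le(1) shrinks_mono by auto
  have K: "K * r 0 \<le> K' * r 0" using st(3) le(3) by (intro mult_right_mono) auto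
  show "(\<forall>L. (\<forall>l<L. norm (\<zeta> (Suc l) - \<zeta> l - 1) \<le> \<delta>' \<and> shrinks \<delta>' \<beta> (\<zeta> l) (r l) (r (Suc l))) \<longrightarrow>
        r L \<le> K' * r 0) \<and>
      ((\<forall>l. norm (\<zeta> (Suc l) - \<zeta> l - 1) \<le> \<delta>' \<and> shrinks \<delta>' \<beta> (\<zeta> l) (r l) (r (Suc l))) \<longrightarrow>
        r \<longlonglongrightarrow> 0)"
    using d' step K by (meson order_trans)
qed

text \<open>The plane is crossed in two phases. Until time \<open>m \<approx> (2\<kappa> + 2) |\<zeta> 0|\<close> every factor is at most
\<open>exp (4 B / |\<zeta> 0|)\<close>, which makes a bounded product. Afterwards the sequence is in the sector of contraction, and since
\<open>|\<zeta> l| \<le> |\<zeta> 0| + 2 l\<close>, the divergence of the harmonic series forces the product to \<open>0\<close>.\<close>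

lemma drifting_contraction:
  assumes "Re \<beta> > 0"
  obtains \<delta> R K where "0 < \<delta>" "1 \<le> K" "drift_control \<delta> R K \<beta>"
proof -
  obtain \<kappa> c R0 where \<kappa>: "\<kappa> \<ge> 1" and c: "c > 0" and R0: "R0 > 0"
    and contr: "\<And>\<zeta> b. norm (b - \<beta>) \<le> Re \<beta> / 2 \<Longrightarrow> norm \<zeta> \<ge> R0 \<Longrightarrow> Re \<zeta> \<ge> \<kappa> * \<bar>Im \<zeta>\<bar> \<Longrightarrow>
       norm (1 - b / \<zeta>) \<le> 1 - c / norm \<zeta>"
    using contraction_in_sector[OF assms] by blast
  \<comment> \<open>the first bound keeps the slope of the drift below that of the sector, the second keeps \<open>b\<close> in the right half-plane\<close>
  define \<delta> where "\<delta> = min (1 / (4 * \<kappa>)) (Re \<beta> / 2)"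
  define R where "R = 4 * R0 + 4"
  define B where "B = norm \<beta> + \<delta>"
  define K where "K = exp (4 * B * (2 * \<kappa> + 3))"
  have \<delta>: "0 < \<delta>" "\<delta> \<le> 1/4" "\<delta> \<le> Re \<beta> / 2" "\<delta> * \<kappa> \<le> 1/4"
  proof -
    have "1 / (4 * \<kappa>) \<le> 1/4" using \<kappa> by (simp add: field_simps)
    then show "\<delta> \<le> 1/4" "\<delta> \<le> Re \<beta> / 2" by (auto simp: \<delta>_def)
    show "0 < \<delta>" using \<kappa> assms by (simp add: \<delta>_def)
    have "\<delta> * \<kappa> \<le> 1 / (4 * \<kappa>) * \<kappa>" using \<kappa> by (intro mult_right_mono) (auto simp: \<delta>_def)
    then show "\<delta> * \<kappa> \<le> 1/4" using \<kappa> by simp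
  qed
  have B: "B \<ge> 0" using \<delta> by (simp add: B_def)
  have K: "K \<ge> 1" using B \<kappa> by (simp add: K_def)
  have grow: "norm (1 - b / \<zeta> l) \<le> exp (4 * B / norm (\<zeta> 0))"
    and late: "l \<ge> (2 * \<kappa> + 2) * norm (\<zeta> 0) \<Longrightarrow> norm (1 - b / \<zeta> l) \<le> exp (- c / (norm (\<zeta> 0) + 2 * real l))"
    if st: "Re (\<zeta> 0) > -1" "norm (\<zeta> 0) \<ge> R" 
      and dr: "\<And>i. i < l \<Longrightarrow> norm (\<zeta> (Suc i) - \<zeta> i - 1) \<le> \<delta>"
      and b: "norm (b - \<beta>) \<le> \<delta>" for \<zeta> b and l :: nat
  proof -
    have n4: "norm (\<zeta> 0) \<ge> 4" using st(2) R0 by (simp add: R_def)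
    note d = right_drift_bounds[of \<zeta> \<delta> l, OF st(1) n4 \<delta>(2) dr]
    have "norm b \<le> B" using b norm_triangle_sub[of b \<beta>] by (simp add: B_def)
    have "norm (\<zeta> l) \<ge> norm (\<zeta> 0) / 4" using d(1) by (simp add: field_simps)
    have "norm (1 - b / \<zeta> l) \<le> 1 + norm b / norm (\<zeta> l)"
      using norm_triangle_ineq4[of 1 "b / \<zeta> l"] by (simp add: norm_divide)
    also have "norm b / norm (\<zeta> l) \<le> B / (norm (\<zeta> 0) / 4)"
      using \<open>norm b \<le> B\<close> \<open>norm (\<zeta> l) \<ge> norm (\<zeta> 0) / 4\<close> n4 B by (intro frac_le) auto
    also have "1 + B / (norm (\<zeta> 0) / 4) \<le> exp (4 * B / norm (\<zeta> 0))"
      using exp_ge_add_one_self[of "4 * B / norm (\<zeta> 0)"] by (simp add: mult.commute)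
    finally show "norm (1 - b / \<zeta> l) \<le> exp (4 * B / norm (\<zeta> 0))" by simp
    assume l: "l \<ge> (2 * \<kappa> + 2) * norm (\<zeta> 0)"
    have "\<kappa> * \<bar>Im (\<zeta> l)\<bar> \<le> \<kappa> * (norm (\<zeta> 0) + \<delta> * l)"
      using d(3) abs_Im_le_cmod[of "\<zeta> 0"] \<kappa> by (intro mult_left_mono) auto
    also have "\<dots> = \<kappa> * norm (\<zeta> 0) + (\<delta> * \<kappa>) * l" by (simp add: algebra_simps)
    also have "\<dots> \<le> \<kappa> * norm (\<zeta> 0) + 1/4 * l"
      using mult_right_mono[OF \<delta>(4), of "real l"] by simp
    also have "\<dots> \<le> 3/4 * l - 1" using l n4 by (simp add: algebra_simps)
    also have "\<dots> \<le> Re (\<zeta> l)" using d(2) .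
    finally have sec: "Re (\<zeta> l) \<ge> \<kappa> * \<bar>Im (\<zeta> l)\<bar>" .
    have "R0 \<le> norm (\<zeta> l)" using \<open>norm (\<zeta> l) \<ge> norm (\<zeta> 0) / 4\<close> st(2) by (simp add: R_def)
    then have "norm (1 - b / \<zeta> l) \<le> 1 - c / norm (\<zeta> l)"
      using contr[OF _ _ sec, of b] b \<delta>(3) by simp
    also have "\<dots> \<le> 1 - c / (norm (\<zeta> 0) + 2 * real l)"
      using d(4) c \<open>R0 \<le> norm (\<zeta> l)\<close> R0 n4 by (intro diff_left_mono divide_left_mono mult_pos_pos) auto
    also have "\<dots> \<le> exp (- c / (norm (\<zeta> 0) + 2 * real l))"
      using exp_ge_add_one_self[of "- c / (norm (\<zeta> 0) + 2 * real l)"] by simp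
    finally show "norm (1 - b / \<zeta> l) \<le> exp (- c / (norm (\<zeta> 0) + 2 * real l))" .
  qed
  have bound: "r L \<le> K * r 0"
    if st: "Re (\<zeta> 0) > -1" "norm (\<zeta> 0) \<ge> R" and r: "\<And>l. r l \<ge> (0::real)"
      and dr: "\<And>l::nat. l < L \<Longrightarrow> norm (\<zeta> (Suc l) - \<zeta> l - 1) \<le> \<delta>"
      and sh: "\<And>l. l < L \<Longrightarrow> shrinks \<delta> \<beta> (\<zeta> l) (r l) (r (Suc l))" for \<zeta> r L
  proof -
    let ?n = "norm (\<zeta> 0)"
    define m where "m = nat \<lceil>(2 * \<kappa> + 2) * ?n\<rceil>"
    have n4: "?n \<ge> 4" using st(2) R0 by (simp add: R_def)
    have x0: "0 \<le> (2 * \<kappa> + 2) * ?n" using \<kappa> by simp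
    then have "real m \<le> (2 * \<kappa> + 2) * ?n + 1" unfolding m_def by linarith
    then have m: "real m \<le> (2 * \<kappa> + 3) * ?n" using n4 by (simp add: algebra_simps)
    have "r l \<le> exp (4 * B / ?n * min l m) * r 0" if "l \<le> L" for l
      using that
    proof (induction l)
      case (Suc l)
      obtain b where b: "norm (b - \<beta>) \<le> \<delta>" "r (Suc l) \<le> r l * norm (1 - b / \<zeta> l)"
        using sh[of l] Suc.prems by (auto simp: shrinks_def)
      show ?case
      proof (cases "l < m")
        case True
        have "r (Suc l) \<le> r l * exp (4 * B / ?n)"
          using b grow[where \<zeta> = \<zeta> and l = l and b = b] st dr Suc.prems r[of l]
          by (intro order_trans[OF b(2)] mult_left_mono) auto
        also have "\<dots> \<le> exp (4 * B / ?n * min l m) * r 0 * exp (4 * B / ?n)"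
          using Suc by (intro mult_right_mono) auto
        also have "\<dots> = exp (4 * B / ?n * min (Suc l) m) * r 0"
          using True by (simp add: exp_add[symmetric] algebra_simps add_divide_distrib)
        finally show ?thesis .
      next
        case False
        then have "real l \<ge> (2 * \<kappa> + 2) * ?n" unfolding m_def by linarith
        then have "norm (1 - b / \<zeta> l) \<le> exp (- c / (?n + 2 * real l))"
          using late[where \<zeta> = \<zeta> and l = l and b = b] b(1) st dr Suc.prems by auto
        also have "\<dots> \<le> 1" using c n4 by simp
        finally have "r (Suc l) \<le> r l"
          using b(2) mult_left_mono[of "norm (1 - b / \<zeta> l)" 1 "r l"] r[of l] by simp
        then show ?thesis using Suc False by simp
      qed
    qed simp
    from this[of L] have "r L \<le> exp (4 * B / ?n * min L m) * r 0" by simp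
    also have "\<dots> \<le> K * r 0"
    proof -
      have "4 * B / ?n * min L m \<le> 4 * B / ?n * ((2 * \<kappa> + 3) * ?n)"
        using B m by (intro mult_left_mono) auto
      also have "\<dots> = 4 * B * (2 * \<kappa> + 3)" using n4 by auto
      finally show ?thesis using r[of 0] unfolding K_def by (intro mult_right_mono) auto
    qed
    finally show ?thesis .
  qed
  have lim: "r \<longlonglongrightarrow> 0"
    if st: "Re (\<zeta> 0) > -1" "norm (\<zeta> 0) \<ge> R" and r: "\<And>l. r l \<ge> (0::real)"
      and dr: "\<And>l::nat. norm (\<zeta> (Suc l) - \<zeta> l - 1) \<le> \<delta>"
      and sh: "\<And>l. shrinks \<delta> \<beta> (\<zeta> l) (r l) (r (Suc l))" for \<zeta> r
  proof -
    let ?n = "norm (\<zeta> 0)"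
    define m where "m = nat \<lceil>(2 * \<kappa> + 2) * ?n\<rceil>"
    have n4: "?n \<ge> 4" using st(2) R0 by (simp add: R_def)
    define s where "s j = (\<Sum>i<j. c / (?n + 2 * real (m + i)))" for j
    have rb: "r (m + j) \<le> r m * exp (- s j)" for j
    proof (induction j)
      case (Suc j)
      obtain b where b: "norm (b - \<beta>) \<le> \<delta>" "r (Suc (m+j)) \<le> r (m+j) * norm (1 - b / \<zeta> (m+j))"
        using sh[of "m+j"] by (auto simp: shrinks_def)
      have "real (m+j) \<ge> (2 * \<kappa> + 2) * ?n" unfolding m_def by linarith
      then have "norm (1 - b / \<zeta> (m+j)) \<le> exp (- c / (?n + 2 * real (m+j)))"
        using late[where \<zeta> = \<zeta> and l = "m+j" and b = b] b(1) st dr by auto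
      then have "r (Suc (m+j)) \<le> r (m+j) * exp (- c / (?n + 2 * real (m+j)))"
        using r by (intro order_trans[OF b(2)] mult_left_mono) auto
      also have "\<dots> \<le> r m * exp (- s j) * exp (- c / (?n + 2 * real (m+j)))"
        using Suc by (intro mult_right_mono) auto
      also have "\<dots> = r m * exp (- s (Suc j))" by (simp add: s_def exp_add[symmetric] exp_diff exp_minus divide_simps)
      finally show ?case by simp
    qed (simp add: s_def)
    have not_sm: "\<not> summable (\<lambda>i. c / (?n + 2 * real (m + i)))"
    proof
      assume *: "summable (\<lambda>i. c / (?n + 2 * real (m + i)))"
      define C where "C = (?n + 2 * m + 2) / c"
      have Cp: "C > 0" using c n4 by (simp add: C_def add_pos_nonneg)
      have "summable (\<lambda>i. inverse (of_nat (Suc i)) :: real)"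
      proof (rule summable_comparison_test'[OF summable_mult[OF *, of C], of 0])
        fix i :: nat
        have "?n + 2 * real (m + i) \<le> (?n + 2 * m + 2) * real (Suc i)"
          using n4 by (simp add: algebra_simps)
        then show "norm (inverse (real (Suc i))) \<le> C * (c / (?n + 2 * real (m + i)))"
          using c n4 by (simp add: C_def divide_simps mult.commute)
      qed
      then show False
        using not_summable_harmonic[where 'a=real] summable_Suc_iff[of "\<lambda>i. inverse (of_nat i) :: real"] by simp
    qed
    have "filterlim s at_top sequentially"
      unfolding filterlim_at_top eventually_sequentially
    proof
      fix Z
      have nonneg: "0 \<le> c / (?n + 2 * real (m + i))" for i using c by simp
      obtain N where "\<not> s N \<le> Z"
        using summableI_nonneg_bounded[OF nonneg, of "\<lambda>i. i" Z] not_sm unfolding s_def by blast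
      moreover have "s N \<le> s n" if "n \<ge> N" for n
        unfolding s_def using that nonneg by (intro sum_mono2) auto
      ultimately show "\<exists>N. \<forall>n\<ge>N. Z \<le> s n" by (meson linorder_linear order_trans)
    qed
    then have "(\<lambda>j. r m * exp (- s j)) \<longlonglongrightarrow> r m * 0"
      by (intro tendsto_intros filterlim_compose[OF exp_at_bot] filterlim_compose[OF filterlim_uminus_at_bot_at_top])
    then have "(\<lambda>j. r (m + j)) \<longlonglongrightarrow> 0"
      using rb r by (intro tendsto_sandwich[of "\<lambda>_. 0" "\<lambda>j. r (m+j)" _ "\<lambda>j. r m * exp (- s j)"]) auto
    then show ?thesis using LIMSEQ_offset[of r m 0] by (simp add: add.commute)
  qed
  show ?thesis
    by (rule that[OF \<delta>(1) K, of R]) (use bound lim in \<open>auto simp: drift_control_def\<close>)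
qed

text \<open>All coordinates have to be controlled with the same constants.\<close>

lemma drifting_contraction_uniform:
  fixes \<beta> :: "'n::finite \<Rightarrow> complex"
  assumes "\<And>s. Re (\<beta> s) > 0"
  obtains \<delta> R K where "0 < \<delta>" "1 \<le> K" "\<And>s. drift_control \<delta> R K (\<beta> s)"
proof -
  have "\<exists>\<delta> R K. 0 < \<delta> \<and> 1 \<le> K \<and> drift_control \<delta> R K (\<beta> s)" for s
    using drifting_contraction[OF assms] by metis
  then obtain \<delta> R K where *: "\<And>s. 0 < \<delta> s" "\<And>s. 1 \<le> K s" "\<And>s. drift_control (\<delta> s) (R s) (K s) (\<beta> s)"
    by metis
  let ?K = "Max (range K)"
  have "1 \<le> ?K" using *(2) by (meson Max_ge UNIV_I finite finite_imageI image_eqI order_trans)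
  moreover have "drift_control (Min (range \<delta>)) (Max (range R)) ?K (\<beta> s)" for s
    by (rule drift_control_weaken[OF *(3)]) auto
  ultimately show ?thesis using that[of "Min (range \<delta>)" ?K] *(1) by auto
qed

section \<open>The Fatou coordinate of a parabolic germ\<close>

text \<open>Factors \<open>1 + a m + o(m)\<close> multiply by adding the coefficients \<open>a\<close>; this carries the asymptotics from the
coordinates to the resonant monomial.\<close>

lemma relative_increment_mult:
  fixes p q m :: "'a \<Rightarrow> 'b::real_normed_field"
  assumes "((\<lambda>x. (p x - 1) / m x) \<longlongrightarrow> a) F" "((\<lambda>x. (q x - 1) / m x) \<longlongrightarrow> b) F" "(m \<longlongrightarrow> 0) F"
    and nz: "\<forall>\<^sub>F x in F. m x \<noteq> 0"
  shows "((\<lambda>x. (p x * q x - 1) / m x) \<longlongrightarrow> a + b) F"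
proof -
  have "((\<lambda>x. (p x - 1) / m x + (q x - 1) / m x + ((p x - 1) / m x) * ((q x - 1) / m x) * m x) \<longlongrightarrow> a + b + a * b * 0) F"
    by (intro tendsto_intros assms)
  then have "((\<lambda>x. (p x - 1) / m x + (q x - 1) / m x + ((p x - 1) / m x) * ((q x - 1) / m x) * m x) \<longlongrightarrow> a + b) F"
    by simp
  then show ?thesis
    by (rule Lim_transform_eventually) (use nz in \<open>eventually_elim, simp add: field_simps\<close>)
qed

lemma relative_increment_prod:
  fixes p :: "'i \<Rightarrow> 'a \<Rightarrow> 'b::real_normed_field"
  assumes "finite I" "\<And>i. i \<in> I \<Longrightarrow> ((\<lambda>x. (p i x - 1) / m x) \<longlongrightarrow> a i) F"
    and m: "(m \<longlongrightarrow> 0) F" "\<forall>\<^sub>F x in F. m x \<noteq> 0"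
  shows "((\<lambda>x. ((\<Prod>i\<in>I. p i x) - 1) / m x) \<longlongrightarrow> (\<Sum>i\<in>I. a i)) F"
  using assms(1,2) by (induction I rule: finite_induct) (auto intro: relative_increment_mult m)

lemma relative_increment_power:
  fixes p :: "'a \<Rightarrow> 'b::real_normed_field"
  assumes "((\<lambda>x. (p x - 1) / m x) \<longlongrightarrow> a) F"
    and m: "(m \<longlongrightarrow> 0) F" "\<forall>\<^sub>F x in F. m x \<noteq> 0"
  shows "((\<lambda>x. (p x ^ n - 1) / m x) \<longlongrightarrow> of_nat n * a) F"
  using relative_increment_prod[of "{..<n}" "\<lambda>_. p" m "\<lambda>_. a" F] assms by simp

lemma relative_increment_tendsto_1:
  fixes p :: "'a \<Rightarrow> 'b::real_normed_field"
  assumes "((\<lambda>x. (p x - 1) / m x) \<longlongrightarrow> a) F"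
    and m: "(m \<longlongrightarrow> 0) F" "\<forall>\<^sub>F x in F. m x \<noteq> 0"
  shows "(p \<longlongrightarrow> 1) F"
proof -
  have "((\<lambda>x. 1 + (p x - 1) / m x * m x) \<longlongrightarrow> 1 + a * 0) F"
    by (intro tendsto_intros assms)
  then have "((\<lambda>x. 1 + (p x - 1) / m x * m x) \<longlongrightarrow> 1) F" by simp
  then show ?thesis
    by (rule Lim_transform_eventually) (use m(2) in \<open>eventually_elim, simp\<close>)
qed

text \<open>The coordinate in which \<open>u \<mapsto> u + A u^(k+1) + \<dots>\<close> becomes the translation by \<open>1\<close> up to \<open>o(1)\<close>.\<close>

definition fatou_coord :: "nat \<Rightarrow> complex \<Rightarrow> complex \<Rightarrow> complex" where
  "fatou_coord k A u = - 1 / (of_nat k * A * u ^ k)"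

lemma power_filter_0:
  assumes "k \<ge> 1"
  shows "((\<lambda>u::complex. u ^ k) \<longlongrightarrow> 0) (at 0)" "\<forall>\<^sub>F u::complex in at 0. u ^ k \<noteq> 0"
proof -
  have "((\<lambda>u::complex. u ^ k) \<longlongrightarrow> 0 ^ k) (at 0)" by (intro tendsto_intros)
  then show "((\<lambda>u::complex. u ^ k) \<longlongrightarrow> 0) (at 0)" using assms by (simp add: power_0_left)
  show "\<forall>\<^sub>F u::complex in at 0. u ^ k \<noteq> 0"
    using eventually_neq_at_within[of 0] by eventually_elim simp
qed

lemma fatou_translation:
  assumes k: "k \<ge> 1" and A: "A \<noteq> 0"
    and h: "((\<lambda>u. (h u - 1) / u ^ k) \<longlongrightarrow> A) (at 0)"
  shows "((\<lambda>u. fatou_coord k A (u * h u) - fatou_coord k A u) \<longlongrightarrow> 1) (at 0)"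
proof -
  note m = power_filter_0[OF k]
  have hk: "((\<lambda>u. (h u ^ k - 1) / u ^ k) \<longlongrightarrow> of_nat k * A) (at 0)"
    by (rule relative_increment_power[OF h m])
  have h1: "((\<lambda>u. h u ^ k) \<longlongrightarrow> 1) (at 0)"
    by (rule relative_increment_tendsto_1[OF hk m])
  have "((\<lambda>u. ((h u ^ k - 1) / u ^ k) / (h u ^ k) / (of_nat k * A)) \<longlongrightarrow> (of_nat k * A) / 1 / (of_nat k * A)) (at 0)"
    using k A by (intro tendsto_intros hk h1) auto
  then have "((\<lambda>u. ((h u ^ k - 1) / u ^ k) / (h u ^ k) / (of_nat k * A)) \<longlongrightarrow> 1) (at 0)"
    using k A by simp
  moreover have "\<forall>\<^sub>F u in at 0. h u ^ k \<noteq> 0"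
    by (rule tendsto_imp_eventually_ne[OF h1]) simp
  then have "\<forall>\<^sub>F u in at 0. ((h u ^ k - 1) / u ^ k) / (h u ^ k) / (of_nat k * A) =
      fatou_coord k A (u * h u) - fatou_coord k A u"
    using m(2) by eventually_elim (use k A in \<open>simp add: fatou_coord_def power_mult_distrib field_simps\<close>)
  ultimately show ?thesis by (rule Lim_transform_eventually)
qed

lemma fatou_multiplier:
  assumes k: "k \<ge> 1" and A: "A \<noteq> 0"
    and g: "((\<lambda>u. g u / u ^ k) \<longlongrightarrow> a) (at 0)"
  shows "((\<lambda>u. fatou_coord k A u * g u) \<longlongrightarrow> - (a / (of_nat k * A))) (at 0)"
proof -
  have "((\<lambda>u. - ((g u / u ^ k) / (of_nat k * A))) \<longlongrightarrow> - (a / (of_nat k * A))) (at 0)"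
    using k A by (intro tendsto_intros g) auto
  then show ?thesis by (rule Lim_transform_eventually) (simp add: fatou_coord_def field_simps)
qed

text \<open>For the inverse map the roles of source and target are exchanged: the multiplier \<open>1/(1 + g u)\<close> is to be expressed
through the Fatou coordinate of the image point \<open>u * h u\<close>, with the opposite sign.\<close>

lemma fatou_inverse_multiplier:
  assumes k: "k \<ge> 1" and A: "A \<noteq> 0"
    and h: "((\<lambda>u. (h u - 1) / u ^ k) \<longlongrightarrow> A) (at 0)"
    and g: "((\<lambda>u. g u / u ^ k) \<longlongrightarrow> a) (at 0)"
  shows "((\<lambda>u. - fatou_coord k A (u * h u) * (1 - 1 / (1 + g u))) \<longlongrightarrow> a / (of_nat k * A)) (at 0)"
    and "\<forall>\<^sub>F u in at 0. 1 + g u \<noteq> 0"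
proof -
  note m = power_filter_0[OF k]
  have h1: "(h \<longlongrightarrow> 1) (at 0)" by (rule relative_increment_tendsto_1[OF h m])
  have g1: "((\<lambda>u. 1 + g u) \<longlongrightarrow> 1) (at 0)" by (rule relative_increment_tendsto_1[OF _ m]) (use g in simp)
  show nz: "\<forall>\<^sub>F u in at 0. 1 + g u \<noteq> 0" using tendsto_imp_eventually_ne[OF g1] by simp
  have "((\<lambda>u. - (fatou_coord k A u * g u) / (h u ^ k * (1 + g u))) \<longlongrightarrow> - (- (a / (of_nat k * A))) / (1 ^ k * 1)) (at 0)"
    by (intro tendsto_intros fatou_multiplier[OF k A g] h1 g1) auto
  then have "((\<lambda>u. - (fatou_coord k A u * g u) / (h u ^ k * (1 + g u))) \<longlongrightarrow> a / (of_nat k * A)) (at 0)"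
    by simp
  then show "((\<lambda>u. - fatou_coord k A (u * h u) * (1 - 1 / (1 + g u))) \<longlongrightarrow> a / (of_nat k * A)) (at 0)"
    by (rule Lim_transform_eventually)
      (use nz in \<open>eventually_elim, simp add: fatou_coord_def power_mult_distrib field_simps\<close>)
qed

lemma fatou_large:
  assumes "1 \<le> k" "A \<noteq> 0"
  shows "\<forall>\<^sub>F u in at 0. R \<le> norm (fatou_coord k A u)"
proof -
  have "((\<lambda>u. norm (of_nat k * A * u ^ k)) \<longlongrightarrow> norm (of_nat k * A * 0 ^ k)) (at 0)"
    by (intro tendsto_intros)
  then have "((\<lambda>u. norm (of_nat k * A * u ^ k)) \<longlongrightarrow> 0) (at 0)" using assms by (simp add: power_0_left)
  then have "\<forall>\<^sub>F u in at 0. norm (of_nat k * A * u ^ k) < 1 / (\<bar>R\<bar> + 1)"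
    by (rule order_tendstoD(2)) simp
  then show ?thesis using eventually_neq_at_within[of 0]
  proof eventually_elim
    case (elim u)
    define q where "q = norm (of_nat k * A * u ^ k)"
    have q: "q > 0" using elim assms by (simp add: q_def)
    have "(\<bar>R\<bar> + 1) * q < 1" using elim(1)[folded q_def] by (simp add: pos_less_divide_eq mult.commute)
    then have "\<bar>R\<bar> + 1 < 1 / q" using q by (simp add: field_simps)
    then show ?case by (simp add: fatou_coord_def norm_divide q_def[symmetric])
  qed
qed

section \<open>Basins swept out by half-planes\<close>

text \<open>As long as an orbit stays in the region \<open>P\<close> where the step estimates hold, the drift bound multiplies the coordinates by at most
\<open>K\<close>; started in the region of radius \<open>\<rho>/K\<close>, the orbit therefore never leaves \<open>P\<close>. The basin is the union of the forward
images of \<open>X\<close>; since \<open>H\<close> is an open map on \<open>P\<close>, it is open.\<close>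

lemma basin_of_half_plane:
  fixes H w :: "complex^'n \<Rightarrow> complex^'n" and Z :: "complex^'n \<Rightarrow> complex"
    and \<rho> :: real and Y :: "(complex^'n) set"
  defines "P \<equiv> {z \<in> Y. \<forall>s. norm (w z $ s) < \<rho>}"
  assumes ctrl: "\<And>s. drift_control \<delta> R K (\<beta> s)" and K: "1 \<le> K"
    and stay: "\<And>z. z \<in> P \<Longrightarrow> H z \<in> Y"
    and far: "\<And>z. z \<in> P \<Longrightarrow> R \<le> norm (Z z)"
    and drift: "\<And>z. z \<in> P \<Longrightarrow> norm (Z (H z) - Z z - 1) \<le> \<delta>"
    and shr: "\<And>z s. z \<in> P \<Longrightarrow> shrinks \<delta> (\<beta> s) (Z z) (norm (w z $ s)) (norm (w (H z) $ s))"
    and open_map: "\<And>S. open S \<Longrightarrow> S \<subseteq> P \<Longrightarrow> open (H ` S)"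
    and dom: "P \<subseteq> Dom"
    and conv: "\<And>x :: nat \<Rightarrow> complex^'n. (\<And>l. x l \<in> P) \<Longrightarrow> (\<And>s. (\<lambda>l. norm (w (x l) $ s)) \<longlonglongrightarrow> 0) \<Longrightarrow> x \<longlonglongrightarrow> 0"
    and X: "open X" "X \<noteq> {}" "X \<subseteq> {z \<in> Y. (\<forall>s. norm (w z $ s) < \<rho> / K) \<and> Re (Z z) > -1}"
  obtains U where "attracting_basin H Dom U" "X \<subseteq> U" "U \<subseteq> P"
proof -
  have small: "\<rho> / K \<le> \<rho>" if "z \<in> X" for z
  proof -
    have "0 < \<rho> / K" using X(3) that by (smt (verit) mem_Collect_eq norm_ge_zero subsetD)
    then have "0 < \<rho>" using K by (simp add: zero_less_divide_iff)
    then show ?thesis using K by (simp add: divide_le_eq mult_le_cancel_left1)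
  qed
  have XP: "X \<subseteq> P"
  proof
    fix z assume z: "z \<in> X"
    then have "z \<in> Y" "\<And>s. norm (w z $ s) < \<rho> / K" using X(3) by auto
    then show "z \<in> P" using small[OF z] unfolding P_def by (auto intro: less_le_trans)
  qed
  have orbit: "(H ^^ l) z \<in> P" if z: "z \<in> X" for z l
  proof (induction l rule: less_induct)
    case (less l)
    show ?case
    proof (cases l)
      case 0
      then show ?thesis using XP z by auto
    next
      case (Suc m)
      have "(H ^^ l) z \<in> Y" using stay[OF less[of m]] Suc by simp
      moreover have "norm (w ((H ^^ l) z) $ s) < \<rho>" for s
      proof -
        have "Re (Z ((H ^^ 0) z)) > -1" "R \<le> norm (Z ((H ^^ 0) z))"
          using z X(3) far[of z] XP by auto
        with ctrl[of s, unfolded drift_control_def, THEN spec[of _ "\<lambda>l. Z ((H ^^ l) z)"],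
            THEN spec[of _ "\<lambda>l. norm (w ((H ^^ l) z) $ s)"]]
        have "norm (w ((H ^^ l) z) $ s) \<le> K * norm (w ((H ^^ 0) z) $ s)"
          using drift[OF less] shr[OF less] by auto
        also have "\<dots> < K * (\<rho> / K)" using z X(3) K by (intro mult_strict_left_mono) auto
        finally show ?thesis using K by simp
      qed
      ultimately show ?thesis by (simp add: P_def)
    qed
  qed
  have lim: "(\<lambda>l. (H ^^ l) z) \<longlonglongrightarrow> 0" if z: "z \<in> X" for z
  proof (rule conv[OF orbit[OF z]])
    fix s
    have "Re (Z ((H ^^ 0) z)) > -1" "R \<le> norm (Z ((H ^^ 0) z))"
      using z X(3) far[of z] XP by auto
    with ctrl[of s, unfolded drift_control_def, THEN spec[of _ "\<lambda>l. Z ((H ^^ l) z)"],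
        THEN spec[of _ "\<lambda>l. norm (w ((H ^^ l) z) $ s)"]]
    show "(\<lambda>l. norm (w ((H ^^ l) z) $ s)) \<longlonglongrightarrow> 0"
      using drift[OF orbit[OF z]] shr[OF orbit[OF z]] by auto
  qed
  define U where "U = (\<Union>l. (H ^^ l) ` X)"
  have "open ((H ^^ l) ` X)" for l
  proof (induction l)
    case (Suc l)
    have "(H ^^ Suc l) ` X = H ` (H ^^ l) ` X" by auto
    then show ?case using open_map[OF Suc] orbit by auto
  qed (use X in auto)
  then have "open U" by (auto simp: U_def)
  have UP: "U \<subseteq> P" using orbit by (auto simp: U_def)
  have XU: "X \<subseteq> U"
  proof
    fix z assume "z \<in> X"
    then have "(H ^^ 0) z \<in> (H ^^ 0) ` X" by (rule imageI)
    then show "z \<in> U" unfolding U_def by (metis UNIV_I UN_I funpow_0)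
  qed
  have HU: "H z \<in> U" if "z \<in> U" for z
  proof -
    obtain l x where "x \<in> X" "z = (H ^^ l) x" using \<open>z \<in> U\<close> by (auto simp: U_def)
    then have "H z \<in> (H ^^ Suc l) ` X" by auto
    then show ?thesis unfolding U_def by blast
  qed
  have Ulim: "(\<lambda>m. (H ^^ m) z) \<longlonglongrightarrow> 0" if "z \<in> U" for z
  proof -
    obtain l x where x: "x \<in> X" "z = (H ^^ l) x" using \<open>z \<in> U\<close> by (auto simp: U_def)
    have "(\<lambda>m. (H ^^ (m + l)) x) \<longlonglongrightarrow> 0" using LIMSEQ_ignore_initial_segment[OF lim[OF x(1)]] .
    then show ?thesis by (simp add: x(2) funpow_add)
  qed
  have "0 \<in> closure U"
  proof -
    obtain z where z: "z \<in> U" using X XU by auto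
    have "(H ^^ m) z \<in> U" for m using z by (induction m) (auto intro: HU)
    then show ?thesis unfolding closure_sequential using Ulim[OF z] by (intro exI[of _ "\<lambda>m. (H ^^ m) z"]) auto
  qed
  then have "attracting_basin H Dom U"
    using \<open>open U\<close> X(2) XU UP dom HU Ulim unfolding attracting_basin_def by blast
  then show ?thesis using that XU UP by blast
qed

section \<open>Monomials and orders of vanishing\<close>

lemma monom_at_0 [simp]: "monom_at z 0 = 1"
  by (simp add: monom_at_def)

lemma monom_at_add: "monom_at z (P + Q) = monom_at z P * monom_at z Q"
  by (simp add: monom_at_def power_add prod.distrib)

lemma monom_at_smult: "monom_at z (k *s Q) = monom_at z Q ^ k"
  by (simp add: monom_at_def power_mult[symmetric] mult.commute prod_power_distrib)

lemma monom_at_axis [simp]: "monom_at z (axis s 1) = z $ s"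
proof -
  have "monom_at z (axis s 1) = (\<Prod>h\<in>UNIV. if h = s then z $ h else 1)"
    unfolding monom_at_def by (intro prod.cong) (auto simp: axis_def)
  then show ?thesis by simp
qed

lemma monom_at_sum: "monom_at z (\<Sum>x\<in>A. m x) = (\<Prod>x\<in>A. monom_at z (m x))"
  by (induction A rule: infinite_finite_induct) (auto simp: monom_at_add)

lemma monom_at_mult: "monom_at (\<chi> h. a $ h * b $ h) Q = monom_at a Q * monom_at b Q"
  by (simp add: monom_at_def power_mult_distrib prod.distrib)

lemma mdeg_0 [simp]: "mdeg 0 = 0"
  by (simp add: mdeg_def)

lemma mdeg_add: "mdeg (P + Q) = mdeg P + mdeg Q"
  by (simp add: mdeg_def sum.distrib)

lemma mdeg_smult: "mdeg (k *s Q) = k * mdeg Q"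
  by (simp add: mdeg_def sum_distrib_left)

lemma mdeg_axis [simp]: "mdeg (axis s 1) = 1"
proof -
  have "mdeg (axis s 1) = (\<Sum>h\<in>UNIV. if h = s then 1 else 0)"
    unfolding mdeg_def by (intro sum.cong) (auto simp: axis_def)
  then show ?thesis by simp
qed

lemma mdeg_sum: "mdeg (\<Sum>x\<in>A. m x) = (\<Sum>x\<in>A. mdeg (m x))"
  by (induction A rule: infinite_finite_induct) (auto simp: mdeg_add)

lemmas [simp] = monom_at_axis[unfolded One_nat_def] mdeg_axis[unfolded One_nat_def]

lemma mdeg_eq_0_iff [simp]: "mdeg Q = 0 \<longleftrightarrow> Q = 0"
  by (auto simp: mdeg_def vec_eq_iff)

lemma finite_mdeg_le: "finite {Q :: nat^'n. mdeg Q \<le> d}"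
proof (rule finite_subset)
  show "{Q :: nat^'n. mdeg Q \<le> d} \<subseteq> vec_lambda ` (Pi\<^sub>E UNIV (\<lambda>_. {..d}))"
  proof
    fix Q :: "nat^'n" assume "Q \<in> {Q. mdeg Q \<le> d}"
    then have "Q $ h \<le> d" for h
      using member_le_sum[of h UNIV "\<lambda>h. Q $ h"] by (auto simp: mdeg_def)
    then show "Q \<in> vec_lambda ` (Pi\<^sub>E UNIV (\<lambda>_. {..d}))"
      by (intro image_eqI[of _ _ "\<lambda>h. Q $ h"]) auto
  qed
qed (rule finite_imageI, rule finite_PiE, auto)

lemma mdeg_eq_1_imp_axis:
  assumes "mdeg Q = 1"
  obtains h where "Q = axis h 1"
proof -
  obtain h where h: "Q $ h \<noteq> 0" using assms by (metis mdeg_eq_0_iff vec_eq_iff zero_index zero_neq_one)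
  have "(\<Sum>i\<in>UNIV. Q $ i) = Q $ h + (\<Sum>i\<in>UNIV - {h}. Q $ i)" by (simp add: sum.remove)
  then have "Q $ h = 1" "(\<Sum>i\<in>UNIV - {h}. Q $ i) = 0" using assms h unfolding mdeg_def by linarith+
  then have "Q $ i = (if i = h then 1 else 0)" for i by auto
  then have "Q = axis h 1" by (auto simp: vec_eq_iff axis_def)
  then show ?thesis using that by blast
qed

lemma norm_monom_at_le:
  assumes "\<And>h. norm (z $ h) \<le> r"
  shows "norm (monom_at z Q) \<le> r ^ mdeg Q"
proof -
  have "norm (monom_at z Q) = (\<Prod>h\<in>UNIV. norm (z $ h) ^ (Q $ h))"
    by (simp add: monom_at_def prod_norm[symmetric] norm_power)
  also have "\<dots> \<le> (\<Prod>h\<in>UNIV. r ^ (Q $ h))"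
    using assms by (intro prod_mono) (auto intro: power_mono)
  also have "\<dots> = r ^ mdeg Q" by (simp add: mdeg_def power_sum)
  finally show ?thesis .
qed

text \<open>\<open>f = O(|z|^m)\<close> at the origin.\<close>

definition vanishes :: "nat \<Rightarrow> ('a::real_normed_vector \<Rightarrow> complex) \<Rightarrow> bool" where
  "vanishes m f \<longleftrightarrow> (\<exists>C. \<forall>\<^sub>F z in nhds 0. norm (f z) \<le> C * norm z ^ m)"

lemma vanishesI_bound: "\<forall>\<^sub>F z in nhds 0. norm (f z) \<le> C * norm z ^ m \<Longrightarrow> vanishes m f"
  by (auto simp: vanishes_def)

lemma vanishes_cong:
  assumes "vanishes m f" "\<forall>\<^sub>F z in nhds 0. f z = g z"
  shows "vanishes m g"
proof -
  obtain C where "\<forall>\<^sub>F z in nhds 0. norm (f z) \<le> C * norm z ^ m"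
    using assms(1) by (auto simp: vanishes_def)
  with assms(2) have "\<forall>\<^sub>F z in nhds 0. norm (g z) \<le> C * norm z ^ m" by eventually_elim auto
  then show ?thesis by (rule vanishesI_bound)
qed

lemma vanishes_0 [simp]: "vanishes m (\<lambda>_. 0)"
  by (auto simp: vanishes_def intro!: exI[of _ 0])

lemma vanishes_const [simp]: "vanishes 0 (\<lambda>_. c)"
  by (auto simp: vanishes_def)

lemma vanishes_add:
  assumes "vanishes m f" "vanishes m g" shows "vanishes m (\<lambda>z. f z + g z)"
proof -
  obtain B C where "\<forall>\<^sub>F z in nhds 0. norm (f z) \<le> B * norm z ^ m"
    "\<forall>\<^sub>F z in nhds 0. norm (g z) \<le> C * norm z ^ m" using assms by (auto simp: vanishes_def)
  then have "\<forall>\<^sub>F z in nhds 0. norm (f z + g z) \<le> (B + C) * norm z ^ m"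
    by eventually_elim (metis add_mono norm_triangle_le distrib_right)
  then show ?thesis by (rule vanishesI_bound)
qed

lemma vanishes_mult:
  assumes "vanishes m f" "vanishes n g" shows "vanishes (m + n) (\<lambda>z. f z * g z)"
proof -
  obtain B C where "\<forall>\<^sub>F z in nhds 0. norm (f z) \<le> B * norm z ^ m"
    "\<forall>\<^sub>F z in nhds 0. norm (g z) \<le> C * norm z ^ n" using assms by (auto simp: vanishes_def)
  then have "\<forall>\<^sub>F z in nhds 0. norm (f z * g z) \<le> (B * C) * norm z ^ (m + n)"
  proof eventually_elim
    case (elim z)
    have "norm (f z * g z) \<le> (B * norm z ^ m) * (C * norm z ^ n)"
      unfolding norm_mult using elim
      by (intro mult_mono) (auto intro: order_trans[OF norm_ge_zero])
    then show ?case by (simp add: power_add algebra_simps)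
  qed
  then show ?thesis by (rule vanishesI_bound)
qed

lemma vanishes_mono:
  assumes "vanishes m f" "n \<le> m" shows "vanishes n f"
proof -
  obtain C where C: "\<forall>\<^sub>F z in nhds 0. norm (f z) \<le> C * norm z ^ m"
    using assms by (auto simp: vanishes_def)
  have "\<forall>\<^sub>F z in nhds (0::'a). norm z < 1"
    by (auto simp: eventually_nhds_metric intro!: exI[of _ 1])
  with C have "\<forall>\<^sub>F z in nhds 0. norm (f z) \<le> max C 0 * norm z ^ n"
  proof eventually_elim
    case (elim z)
    have "C * norm z ^ m \<le> max C 0 * norm z ^ m" by (intro mult_right_mono) auto
    also have "\<dots> \<le> max C 0 * norm z ^ n"
      using elim assms by (intro mult_left_mono power_decreasing) auto
    finally show ?case using elim by linarith
  qed
  then show ?thesis by (rule vanishesI_bound)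
qed

lemma vanishes_cmult: "vanishes m f \<Longrightarrow> vanishes m (\<lambda>z. c * f z)"
  using vanishes_mult[of 0 "\<lambda>_. c" m f] by simp

lemma vanishes_minus: "vanishes m f \<Longrightarrow> vanishes m (\<lambda>z. - f z)"
  using vanishes_cmult[of m f "-1"] by simp

lemma vanishes_diff: "vanishes m f \<Longrightarrow> vanishes m g \<Longrightarrow> vanishes m (\<lambda>z. f z - g z)"
  using vanishes_add[of m f "\<lambda>z. - g z"] vanishes_minus[of m g] by simp

lemma vanishes_sum: "(\<And>i. i \<in> I \<Longrightarrow> vanishes m (f i)) \<Longrightarrow> vanishes m (\<lambda>z. \<Sum>i\<in>I. f i z)"
  by (induction I rule: infinite_finite_induct) (auto intro: vanishes_add)

lemma vanishes_prod:
  "(\<And>i. i \<in> I \<Longrightarrow> vanishes (m i) (f i)) \<Longrightarrow> vanishes (\<Sum>i\<in>I. m i) (\<lambda>z. \<Prod>i\<in>I. f i z)"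
  by (induction I rule: infinite_finite_induct) (auto intro: vanishes_mult)

lemma vanishes_monom_at: "vanishes (mdeg Q) (\<lambda>z. monom_at z Q)"
  by (rule vanishesI_bound[of _ 1]) (auto intro!: always_eventually norm_monom_at_le Finite_Cartesian_Product.norm_nth_le)

text \<open>Telescoping: the factors are exchanged one at a time.\<close>

lemma vanishes_prod_diff:
  assumes "finite I" "\<And>i. i \<in> I \<Longrightarrow> vanishes 0 (f i)" "\<And>i. i \<in> I \<Longrightarrow> vanishes 0 (g i)"
    "\<And>i. i \<in> I \<Longrightarrow> vanishes m (\<lambda>z. f i z - g i z)"
  shows "vanishes m (\<lambda>z. (\<Prod>i\<in>I. f i z) - (\<Prod>i\<in>I. g i z))"
  using assms
proof (induction I rule: finite_induct)
  case (insert i I)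
  have p: "vanishes 0 (\<lambda>z. \<Prod>i\<in>I. f i z)"
    using vanishes_prod[of I "\<lambda>_. 0" f] insert by simp
  have "vanishes (m + 0) (\<lambda>z. (f i z - g i z) * (\<Prod>i\<in>I. f i z))"
    using insert p by (intro vanishes_mult) auto
  moreover have "vanishes (0 + m) (\<lambda>z. g i z * ((\<Prod>i\<in>I. f i z) - (\<Prod>i\<in>I. g i z)))"
    using insert by (intro vanishes_mult) auto
  ultimately have "vanishes m (\<lambda>z. (f i z - g i z) * (\<Prod>i\<in>I. f i z) + g i z * ((\<Prod>i\<in>I. f i z) - (\<Prod>i\<in>I. g i z)))"
    by (intro vanishes_add) auto
  then show ?case using insert by (simp add: algebra_simps)
qed simp

section \<open>Formal composition and truncation\<close>

text \<open>The Taylor polynomial of degree \<open>d\<close>; on it formal identities become identities between functions up to \<open>O(|z|^(d+1))\<close>.\<close>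

definition trunc :: "nat \<Rightarrow> (nat^'n \<Rightarrow> complex^'n) \<Rightarrow> complex^'n \<Rightarrow> complex^'n" where
  "trunc d T z = (\<Sum>Q | mdeg Q \<le> d. monom_at z Q *s T Q)"

lemma trunc_nth: "trunc d T z $ s = (\<Sum>Q | mdeg Q \<le> d. monom_at z Q * T Q $ s)"
  by (simp add: trunc_def)

lemma vanishes_trunc: "vanishes 0 (\<lambda>z. trunc d T z $ s)"
  unfolding trunc_nth
proof (intro vanishes_sum)
  fix Q
  show "vanishes 0 (\<lambda>z. monom_at z Q * T Q $ s)"
    using vanishes_mult[OF vanishes_mono[OF vanishes_monom_at[of Q], of 0] vanishes_const[of "T Q $ s"]] by simp
qed

lemma card_factors: "card (factors P) = mdeg P" "finite (factors P)"
  by (auto simp: factors_def mdeg_def)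

text \<open>In a power with more than \<open>mdeg Q\<close> factors, one factor has to contribute its constant term.\<close>

lemma fpow_coeff_eq_0:
  assumes "T 0 = 0" "mdeg Q < mdeg P"
  shows "fpow_coeff T P Q = 0"
  unfolding fpow_coeff_def
proof (rule sum.neutral, rule ballI)
  fix m assume "m \<in> {m. m \<in> factors P \<rightarrow>\<^sub>E UNIV \<and> (\<Sum>x\<in>factors P. m x) = Q}"
  then have Q: "(\<Sum>x\<in>factors P. mdeg (m x)) = mdeg Q" by (auto simp: mdeg_sum[symmetric])
  have "\<exists>x\<in>factors P. m x = 0"
  proof (rule ccontr)
    assume "\<not> ?thesis"
    then have "(\<Sum>x\<in>factors P. 1) \<le> (\<Sum>x\<in>factors P. mdeg (m x))"
      by (intro sum_mono) (metis One_nat_def Suc_leI gr0I mdeg_eq_0_iff)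
    then show False using Q assms(2) by (simp add: card_factors)
  qed
  then show "(\<Prod>x\<in>factors P. T (m x) $ fst x) = 0"
    using assms(1) card_factors(2) by (metis (mono_tags, lifting) prod_zero zero_index)
qed

lemma monom_at_factors: "monom_at y P = (\<Prod>x\<in>factors P. y $ fst x)"
proof -
  have "(\<Prod>x\<in>factors P. y $ fst x) = (\<Prod>j\<in>UNIV. \<Prod>i\<in>{..<P $ j}. y $ j)"
    unfolding factors_def by (subst prod.Sigma) (auto simp: case_prod_unfold)
  then show ?thesis by (simp add: monom_at_def)
qed

text \<open>Expanding the product over all factors gives one monomial for each selection \<open>m\<close>. The selections of total exponent \<open>Q\<close> with
\<open>mdeg Q \<le> d\<close> involve only exponents of degree at most \<open>d\<close>, so they are exactly those counted by the formal coefficient.\<close>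

lemma monom_at_trunc:
  "vanishes (Suc d) (\<lambda>z. monom_at (trunc d T z) P - (\<Sum>Q | mdeg Q \<le> d. fpow_coeff T P Q * monom_at z Q))"
proof -
  define I where "I = {Q :: nat^'a. mdeg Q \<le> d}"
  define c where "c m = (\<Prod>x\<in>factors P. T (m x) $ fst x)" for m
  define tot where "tot m = (\<Sum>x\<in>factors P. m x)" for m :: "_ \<Rightarrow> nat^'a"
  let ?E = "Pi\<^sub>E (factors P) (\<lambda>_. I)"
  have fI: "finite I" by (simp add: I_def finite_mdeg_le)
  have fE: "finite ?E" using fI card_factors by (intro finite_PiE) auto
  have split: "?E = {m\<in>?E. tot m \<in> I} \<union> {m\<in>?E. tot m \<notin> I}" by auto
  have ms: "monom_at (trunc d T z) P = (\<Sum>m\<in>?E. c m * monom_at z (tot m))" for z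
  proof -
    have "monom_at (trunc d T z) P = (\<Prod>x\<in>factors P. \<Sum>Q\<in>I. monom_at z Q * T Q $ fst x)"
      by (simp add: monom_at_factors trunc_nth I_def)
    also have "\<dots> = (\<Sum>m\<in>?E. \<Prod>x\<in>factors P. monom_at z (m x) * T (m x) $ fst x)"
      using fI card_factors by (intro prod_sum_PiE) auto
    also have "\<dots> = (\<Sum>m\<in>?E. c m * monom_at z (tot m))"
      by (simp add: c_def tot_def monom_at_sum prod.distrib mult.commute)
    finally show ?thesis .
  qed
  have low: "(\<Sum>m | m \<in> ?E \<and> tot m \<in> I. c m * monom_at z (tot m)) =
      (\<Sum>Q | mdeg Q \<le> d. fpow_coeff T P Q * monom_at z Q)" for z
  proof -
    have "(\<Sum>m | m \<in> ?E \<and> tot m \<in> I. c m * monom_at z (tot m)) =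
        (\<Sum>Q\<in>I. \<Sum>m | m \<in> {m\<in>?E. tot m \<in> I} \<and> tot m = Q. c m * monom_at z (tot m))"
      using fE fI by (intro sum.group[symmetric]) auto
    also have "\<dots> = (\<Sum>Q\<in>I. fpow_coeff T P Q * monom_at z Q)"
    proof (rule sum.cong[OF refl])
      fix Q assume Q: "Q \<in> I"
      have "{m. m \<in> {m\<in>?E. tot m \<in> I} \<and> tot m = Q} = {m. m \<in> factors P \<rightarrow>\<^sub>E UNIV \<and> tot m = Q}" (is "?A = ?B")
      proof
        show "?A \<subseteq> ?B" by (auto simp: PiE_def)
        show "?B \<subseteq> ?A"
        proof
          fix m assume m: "m \<in> ?B"
          have "m x \<in> I" if x: "x \<in> factors P" for x
          proof -
            have "mdeg (m x) \<le> (\<Sum>x\<in>factors P. mdeg (m x))"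
              using x card_factors by (intro member_le_sum) auto
            also have "\<dots> = mdeg Q" using m by (auto simp: mdeg_sum[symmetric] tot_def)
            finally show ?thesis using Q by (simp add: I_def)
          qed
          then show "m \<in> ?A" using m Q by (auto simp: PiE_def)
        qed
      qed
      then show "(\<Sum>m | m \<in> {m\<in>?E. tot m \<in> I} \<and> tot m = Q. c m * monom_at z (tot m)) = fpow_coeff T P Q * monom_at z Q"
        unfolding fpow_coeff_def sum_distrib_right c_def[symmetric] tot_def[symmetric]
        by (intro sum.cong) auto
    qed
    finally show ?thesis by (simp add: I_def)
  qed
  have "monom_at (trunc d T z) P - (\<Sum>Q | mdeg Q \<le> d. fpow_coeff T P Q * monom_at z Q)
      = (\<Sum>m\<in>{m\<in>?E. tot m \<notin> I}. c m * monom_at z (tot m))" for z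
  proof -
    have "monom_at (trunc d T z) P = (\<Sum>m\<in>{m\<in>?E. tot m \<in> I}. c m * monom_at z (tot m)) + (\<Sum>m\<in>{m\<in>?E. tot m \<notin> I}. c m * monom_at z (tot m))"
      unfolding ms by (subst split, subst sum.union_disjoint) (use fE in auto)
    then show ?thesis using low[of z] by simp
  qed
  moreover have "vanishes (Suc d) (\<lambda>z. \<Sum>m\<in>{m\<in>?E. tot m \<notin> I}. c m * monom_at z (tot m))"
  proof (intro vanishes_sum vanishes_cmult)
    fix m assume "m \<in> {m\<in>?E. tot m \<notin> I}"
    then have "Suc d \<le> mdeg (tot m)" by (simp add: I_def)
    then show "vanishes (Suc d) (\<lambda>z. monom_at z (tot m))"
      using vanishes_mono[OF vanishes_monom_at] by blast
  qed
  ultimately show ?thesis by simp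
qed

text \<open>Formal composition computes the Taylor polynomial of a composition. This is the only bridge needed between formal
conjugations and actual maps.\<close>

lemma trunc_fcomp:
  fixes g :: "complex^'n \<Rightarrow> complex^'n"
  assumes T0: "T 0 = 0" and g: "\<And>s. vanishes (Suc d) (\<lambda>z. g z $ s - trunc d T z $ s)"
  shows "vanishes (Suc d) (\<lambda>z. trunc d G (g z) $ s - trunc d (fcomp G T) z $ s)"
proof -
  have g0: "vanishes 0 (\<lambda>z. g z $ s)" for s
    using vanishes_add[OF vanishes_mono[OF g[of s]] vanishes_trunc[of d T s]] by simp
  have mon: "vanishes (Suc d) (\<lambda>z. monom_at (g z) P - monom_at (trunc d T z) P)" for P
    unfolding monom_at_factors
    using g g0 vanishes_trunc card_factors by (intro vanishes_prod_diff) auto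
  have mon': "vanishes (Suc d) (\<lambda>z. monom_at (g z) P - (\<Sum>Q | mdeg Q \<le> d. fpow_coeff T P Q * monom_at z Q))" for P
    using vanishes_add[OF mon[of P] monom_at_trunc[of d T P]] by simp
  have "trunc d G (g z) $ s - trunc d (fcomp G T) z $ s =
      (\<Sum>P | mdeg P \<le> d. G P $ s * (monom_at (g z) P - (\<Sum>Q | mdeg Q \<le> d. fpow_coeff T P Q * monom_at z Q)))" for z
  proof -
    have "trunc d (fcomp G T) z $ s = (\<Sum>Q | mdeg Q \<le> d. \<Sum>P | mdeg P \<le> d. monom_at z Q * (fpow_coeff T P Q * G P $ s))"
      unfolding trunc_nth fcomp_def
    proof (rule sum.cong[OF refl])
      fix Q assume Q: "Q \<in> {Q :: nat^'n. mdeg Q \<le> d}"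
      have "(\<Sum>P | mdeg P \<le> mdeg Q. fpow_coeff T P Q *s G P) $ s = (\<Sum>P | mdeg P \<le> mdeg Q. fpow_coeff T P Q * G P $ s)"
        by simp
      also have "\<dots> = (\<Sum>P | mdeg P \<le> d. fpow_coeff T P Q * G P $ s)"
        using Q fpow_coeff_eq_0[of T, OF T0] by (intro sum.mono_neutral_left finite_mdeg_le) auto
      finally show "monom_at z Q * (\<Sum>P | mdeg P \<le> mdeg Q. fpow_coeff T P Q *s G P) $ s =
         (\<Sum>P | mdeg P \<le> d. monom_at z Q * (fpow_coeff T P Q * G P $ s))"
        by (simp add: sum_distrib_left)
    qed
    also have "\<dots> = (\<Sum>P | mdeg P \<le> d. \<Sum>Q | mdeg Q \<le> d. monom_at z Q * (fpow_coeff T P Q * G P $ s))"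
      by (rule sum.swap)
    finally show ?thesis
      by (simp add: trunc_nth sum_subtractf sum_distrib_left algebra_simps)
  qed
  then show ?thesis using mon' by (auto intro!: vanishes_sum vanishes_cmult)
qed

section \<open>Convergent expansions\<close>

lemma has_sum_vec_nth: "(f has_sum S) A \<Longrightarrow> ((\<lambda>x. f x $ s) has_sum (S $ s)) A" for f :: "_ \<Rightarrow> complex^'n"
  by (rule has_sum_bounded_linear[OF bounded_linear_vec_nth])

lemma norm_le_card_times:
  fixes z :: "complex^'n"
  assumes "\<And>h. norm (z $ h) \<le> r"
  shows "norm z \<le> real CARD('n) * r"
proof -
  have "norm z \<le> (\<Sum>h\<in>UNIV. norm (z $ h))" unfolding norm_vec_def by (rule L2_set_le_sum) simp
  also have "\<dots> \<le> (\<Sum>h\<in>(UNIV::'n set). r)" using assms by (intro sum_mono) auto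
  finally show ?thesis by simp
qed

text \<open>Polydiscs rather than balls, since the real point with all coordinates equal then serves as a majorant.\<close>

lemma has_taylor_polydisc:
  assumes "has_taylor F f"
  obtains r where "r > 0"
    "\<And>z s. (\<And>h. norm (z $ h) < r) \<Longrightarrow> ((\<lambda>Q. monom_at z Q * f Q $ s) has_sum F z $ s) UNIV"
proof -
  obtain e where e: "e > 0" "\<And>z. norm z < e \<Longrightarrow> ((\<lambda>Q. monom_at z Q *s f Q) has_sum F z) UNIV"
    using assms by (auto simp: has_taylor_def eventually_nhds_metric)
  define r where "r = e / (2 * real CARD('a))"
  have "((\<lambda>Q. monom_at z Q * f Q $ s) has_sum F z $ s) UNIV" if "\<And>h. norm (z $ h) < r" for z s
  proof -
    have "norm z \<le> real CARD('a) * r" using that by (intro norm_le_card_times) (auto intro: less_imp_le)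
    also have "\<dots> < e" using e(1) by (simp add: r_def)
    finally show ?thesis using has_sum_vec_nth[OF e(2)] by simp
  qed
  then show ?thesis using that[of r] e(1) by (simp add: r_def)
qed

lemma monom_at_of_real: "monom_at (\<chi> h. of_real t) Q = of_real (t ^ mdeg Q)"
  by (simp add: monom_at_def mdeg_def power_sum)

text \<open>The series converges absolutely at the point with all coordinates \<open>t\<close>, and for \<open>norm z < t\<close> each term of degree above \<open>d\<close>
gains the factor \<open>(norm z / t)^(d+1)\<close> over the term at that point.\<close>

lemma has_taylor_remainder:
  assumes "has_taylor F f"
  shows "vanishes (Suc d) (\<lambda>z. F z $ s - trunc d f z $ s)"
proof -
  obtain r where r: "r > 0" 
    "\<And>z s. (\<And>h. norm (z $ h) < r) \<Longrightarrow> ((\<lambda>Q. monom_at z Q * f Q $ s) has_sum F z $ s) UNIV"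
    using has_taylor_polydisc[OF assms] by blast
  define t where "t = r / 2"
  have t: "0 < t" "t < r" using r by (auto simp: t_def)
  have "(\<lambda>Q. monom_at (\<chi> h. of_real t) Q * f Q $ s) summable_on UNIV"
    using r(2)[of "\<chi> h. of_real t"] t by (auto simp: summable_on_def)
  then have "(\<lambda>Q. norm (monom_at (\<chi> h. of_real t) Q * f Q $ s)) summable_on UNIV"
    by (rule summable_on_iff_abs_summable_on_complex[THEN iffD1])
  then have sm: "(\<lambda>Q. t ^ mdeg Q * norm (f Q $ s)) summable_on UNIV"
    using t by (simp add: monom_at_of_real norm_mult norm_power)
  let ?A = "UNIV - {Q :: nat^'a. mdeg Q \<le> d}"
  define C where "C = infsum (\<lambda>Q. t ^ mdeg Q * norm (f Q $ s)) ?A"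
  have C: "((\<lambda>Q. t ^ mdeg Q * norm (f Q $ s)) has_sum C) ?A"
    unfolding C_def by (intro has_sum_infsum summable_on_subset_banach[OF sm]) auto
  have "norm (F z $ s - trunc d f z $ s) \<le> (C / t ^ Suc d) * norm z ^ Suc d" if z: "norm z < t" for z
  proof -
    have zh: "norm (z $ h) \<le> norm z" for h by (rule Finite_Cartesian_Product.norm_nth_le)
    have "((\<lambda>Q. monom_at z Q * f Q $ s) has_sum F z $ s) UNIV"
      using zh z t by (intro r(2)) (meson le_less_trans less_trans)
    then have hs: "((\<lambda>Q. monom_at z Q * f Q $ s) has_sum (F z $ s - trunc d f z $ s)) ?A"
      by (rule has_sum_Diff) (auto simp: trunc_nth finite_mdeg_le intro: has_sum_finite)
    have le: "norm (monom_at z Q * f Q $ s) \<le> (norm z / t) ^ Suc d * (t ^ mdeg Q * norm (f Q $ s))"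
      if "Q \<in> ?A" for Q
    proof -
      have "norm (monom_at z Q) \<le> norm z ^ mdeg Q" by (rule norm_monom_at_le[OF zh])
      also have "\<dots> = (norm z / t) ^ mdeg Q * t ^ mdeg Q" using t by (simp add: power_divide)
      also have "\<dots> \<le> (norm z / t) ^ Suc d * t ^ mdeg Q"
        using z t that by (intro mult_right_mono power_decreasing) auto
      finally show ?thesis
        unfolding norm_mult mult.assoc[symmetric] by (intro mult_right_mono) auto
    qed
    have hc: "((\<lambda>Q. (norm z / t) ^ Suc d * (t ^ mdeg Q * norm (f Q $ s))) has_sum (norm z / t) ^ Suc d * C) ?A"
      by (rule has_sum_cmult_right[OF C])
    have "(\<lambda>Q. norm (monom_at z Q * f Q $ s)) summable_on ?A"
      by (rule summable_on_iff_abs_summable_on_complex[THEN iffD1]) (use hs in \<open>auto simp: summable_on_def\<close>)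
    then have hn: "((\<lambda>Q. norm (monom_at z Q * f Q $ s)) has_sum infsum (\<lambda>Q. norm (monom_at z Q * f Q $ s)) ?A) ?A"
      by (rule has_sum_infsum)
    have "norm (F z $ s - trunc d f z $ s) \<le> infsum (\<lambda>Q. norm (monom_at z Q * f Q $ s)) ?A"
      by (rule norm_has_sum_bound[OF hn hs])
    also have "\<dots> \<le> (norm z / t) ^ Suc d * C"
      by (rule has_sum_mono[OF hn hc le])
    finally show ?thesis by (simp add: power_divide field_simps)
  qed
  then have "\<forall>\<^sub>F z in nhds 0. norm (F z $ s - trunc d f z $ s) \<le> (C / t ^ Suc d) * norm z ^ Suc d"
    unfolding eventually_nhds_metric using t(1) by (intro exI[of _ t]) (simp add: dist_norm)
  then show ?thesis by (rule vanishesI_bound)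
qed

lemma monom_at_origin: "monom_at 0 Q = (if Q = 0 then 1 else 0)"
  using norm_monom_at_le[of 0 0 Q] by (auto simp: power_0_left split: if_splits)

lemma has_taylor_at_0: "has_taylor F f \<Longrightarrow> f 0 = F 0"
proof -
  assume "has_taylor F f"
  then obtain r where r: "r > 0" 
    "\<And>z s. (\<And>h. norm (z $ h) < r) \<Longrightarrow> ((\<lambda>Q. monom_at z Q * f Q $ s) has_sum F z $ s) UNIV"
    using has_taylor_polydisc by blast
  have "f 0 $ s = F 0 $ s" for s
  proof -
    have "((\<lambda>Q. monom_at 0 Q * f Q $ s) has_sum F 0 $ s) UNIV" using r by simp
    moreover have "((\<lambda>Q. monom_at 0 Q * f Q $ s) has_sum (\<Sum>Q\<in>{0}. monom_at 0 Q * f Q $ s)) {0}"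
      by (rule has_sum_finite) simp
    then have "((\<lambda>Q. monom_at 0 Q * f Q $ s) has_sum f 0 $ s) UNIV"
      by (subst has_sum_cong_neutral[where T = "{0}"]) (auto simp: monom_at_origin)
    ultimately show ?thesis using has_sum_unique by blast
  qed
  then show ?thesis by (simp add: vec_eq_iff)
qed

text \<open>The exponents occurring in component \<open>s\<close> form the progression \<open>axis s 1 + k *s \<alpha>\<close>, which is injective in \<open>k\<close>.\<close>

lemma pd_form_resonant:
  fixes \<alpha> :: "nat^'n"
  assumes "\<alpha> \<noteq> 0"
  shows "pd_form lam \<alpha> a (axis s 1 + k *s \<alpha>) $ s = (if k = 0 then lam $ s else a k s)"
    and "Q \<notin> range (\<lambda>k. axis s 1 + k *s \<alpha>) \<Longrightarrow> pd_form lam \<alpha> a Q $ s = 0"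
    and "inj (\<lambda>k. axis s 1 + k *s \<alpha>)"
proof -
  obtain h where h: "\<alpha> $ h \<noteq> 0" using assms by (auto simp: vec_eq_iff)
  have inj: "axis s 1 + k *s \<alpha> = axis s 1 + l *s \<alpha> \<longleftrightarrow> k = l" for k l
  proof
    assume "axis s 1 + k *s \<alpha> = axis s 1 + l *s \<alpha>"
    then have "(axis s 1 + k *s \<alpha>) $ h = (axis s 1 + l *s \<alpha>) $ h" by (rule arg_cong)
    then show "k = l" using h by simp
  qed simp
  have "{l. 1 \<le> l \<and> axis s 1 + k *s \<alpha> = axis s 1 + l *s \<alpha>} = (if k = 0 then {} else {k})"
    using inj by auto
  moreover have "axis s 1 + k *s \<alpha> = axis s 1 \<longleftrightarrow> k = 0" using inj[of k 0] by simp
  ultimately show "pd_form lam \<alpha> a (axis s 1 + k *s \<alpha>) $ s = (if k = 0 then lam $ s else a k s)"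
    by (simp add: pd_form_def del: add_cancel_left_right)
  show "inj (\<lambda>k. axis s 1 + k *s \<alpha>)" using inj by (auto simp: inj_def)
  assume Q: "Q \<notin> range (\<lambda>k. axis s 1 + k *s \<alpha>)"
  then have "Q \<noteq> axis s 1 + 0 *s \<alpha>" by blast
  moreover from Q have E: "{l. 1 \<le> l \<and> Q = axis s 1 + l *s \<alpha>} = {}" by blast
  ultimately show "pd_form lam \<alpha> a Q $ s = 0"
    unfolding pd_form_def vec_lambda_beta E by simp
qed

text \<open>Component \<open>s\<close> is \<open>z_s\<close> times a power series in the single variable \<open>u = z^\<alpha>\<close>.\<close>

lemma pd_form_power_series:
  fixes \<alpha> :: "nat^'n"
  assumes G: "has_taylor G (pd_form lam \<alpha> a)" and \<alpha>: "\<alpha> \<noteq> 0"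
  obtains r g where "r > 0" "\<And>s. g s 0 = 0"
    "\<And>z s. (\<And>h. norm (z $ h) < r) \<Longrightarrow> G z $ s = lam $ s * z $ s + z $ s * g s (monom_at z \<alpha>)"
    "\<forall>s. \<forall>k\<ge>1. (\<forall>l. 1 \<le> l \<longrightarrow> l < k \<longrightarrow> a l s = 0) \<longrightarrow> ((\<lambda>u. g s u / u ^ k) \<longlongrightarrow> a k s) (at 0)"
proof -
  obtain r where r: "r > 0" 
    "\<And>z s. (\<And>h. norm (z $ h) < r) \<Longrightarrow> ((\<lambda>Q. monom_at z Q * pd_form lam \<alpha> a Q $ s) has_sum G z $ s) UNIV"
    using has_taylor_polydisc[OF G] by blast
  define c where "c s k = (if k = 0 then lam $ s else a k s)" for s k
  define g where "g s u = (\<Sum>k. c s k * u ^ k) - lam $ s" for s u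
  have sums: "(\<lambda>k. z $ s * (c s k * monom_at z \<alpha> ^ k)) sums (G z $ s)"
    if z: "\<And>h. norm (z $ h) < r" for z s
  proof -
    let ?e = "\<lambda>k. axis s 1 + k *s \<alpha>"
    have "((\<lambda>Q. monom_at z Q * pd_form lam \<alpha> a Q $ s) has_sum G z $ s) (range ?e)"
      using r(2)[of z s, OF z] pd_form_resonant(2)[OF \<alpha>, of _ s lam a]
      by (subst has_sum_cong_neutral[where T = UNIV]) auto
    then have "((\<lambda>k. monom_at z (?e k) * pd_form lam \<alpha> a (?e k) $ s) has_sum G z $ s) UNIV"
      by (subst (asm) has_sum_reindex[OF pd_form_resonant(3)[OF \<alpha>, of s]]) (simp add: o_def del: One_nat_def)
    moreover have "monom_at z (?e k) * pd_form lam \<alpha> a (?e k) $ s = z $ s * (c s k * monom_at z \<alpha> ^ k)" for k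
      unfolding pd_form_resonant(1)[OF \<alpha>] by (simp add: c_def monom_at_add monom_at_smult)
    ultimately show ?thesis using has_sum_imp_sums by simp
  qed
  define t where "t = r / 2"
  have t: "0 < t" "t < r" using r(1) by (auto simp: t_def)
  have G_eq: "G z $ s = lam $ s * z $ s + z $ s * g s (monom_at z \<alpha>)"
    if z: "\<And>h. norm (z $ h) < r" for z s
  proof (cases "z $ s = 0")
    case True
    then show ?thesis using sums[of z s, OF z] sums_unique2[OF sums_zero] by simp
  next
    case False
    have "(\<lambda>k. c s k * monom_at z \<alpha> ^ k) sums (G z $ s / z $ s)"
      using sums_mult[OF sums[of z s, OF z], of "inverse (z $ s)"] False by (simp add: field_simps)
    then have "(\<Sum>k. c s k * monom_at z \<alpha> ^ k) = G z $ s / z $ s" by (rule sums_unique[symmetric])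
    then show ?thesis using False by (simp add: g_def field_simps)
  qed
  have lim: "((\<lambda>u. g s u / u ^ k) \<longlongrightarrow> a k s) (at 0)"
    if k: "1 \<le> k" and a0: "\<And>l. 1 \<le> l \<Longrightarrow> l < k \<Longrightarrow> a l s = 0" for s k
  proof -
    define u0 :: complex where "u0 = of_real (t ^ mdeg \<alpha>)"
    have "(\<lambda>k. of_real t * (c s k * u0 ^ k)) sums (G (\<chi> h. of_real t) $ s)"
      using sums[of "\<chi> h. of_real t" s] t by (simp add: monom_at_of_real u0_def)
    then have "summable (\<lambda>k. of_real t * (c s k * u0 ^ k))" by (rule sums_summable)
    then have sm: "summable (\<lambda>k. c s k * u0 ^ k)" using t by (simp add: summable_mult_D)
    have u0: "norm u0 > 0" using t by (simp add: u0_def)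
    have "((\<lambda>u. g s u / u ^ k) \<longlongrightarrow> c s (0 + k)) (at 0)"
    proof (rule powser_limit_0_strong[OF u0, where a = "\<lambda>i. c s (i + k)"])
      fix u :: complex assume u: "u \<noteq> 0" "norm u < norm u0"
      have "summable (\<lambda>i. c s i * u ^ i)" by (rule powser_inside[OF sm u(2)])
      then have "(\<lambda>i. c s (i + k) * u ^ (i + k)) sums ((\<Sum>i. c s i * u ^ i) - (\<Sum>i<k. c s i * u ^ i))"
        using sums_split_initial_segment summable_sums by blast
      moreover have "(\<Sum>i<k. c s i * u ^ i) = (\<Sum>i\<in>{0}. c s i * u ^ i)"
        using k a0 by (intro sum.mono_neutral_right) (auto simp: c_def)
      ultimately have "(\<lambda>i. c s (i + k) * u ^ (i + k)) sums g s u"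
        by (simp add: g_def c_def)
      from sums_mult[OF this, of "inverse (u ^ k)"]
      show "(\<lambda>i. c s (i + k) * u ^ i) sums (g s u / u ^ k)"
        using u(1) by (simp add: power_add field_simps)
    qed
    then show ?thesis using k by (simp add: c_def)
  qed
  have "g s 0 = 0" for s by (simp add: g_def c_def powser_zero)
  then show ?thesis using that[of r g] r(1) G_eq lim by blast
qed

section \<open>Functions holomorphic along complex lines\<close>

text \<open>Cauchy's inequality, used on arbitrarily small circles to identify the derivative of order \<open>d\<close> with the limit \<open>c\<close>, and
on the circle of radius \<open>r/2\<close> to bound it.\<close>

lemma taylor_coefficient_bound:
  assumes h: "h holomorphic_on ball 0 r" and r: "r > 0"
    and B: "\<And>t. norm t < r \<Longrightarrow> norm (h t) \<le> B"
    and c: "((\<lambda>t. h t / t ^ d) \<longlongrightarrow> c) (at 0)"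
  shows "norm c \<le> B / (r / 2) ^ d"
proof -
  define k where "k t = h t - c * t ^ d" for t
  have kh: "k holomorphic_on ball 0 r" unfolding k_def by (intro holomorphic_intros h)
  have "norm ((deriv ^^ d) k 0) \<le> fact d * \<epsilon>" if \<epsilon>: "\<epsilon> > 0" for \<epsilon>
  proof -
    have "((\<lambda>t. h t / t ^ d - c) \<longlongrightarrow> c - c) (at 0)" by (intro tendsto_intros c)
    then have "\<forall>\<^sub>F t in at 0. dist (h t / t ^ d - c) 0 < \<epsilon>"
      using \<epsilon> by (intro tendstoD) auto
    then obtain e where e: "e > 0" "\<And>t. t \<noteq> 0 \<Longrightarrow> norm t < e \<Longrightarrow> norm (h t / t ^ d - c) < \<epsilon>"
      by (auto simp: eventually_at)
    define \<rho> where "\<rho> = min e r / 2"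
    have \<rho>: "0 < \<rho>" "\<rho> < e" "\<rho> < r" using e(1) r by (auto simp: \<rho>_def)
    have "norm ((deriv ^^ d) k 0) \<le> fact d * (\<epsilon> * \<rho> ^ d) / \<rho> ^ d"
    proof (rule Cauchy_inequality)
      show "k holomorphic_on ball 0 \<rho>" using kh \<rho> by (auto elim: holomorphic_on_subset)
      show "continuous_on (cball 0 \<rho>) k"
        using holomorphic_on_imp_continuous_on[OF kh] \<rho> by (auto elim: continuous_on_subset)
      fix t :: complex assume t: "norm (0 - t) = \<rho>"
      then have "t \<noteq> 0" using \<rho> by auto
      then have "k t = (h t / t ^ d - c) * t ^ d" by (simp add: k_def field_simps)
      then show "norm (k t) \<le> \<epsilon> * \<rho> ^ d"
        using e(2)[OF \<open>t \<noteq> 0\<close>] t \<rho> by (auto simp: norm_mult norm_power intro!: mult_mono)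
    qed (use \<rho> in auto)
    then show ?thesis using \<rho> by simp
  qed
  then have "norm ((deriv ^^ d) k 0) / fact d \<le> 0 + \<epsilon>" if "\<epsilon> > 0" for \<epsilon> :: real
    using that by (simp add: field_simps)
  then have "norm ((deriv ^^ d) k 0) / fact d \<le> 0" by (rule field_le_epsilon)
  then have k0: "(deriv ^^ d) k 0 = 0"
    using fact_gt_zero[of d, where ?'a = real] by (auto simp: divide_le_0_iff)
  have "(deriv ^^ d) (\<lambda>t. c * t ^ d) 0 = c * (deriv ^^ d) (\<lambda>t. (t - 0) ^ d) 0"
    by (subst higher_deriv_cmult[where A = UNIV]) (auto intro!: holomorphic_intros)
  also have "\<dots> = c * fact d" by (subst higher_deriv_power) (simp add: pochhammer_fact[symmetric])
  finally have "(deriv ^^ d) (\<lambda>t. c * t ^ d) 0 = c * fact d" .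
  moreover have "(deriv ^^ d) k 0 = (deriv ^^ d) h 0 - (deriv ^^ d) (\<lambda>t. c * t ^ d) 0"
    unfolding k_def by (rule higher_deriv_diff[where S = "ball 0 r"]) (use h r in \<open>auto intro!: holomorphic_intros\<close>)
  ultimately have "(deriv ^^ d) h 0 = c * fact d" using k0 by simp
  moreover have "norm ((deriv ^^ d) h 0) \<le> fact d * B / (r / 2) ^ d"
  proof (rule Cauchy_inequality)
    show "h holomorphic_on ball 0 (r / 2)" using h r by (auto elim: holomorphic_on_subset)
    show "continuous_on (cball 0 (r / 2)) h"
      using holomorphic_on_imp_continuous_on[OF h] r by (auto elim: continuous_on_subset)
  qed (use r B in auto)
  ultimately have "fact d * norm c \<le> fact d * (B / (r / 2) ^ d)"
    by (simp add: norm_mult mult.commute)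
  then show ?thesis by (rule mult_left_le_imp_le) simp
qed

text \<open>Holomorphy along every complex line is all that the one-variable estimates below use, and it is preserved by polynomial
expressions without any computation of Jacobian matrices.\<close>

definition line_holo :: "(complex^'n \<Rightarrow> complex) \<Rightarrow> (complex^'n) set \<Rightarrow> bool" where
  "line_holo f \<Omega> \<longleftrightarrow> (\<forall>p v. (\<lambda>t. f (p + t *s v)) holomorphic_on {t. p + t *s v \<in> \<Omega>})"

lemma line_holo_const: "line_holo (\<lambda>_. c) \<Omega>"
  by (simp add: line_holo_def)

lemma line_holo_mult: "line_holo f \<Omega> \<Longrightarrow> line_holo g \<Omega> \<Longrightarrow> line_holo (\<lambda>z. f z * g z) \<Omega>"
  by (auto simp: line_holo_def intro!: holomorphic_intros)

lemma line_holo_power: "line_holo f \<Omega> \<Longrightarrow> line_holo (\<lambda>z. f z ^ k) \<Omega>"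
  by (auto simp: line_holo_def intro!: holomorphic_intros)

lemma line_holo_sum: "(\<And>i. i \<in> I \<Longrightarrow> line_holo (f i) \<Omega>) \<Longrightarrow> line_holo (\<lambda>z. \<Sum>i\<in>I. f i z) \<Omega>"
  by (auto simp: line_holo_def intro!: holomorphic_intros)

lemma line_holo_prod: "(\<And>i. i \<in> I \<Longrightarrow> line_holo (f i) \<Omega>) \<Longrightarrow> line_holo (\<lambda>z. \<Prod>i\<in>I. f i z) \<Omega>"
  by (auto simp: line_holo_def intro!: holomorphic_intros)

lemma line_holo_nth:
  assumes "holo_on \<psi> \<Omega>"
  shows "line_holo (\<lambda>z. \<psi> z $ s) \<Omega>"
  unfolding line_holo_def
proof (intro allI)
  fix p v :: "complex^'a"
  show "(\<lambda>t. \<psi> (p + t *s v) $ s) holomorphic_on {t. p + t *s v \<in> \<Omega>}"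
    unfolding holomorphic_on_def
  proof
    fix t assume "t \<in> {t. p + t *s v \<in> \<Omega>}"
    then obtain A :: "complex^'a^'a" where A: "(\<psi> has_derivative (\<lambda>v. A *v v)) (at (p + t *s v))"
      using assms by (auto simp: holo_on_def)
    have "bounded_linear (\<lambda>h :: complex. h *s v)"
      by (rule linear_conv_bounded_linear[THEN iffD1]) (auto intro!: linearI simp: vec_eq_iff algebra_simps)
    then have "((\<lambda>t. p + t *s v) has_derivative (\<lambda>h. h *s v)) (at t)"
      using has_derivative_add[OF has_derivative_const bounded_linear_imp_has_derivative] by fastforce
    then have "((\<lambda>t. \<psi> (p + t *s v)) has_derivative (\<lambda>h. A *v (h *s v))) (at t)"
      by (rule has_derivative_compose[where g = \<psi>]) (rule A)
    then have "((\<lambda>t. \<psi> (p + t *s v) $ s) has_derivative (\<lambda>h. (A *v (h *s v)) $ s)) (at t)"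
      by (rule bounded_linear.has_derivative[OF bounded_linear_vec_nth])
    also have "(\<lambda>h. (A *v (h *s v)) $ s) = (*) ((A *v v) $ s)"
      by (auto simp: fun_eq_iff matrix_vector_mult_def sum_distrib_left sum_distrib_right algebra_simps)
    finally show "(\<lambda>t. \<psi> (p + t *s v) $ s) field_differentiable at t within {t. p + t *s v \<in> \<Omega>}"
      by (auto simp: field_differentiable_def has_field_derivative_def intro: has_derivative_at_withinI)
  qed
qed

lemma isCont_filterlim_nhds: "isCont f x \<Longrightarrow> filterlim f (nhds (f x)) (nhds x)"
  unfolding isCont_def by (rule tendsto_at_iff_tendsto_nhds[THEN iffD1])

lemma norm_vector_smult: "norm (t *s x) = norm t * norm x" for x :: "complex^'n"
  by (simp add: norm_vec_def norm_mult L2_set_right_distrib)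

text \<open>Strict differentiability at \<open>0\<close>: the remainder of the linear approximation, restricted to the line through \<open>p\<close> and \<open>p + h\<close>, is
small on a disc of radius \<open>|p|/|h|\<close>, so Cauchy's inequality makes its derivative small as well.\<close>

lemma strict_derivative_at_0:
  fixes f :: "complex^'n \<Rightarrow> complex"
  assumes \<Omega>: "open \<Omega>" "0 \<in> \<Omega>" and f: "line_holo f \<Omega>" and f0: "f 0 = 0"
    and d: "(f has_derivative (\<lambda>v. \<kappa> * v $ s)) (at 0)" and \<epsilon>: "\<epsilon> > 0"
  obtains \<delta> where "\<delta> > 0" "\<And>p h. norm p < \<delta> \<Longrightarrow> norm h \<le> norm p / 2 \<Longrightarrow> norm (f (p + h) - f p - \<kappa> * h $ s) \<le> \<epsilon> * norm h"
proof -
  have "\<exists>\<delta>>0. \<forall>z. norm (z - 0) < \<delta> \<longrightarrow> norm (f z - f 0 - \<kappa> * (z - 0) $ s) \<le> \<epsilon> / 4 * norm (z - 0)"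
    using d \<epsilon> unfolding has_derivative_at_alt by (metis divide_pos_pos zero_less_numeral)
  then obtain r where r: "r > 0" and small: "\<And>z. norm z < r \<Longrightarrow> norm (f z - \<kappa> * z $ s) \<le> \<epsilon> / 4 * norm z"
    using f0 by auto
  obtain e where e: "e > 0" "ball 0 e \<subseteq> \<Omega>" using \<Omega> open_contains_ball by blast
  define \<delta> where "\<delta> = min r e / 2"
  have "norm (f (p + h) - f p - \<kappa> * h $ s) \<le> \<epsilon> * norm h"
    if p: "norm p < \<delta>" and h: "norm h \<le> norm p / 2" for p h
  proof (cases "h = 0")
    case False
    define g where "g t = f (p + t *s h) - \<kappa> * (p + t *s h) $ s" for t
    \<comment> \<open>the largest radius for which the points \<open>p + t *s h\<close> stay in the ball of radius \<open>2 * norm p\<close>\<close>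
    define R where "R = norm p / norm h"
    have R: "R \<ge> 2" using h False by (simp add: R_def field_simps)
    have hp: "norm h > 0" "norm p > 0" using False h by (auto simp: zero_less_norm_iff[symmetric] simp del: zero_less_norm_iff)
    have nrm: "norm (p + t *s h) \<le> 2 * norm p" "norm (p + t *s h) < r" "p + t *s h \<in> \<Omega>" if "norm t \<le> R" for t
    proof -
      have "norm (t *s h) \<le> R * norm h" unfolding norm_vector_smult using that by (intro mult_right_mono) auto
      then have "norm (t *s h) \<le> norm p" using hp by (simp add: R_def)
      then show le: "norm (p + t *s h) \<le> 2 * norm p" using norm_triangle_ineq[of p "t *s h"] by linarith
      show "norm (p + t *s h) < r" using le p by (simp add: \<delta>_def)
      have "p + t *s h \<in> ball 0 e" using le p by (simp add: \<delta>_def)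
      then show "p + t *s h \<in> \<Omega>" using e by blast
    qed
    have "(\<lambda>t. f (p + t *s h)) holomorphic_on {t. p + t *s h \<in> \<Omega>}" using f by (auto simp: line_holo_def)
    then have fh: "(\<lambda>t. f (p + t *s h)) holomorphic_on cball 0 R"
      by (rule holomorphic_on_subset) (use nrm in auto)
    have gh: "g holomorphic_on cball 0 R" unfolding g_def by (intro holomorphic_intros fh) (auto intro!: holomorphic_intros)
    have gB: "norm (g t) \<le> \<epsilon> / 2 * norm p" if "norm t \<le> R" for t
    proof -
      have "norm (g t) \<le> \<epsilon> / 4 * norm (p + t *s h)" unfolding g_def by (rule small[OF nrm(2)[OF that]])
      also have "\<dots> \<le> \<epsilon> / 4 * (2 * norm p)" using \<epsilon> nrm(1)[OF that] by (intro mult_left_mono) auto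
      finally show ?thesis by simp
    qed
    have dg: "(g has_field_derivative deriv g t) (at t within cball 0 1)" and dB: "norm (deriv g t) \<le> \<epsilon> * norm h"
      if t: "t \<in> cball 0 1" for t
    proof -
      have sub: "cball t (R / 2) \<subseteq> cball 0 R"
      proof
        fix x assume "x \<in> cball t (R / 2)"
        then have "norm x \<le> R / 2 + norm t"
          using norm_triangle_sub[of x t] by (simp add: dist_norm norm_minus_commute)
        then show "x \<in> cball 0 R" using t R by simp
      qed
      have "t \<in> ball 0 R" using t R by auto
      moreover have "g holomorphic_on ball 0 R" using gh by (auto elim: holomorphic_on_subset)
      ultimately have "g field_differentiable at t"
        using holomorphic_on_imp_differentiable_at by blast
      then show "(g has_field_derivative deriv g t) (at t within cball 0 1)"
        by (simp add: field_differentiable_derivI has_field_derivative_at_within)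
      have "norm ((deriv ^^ 1) g t) \<le> fact 1 * (\<epsilon> / 2 * norm p) / (R / 2) ^ 1"
      proof (rule Cauchy_inequality)
        show "g holomorphic_on ball t (R / 2)"
          using gh sub ball_subset_cball by (meson holomorphic_on_subset order_trans)
        show "continuous_on (cball t (R / 2)) g"
          using holomorphic_on_imp_continuous_on[OF gh] sub by (rule continuous_on_subset)
        show "0 < R / 2" using R by simp
        fix x assume "norm (t - x) = R / 2"
        then have "x \<in> cball t (R / 2)" by (simp add: dist_norm)
        then show "norm (g x) \<le> \<epsilon> / 2 * norm p" using sub gB by auto
      qed
      also have "\<dots> = \<epsilon> * norm h" using hp by (simp add: R_def)
      finally show "norm (deriv g t) \<le> \<epsilon> * norm h" by simp
    qed
    have "norm (g 1 - g 0) \<le> (\<epsilon> * norm h) * norm (1 - 0 :: complex)"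
      by (rule field_differentiable_bound[of "cball 0 1", OF _ dg dB]) auto
    then show ?thesis by (simp add: g_def algebra_simps)
  qed simp
  then show ?thesis using that[of \<delta>] r e by (simp add: \<delta>_def)
qed

lemma tendsto_ray_0:
  "((\<lambda>t. t *s x) \<longlongrightarrow> (0 :: complex^'n)) (at 0)"
proof -
  have "((\<lambda>t. \<chi> h. t * x $ h) \<longlongrightarrow> (\<chi> h. 0 * x $ h)) (at 0)"
    by (intro tendsto_intros)
  then show ?thesis by (simp add: vector_scalar_mult_def zero_vec_def)
qed

lemma monom_at_vector_smult: "monom_at (t *s x) Q = t ^ mdeg Q * monom_at x Q"
  by (simp add: monom_at_def mdeg_def power_mult_distrib prod.distrib power_sum)

lemma vanishes_along_ray:
  fixes f :: "complex^'n \<Rightarrow> complex"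
  assumes "vanishes (Suc d) f"
  shows "((\<lambda>t. f (t *s x) / t ^ d) \<longlongrightarrow> 0) (at 0)"
proof -
  obtain C where "\<forall>\<^sub>F z in nhds 0. norm (f z) \<le> C * norm z ^ Suc d"
    using assms by (auto simp: vanishes_def)
  then have ev: "\<forall>\<^sub>F t in at 0. norm (f (t *s x)) \<le> C * norm (t *s x) ^ Suc d"
    by (rule eventually_compose_filterlim[OF _ tendsto_ray_0])
  show ?thesis
  proof (rule Lim_null_comparison)
    show "\<forall>\<^sub>F t in at 0. norm (f (t *s x) / t ^ d) \<le> C * norm x ^ Suc d * norm t"
      using ev eventually_neq_at_within[of 0]
      by eventually_elim (simp add: norm_divide norm_power norm_vector_smult power_mult_distrib field_simps)
    show "((\<lambda>t::complex. C * norm x ^ Suc d * norm t) \<longlongrightarrow> 0) (at 0)"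
      by (rule tendsto_mult_right_zero[OF tendsto_norm_zero[OF tendsto_ident_at]])
  qed
qed

lemma derivative_along_ray:
  fixes f :: "complex^'n \<Rightarrow> complex"
  assumes d: "(f has_derivative (\<lambda>v. \<kappa> * v $ s)) (at 0)" and f0: "f 0 = 0"
  shows "((\<lambda>t. f (t *s x) / t) \<longlongrightarrow> \<kappa> * x $ s) (at 0)"
proof -
  have "bounded_linear (\<lambda>t :: complex. t *s x)"
    by (rule linear_conv_bounded_linear[THEN iffD1]) (auto intro!: linearI simp: vec_eq_iff algebra_simps)
  then have l: "((\<lambda>t. t *s x) has_derivative (\<lambda>t. t *s x)) (at 0)"
    by (rule bounded_linear_imp_has_derivative)
  have "((\<lambda>t. f (t *s x)) has_derivative (\<lambda>t. \<kappa> * (t *s x) $ s)) (at 0)"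
    by (rule has_derivative_compose[where g = f, OF l]) (use d in simp)
  also have "(\<lambda>t. \<kappa> * (t *s x) $ s) = (*) (\<kappa> * x $ s)" by (auto simp: fun_eq_iff)
  finally have "((\<lambda>t. f (t *s x)) has_field_derivative \<kappa> * x $ s) (at 0)"
    by (simp add: has_field_derivative_def)
  then show ?thesis by (simp add: has_field_derivative_iff f0)
qed

section \<open>The leading resonant coefficient under a change of normal form\<close>

text \<open>The map \<open>S\<close> conjugates the normal form \<open>G\<close>, with leading coefficients \<open>a\<close>, up to order \<open>d = 1 + k * mdeg \<alpha>\<close> to one with leading
coefficient \<open>b\<close> in component \<open>s\<close>. Along rays the difference of the two coefficients, with the weight of the linear part \<open>\<kappa>\<close>,
appears as the quantity \<open>\<gamma>\<close>. Rotating the ray by \<open>lam\<close> reproduces the resonant term up to the factor \<open>lam $ s\<close>, so \<open>l\<close> rotations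
accumulate it \<open>l\<close> times, while the Cauchy estimate for \<open>S\<close> does not depend on \<open>l\<close>.\<close>

lemma resonant_coefficient_transforms:
  fixes S G :: "complex^'n \<Rightarrow> complex^'n" and \<alpha> :: "nat^'n"
  assumes \<Omega>: "open \<Omega>" "0 \<in> \<Omega>"
    and S: "\<And>s. line_holo (\<lambda>w. S w $ s) \<Omega>" "S 0 = 0"
    and dS: "\<And>s. ((\<lambda>w. S w $ s) has_derivative (\<lambda>v. \<kappa> $ s * v $ s)) (at 0)"
    and lam: "\<And>s. norm (lam $ s) = 1" "monom_at lam \<alpha> = 1"
    and \<alpha>: "\<alpha> \<noteq> 0" and k: "1 \<le> k"
    and r: "r > 0" and G: "\<And>z s. (\<And>h. norm (z $ h) < r) \<Longrightarrow> G z $ s = lam $ s * z $ s + z $ s * g s (monom_at z \<alpha>)"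
    and g: "\<And>s. ((\<lambda>u. g s u / u ^ k) \<longlongrightarrow> a s) (at 0)"
    and conj: "vanishes (Suc (1 + k * mdeg \<alpha>))
      (\<lambda>w. S (G w) $ s - (lam $ s * S w $ s + b * (S w $ s * monom_at (S w) \<alpha> ^ k)))"
    and \<kappa>: "\<kappa> $ s \<noteq> 0"
  shows "a s = b * monom_at \<kappa> \<alpha> ^ k"
proof -
  define d where "d = 1 + k * mdeg \<alpha>"
  have d2: "d \<ge> 2" using k \<alpha> by (simp add: d_def) (metis One_nat_def Suc_leI le_less mdeg_eq_0_iff mult_is_0 neq0_conv not_one_le_zero)
  define unim where "unim x \<longleftrightarrow> (\<forall>h. norm (x $ h) = 1)" for x :: "complex^'n"
  define rot where "rot x = (\<chi> h. lam $ h * x $ h)" for x :: "complex^'n"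
  define \<gamma> where "\<gamma> = \<kappa> $ s * (b * monom_at \<kappa> \<alpha> ^ k - a s)"
  have unim_rot: "unim (rot x)" if "unim x" for x using that lam by (simp add: unim_def rot_def norm_mult)
  have step: "((\<lambda>t. (S (t *s rot x) $ s - lam $ s * S (t *s x) $ s) / t ^ d) \<longlongrightarrow> \<gamma> * (x $ s * monom_at x \<alpha> ^ k)) (at 0)"
    if x: "unim x" for x
  proof -
    have xs: "norm (x $ h) = 1" for h using x by (simp add: unim_def)
    have mx: "norm (monom_at x \<alpha>) = 1" by (simp add: monom_at_def prod_norm[symmetric] norm_power xs)
    \<comment> \<open>the value of \<open>S\<close> at \<open>G (t *s x)\<close> is expressed through \<open>S (t *s x)\<close> by the conjugation (lim1, lim2), and through \<open>S (t *s rot x)\<close> by strict differentiability (lim3)\<close>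
    have lim1: "((\<lambda>t. (S (G (t *s x)) $ s - (lam $ s * S (t *s x) $ s + b * (S (t *s x) $ s * monom_at (S (t *s x)) \<alpha> ^ k))) / t ^ d) \<longlongrightarrow> 0) (at 0)"
      using vanishes_along_ray[OF conj, of x] by (simp add: d_def)
    have Sray: "((\<lambda>t. S (t *s x) $ h / t) \<longlongrightarrow> \<kappa> $ h * x $ h) (at 0)" for h
      by (rule derivative_along_ray[OF dS]) (simp add: S)
    have "((\<lambda>t. b * ((S (t *s x) $ s / t) * (\<Prod>h\<in>UNIV. (S (t *s x) $ h / t) ^ (\<alpha> $ h)) ^ k)) \<longlongrightarrow>
        b * ((\<kappa> $ s * x $ s) * (\<Prod>h\<in>UNIV. (\<kappa> $ h * x $ h) ^ (\<alpha> $ h)) ^ k)) (at 0)"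
      by (intro tendsto_intros Sray)
    moreover have "b * ((S (t *s x) $ s / t) * (\<Prod>h\<in>UNIV. (S (t *s x) $ h / t) ^ (\<alpha> $ h)) ^ k) =
        b * (S (t *s x) $ s * monom_at (S (t *s x)) \<alpha> ^ k) / t ^ d" for t
    proof -
      have "(\<Prod>h\<in>UNIV. (S (t *s x) $ h / t) ^ (\<alpha> $ h)) = monom_at (S (t *s x)) \<alpha> / t ^ mdeg \<alpha>"
        by (simp add: monom_at_def mdeg_def power_divide prod_dividef power_sum)
      moreover have "t ^ d = t * (t ^ mdeg \<alpha>) ^ k" by (simp add: d_def power_mult[symmetric] mult.commute)
      ultimately show ?thesis by (simp add: power_divide)
    qed
    moreover have "(\<Prod>h\<in>UNIV. (\<kappa> $ h * x $ h) ^ (\<alpha> $ h)) = monom_at \<kappa> \<alpha> * monom_at x \<alpha>"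
      by (simp add: monom_at_def power_mult_distrib prod.distrib)
    ultimately have lim2: "((\<lambda>t. b * (S (t *s x) $ s * monom_at (S (t *s x)) \<alpha> ^ k) / t ^ d) \<longlongrightarrow>
        b * ((\<kappa> $ s * x $ s) * (monom_at \<kappa> \<alpha> * monom_at x \<alpha>) ^ k)) (at 0)" by simp
    define H where "H t = G (t *s x) - t *s rot x" for t
    have Hlim: "((\<lambda>t. H t $ h / t ^ d) \<longlongrightarrow> x $ h * (a h * monom_at x \<alpha> ^ k)) (at 0)" for h
    proof -
      have fl: "filterlim (\<lambda>t. t ^ mdeg \<alpha> * monom_at x \<alpha>) (at 0) (at 0)"
      proof (rule filterlim_atI)
        have "((\<lambda>t. t ^ mdeg \<alpha> * monom_at x \<alpha>) \<longlongrightarrow> 0 ^ mdeg \<alpha> * monom_at x \<alpha>) (at 0)"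
          by (intro tendsto_intros)
        then show "((\<lambda>t. t ^ mdeg \<alpha> * monom_at x \<alpha>) \<longlongrightarrow> 0) (at 0)" using \<alpha> by (simp add: power_0_left)
        show "\<forall>\<^sub>F t in at 0. t ^ mdeg \<alpha> * monom_at x \<alpha> \<noteq> 0"
          using eventually_neq_at_within[of 0] by eventually_elim (use mx in auto)
      qed
      have "((\<lambda>t. x $ h * (g h (t ^ mdeg \<alpha> * monom_at x \<alpha>) / (t ^ mdeg \<alpha> * monom_at x \<alpha>) ^ k * monom_at x \<alpha> ^ k)) \<longlongrightarrow> x $ h * (a h * monom_at x \<alpha> ^ k)) (at 0)"
        by (intro tendsto_intros filterlim_compose[OF g fl])
      moreover have "\<forall>\<^sub>F t in at 0. x $ h * (g h (t ^ mdeg \<alpha> * monom_at x \<alpha>) / (t ^ mdeg \<alpha> * monom_at x \<alpha>) ^ k * monom_at x \<alpha> ^ k) = H t $ h / t ^ d"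
      proof -
        have "\<forall>\<^sub>F t in at (0::complex). norm t < r"
          using r by (auto simp: eventually_at intro!: exI[of _ r])
        then show ?thesis using eventually_neq_at_within[of 0]
        proof eventually_elim
          case (elim t)
          have "G (t *s x) $ h = lam $ h * (t *s x) $ h + (t *s x) $ h * g h (monom_at (t *s x) \<alpha>)"
            using elim xs by (intro G) (simp add: norm_mult)
          then show ?case using elim mx
            by (auto simp: H_def rot_def monom_at_vector_smult d_def power_mult_distrib power_mult[symmetric] mult.commute field_simps)
        qed
      qed
      ultimately show ?thesis by (rule Lim_transform_eventually)
    qed
    define c where "c = (\<chi> h. x $ h * (a h * monom_at x \<alpha> ^ k))"
    have Hc: "((\<lambda>t. (1 / t ^ d) *s H t) \<longlongrightarrow> c) (at 0)"
      by (rule vec_tendstoI) (use Hlim in \<open>simp add: c_def\<close>)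
    have Hn: "\<forall>\<^sub>F t in at 0. norm (H t) \<le> (norm c + 1) * norm t ^ d"
    proof -
      have "\<forall>\<^sub>F t in at 0. norm ((1 / t ^ d) *s H t) < norm c + 1"
        by (rule order_tendstoD(2)[OF tendsto_norm[OF Hc]]) simp
      then show ?thesis using eventually_neq_at_within[of 0]
        by eventually_elim (simp add: norm_vector_smult norm_divide norm_power field_simps less_imp_le)
    qed
    have nrot: "norm (rot x) > 0"
    proof -
      have "norm (rot x $ s) = 1" using unim_rot[OF x] by (simp add: unim_def)
      then show ?thesis using Finite_Cartesian_Product.norm_nth_le[of "rot x" s] by linarith
    qed
    have lim3: "((\<lambda>t. (S (G (t *s x)) $ s - S (t *s rot x) $ s - \<kappa> $ s * H t $ s) / t ^ d) \<longlongrightarrow> 0) (at 0)"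
    proof (rule tendstoI)
      fix e :: real assume e: "e > 0"
      define \<epsilon> where "\<epsilon> = e / (2 * (norm c + 1))"
      have nc: "norm c + 1 > 0" by (simp add: add_nonneg_pos)
      have \<epsilon>: "\<epsilon> > 0" using e nc by (simp add: \<epsilon>_def)
      have "x / (2 * y) * y = x / 2" if "y > 0" for x y :: real using that by simp
      from this[OF nc] have \<epsilon>nc: "\<epsilon> * (norm c + 1) = e / 2" unfolding \<epsilon>_def .
      obtain \<delta> where \<delta>: "\<delta> > 0" "\<And>p h. norm p < \<delta> \<Longrightarrow> norm h \<le> norm p / 2 \<Longrightarrow> norm (S (p + h) $ s - S p $ s - \<kappa> $ s * h $ s) \<le> \<epsilon> * norm h"
        using strict_derivative_at_0[OF \<Omega> S(1) _ dS \<epsilon>, of s] S(2) by (metis zero_index)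
      have e1: "\<forall>\<^sub>F t in at 0. norm (t *s rot x) < \<delta>"
        by (rule order_tendstoD(2)[OF tendsto_norm_zero[OF tendsto_ray_0] \<delta>(1)])
      have "((\<lambda>t. norm (t :: complex) ^ (d - 1)) \<longlongrightarrow> 0) (at 0)"
        using tendsto_power[OF tendsto_norm_zero[OF tendsto_ident_at], of "d - 1"] d2 by (simp add: power_0_left)
      then have "((\<lambda>t. (norm c + 1) * norm (t :: complex) ^ (d - 1)) \<longlongrightarrow> 0) (at 0)"
        by (rule tendsto_mult_right_zero)
      then have e2: "\<forall>\<^sub>F t in at 0. (norm c + 1) * norm (t :: complex) ^ (d - 1) < norm (rot x) / 2"
        by (rule order_tendstoD(2)) (use nrot in simp)
      show "\<forall>\<^sub>F t in at 0. dist ((S (G (t *s x)) $ s - S (t *s rot x) $ s - \<kappa> $ s * H t $ s) / t ^ d) 0 < e"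
        using e1 e2 Hn eventually_neq_at_within[of 0]
      proof eventually_elim
        case (elim t)
        have tp: "norm t > 0" using elim by simp
        have "norm t ^ d = norm t ^ (d - 1) * norm t" using d2 by (simp add: power_eq_if)
        then have "norm (H t) \<le> ((norm c + 1) * norm t ^ (d - 1)) * norm t" using elim by (simp add: mult.assoc)
        also have "\<dots> \<le> (norm (rot x) / 2) * norm t" using elim by (intro mult_right_mono) auto
        finally have "norm (H t) \<le> norm (t *s rot x) / 2" by (simp add: norm_vector_smult mult.commute)
        from \<delta>(2)[OF elim(1) this]
        have "norm (S (G (t *s x)) $ s - S (t *s rot x) $ s - \<kappa> $ s * H t $ s) \<le> \<epsilon> * norm (H t)"
          by (simp add: H_def)
        also have "\<dots> \<le> \<epsilon> * ((norm c + 1) * norm t ^ d)" using elim \<epsilon> by (intro mult_left_mono) auto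
        also have "\<dots> = e / 2 * norm t ^ d" by (simp only: mult.assoc[symmetric] \<epsilon>nc)
        also have "\<dots> < e * norm t ^ d" using e tp by simp
        finally show ?case using tp by (simp add: norm_divide norm_power field_simps)
      qed
    qed
    have "((\<lambda>t. (S (G (t *s x)) $ s - (lam $ s * S (t *s x) $ s + b * (S (t *s x) $ s * monom_at (S (t *s x)) \<alpha> ^ k))) / t ^ d
        + b * (S (t *s x) $ s * monom_at (S (t *s x)) \<alpha> ^ k) / t ^ d
        - (S (G (t *s x)) $ s - S (t *s rot x) $ s - \<kappa> $ s * H t $ s) / t ^ d
        - \<kappa> $ s * (H t $ s / t ^ d)) \<longlongrightarrow>
        0 + b * ((\<kappa> $ s * x $ s) * (monom_at \<kappa> \<alpha> * monom_at x \<alpha>) ^ k) - 0 - \<kappa> $ s * (x $ s * (a s * monom_at x \<alpha> ^ k))) (at 0)"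
      by (intro tendsto_intros lim1 lim2 lim3 Hlim)
    also have "0 + b * ((\<kappa> $ s * x $ s) * (monom_at \<kappa> \<alpha> * monom_at x \<alpha>) ^ k) - 0 - \<kappa> $ s * (x $ s * (a s * monom_at x \<alpha> ^ k))
       = \<gamma> * (x $ s * monom_at x \<alpha> ^ k)" by (simp add: \<gamma>_def power_mult_distrib algebra_simps)
    finally show ?thesis by (simp add: add_divide_distrib diff_divide_distrib algebra_simps)
  qed
  \<comment> \<open>the orbit of a single ray under the linear part suffices\<close>
  define X where "X l = (rot ^^ l) (\<chi> h. 1)" for l
  have X_nth: "X l $ h = lam $ h ^ l" for l h by (induction l arbitrary: h) (simp_all add: X_def rot_def)
  have X_mon: "monom_at (X l) \<alpha> = 1" for l
  proof -
    have "monom_at (X l) \<alpha> = monom_at lam \<alpha> ^ l"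
      by (simp add: monom_at_def X_nth prod_power_distrib power_mult[symmetric] mult.commute)
    then show ?thesis using lam by simp
  qed
  have X_unim: "unim (X l)" for l using lam by (simp add: unim_def X_nth norm_power)
  have telescope: "((\<lambda>t. (S (t *s X l) $ s - lam $ s ^ l * S (t *s X 0) $ s) / t ^ d) \<longlongrightarrow> of_nat l * \<gamma> * lam $ s ^ l / lam $ s) (at 0)" for l
  proof (induction l)
    case (Suc l)
    have l0: "lam $ s \<noteq> 0" using lam(1)[of s] by auto
    have "X (Suc l) = rot (X l)" by (simp add: X_def)
    then have "((\<lambda>t. (S (t *s X (Suc l)) $ s - lam $ s * S (t *s X l) $ s) / t ^ d) \<longlongrightarrow> \<gamma> * lam $ s ^ l) (at 0)"
      using step[OF X_unim[of l]] by (simp add: X_mon X_nth)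
    from tendsto_add[OF this tendsto_mult_left[OF Suc.IH, of "lam $ s"]]
    show ?case using l0 by (simp add: add_divide_distrib diff_divide_distrib algebra_simps)
  qed simp
  have "isCont (\<lambda>w. S w $ s) 0" using dS has_derivative_continuous by blast
  then have "((\<lambda>w. S w $ s) \<longlongrightarrow> 0) (nhds 0)"
    using isCont_filterlim_nhds[where f = "\<lambda>w. S w $ s" and x = 0] by (simp add: S)
  then have "\<forall>\<^sub>F w in nhds 0. norm (S w $ s) < 1"
    by (intro order_tendstoD(2)[OF tendsto_norm_zero]) auto
  moreover have "\<forall>\<^sub>F w in nhds 0. w \<in> \<Omega>" using \<Omega> by (rule eventually_nhds_in_open)
  ultimately have "\<forall>\<^sub>F w in nhds 0. norm (S w $ s) < 1 \<and> w \<in> \<Omega>" by (rule eventually_conj)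
  then obtain e where e: "e > 0" "\<And>w. norm w < e \<Longrightarrow> norm (S w $ s) < 1" "\<And>w. norm w < e \<Longrightarrow> w \<in> \<Omega>"
    unfolding eventually_nhds_metric by (auto simp: dist_norm)
  define \<rho> where "\<rho> = e / real CARD('n)"
  have \<rho>: "\<rho> > 0" using e by (simp add: \<rho>_def)
  have ray: "norm (t *s X l) < e" if "norm t < \<rho>" for t l
  proof -
    have "norm (X l) \<le> real CARD('n) * 1" using X_unim[of l] by (intro norm_le_card_times) (simp add: unim_def)
    then have "norm (t *s X l) \<le> norm t * real CARD('n)"
      unfolding norm_vector_smult by (intro mult_left_mono) auto
    also have "\<dots> < e" using that by (simp add: \<rho>_def field_simps)
    finally show ?thesis .
  qed
  have hol: "(\<lambda>t. S (t *s X l) $ s) holomorphic_on ball 0 \<rho>" for l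
  proof -
    have "(\<lambda>t. S (0 + t *s X l) $ s) holomorphic_on {t. 0 + t *s X l \<in> \<Omega>}"
      using S(1)[of s] unfolding line_holo_def by blast
    then have "(\<lambda>t. S (t *s X l) $ s) holomorphic_on {t. t *s X l \<in> \<Omega>}" by simp
    then show ?thesis by (rule holomorphic_on_subset) (use ray e in auto)
  qed
  have bound: "norm (of_nat l * \<gamma> * lam $ s ^ l / lam $ s) \<le> 2 / (\<rho> / 2) ^ d" for l
  proof (rule taylor_coefficient_bound[OF _ \<rho> _ telescope])
    show "(\<lambda>t. S (t *s X l) $ s - lam $ s ^ l * S (t *s X 0) $ s) holomorphic_on ball 0 \<rho>"
      by (intro holomorphic_intros hol)
    fix t :: complex assume t: "norm t < \<rho>"
    have "norm (S (t *s X l) $ s - lam $ s ^ l * S (t *s X 0) $ s) \<le> norm (S (t *s X l) $ s) + norm (lam $ s ^ l * S (t *s X 0) $ s)"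
      by (rule norm_triangle_ineq4)
    also have "\<dots> \<le> 1 + 1"
      using e(2)[OF ray[OF t]] lam(1) by (intro add_mono) (auto simp: norm_mult norm_power less_imp_le)
    finally show "norm (S (t *s X l) $ s - lam $ s ^ l * S (t *s X 0) $ s) \<le> 2" by simp
  qed
  have "norm \<gamma> = 0"
  proof (rule ccontr)
    assume "norm \<gamma> \<noteq> 0"
    then have p: "norm \<gamma> > 0" by simp
    \<comment> \<open>the bound is uniform in \<open>l\<close>, so a large \<open>l\<close> is contradictory\<close>
    obtain l :: nat where "2 / (\<rho> / 2) ^ d / norm \<gamma> < of_nat l" using reals_Archimedean2 by blast
    then have "2 / (\<rho> / 2) ^ d < of_nat l * norm \<gamma>" using pos_divide_less_eq[OF p] by blast
    also have "\<dots> = norm (of_nat l * \<gamma> * lam $ s ^ l / lam $ s)"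
      using lam by (simp add: norm_mult norm_divide norm_power)
    finally show False using bound[of l] by simp
  qed
  then show ?thesis using \<kappa> by (simp add: \<gamma>_def)
qed

lemma vanishes_2_has_derivative_0:
  fixes f :: "'a::real_normed_vector \<Rightarrow> complex"
  assumes "vanishes 2 f"
  shows "(f has_derivative (\<lambda>_. 0)) (at 0)"
proof -
  obtain C where C: "\<forall>\<^sub>F z in nhds 0. norm (f z) \<le> C * norm z ^ 2"
    using assms by (auto simp: vanishes_def)
  from eventually_nhds_x_imp_x[OF C] have f0: "f 0 = 0" by simp
  have "((\<lambda>h. norm (f (0 + h) - f 0 - 0) / norm h) \<longlongrightarrow> 0) (at 0)"
  proof (rule Lim_null_comparison)
    have "\<forall>\<^sub>F z in at 0. norm (f z) \<le> C * norm z ^ 2"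
      using C by (simp add: eventually_at_filter eventually_mono)
    then show "\<forall>\<^sub>F h in at 0. norm (norm (f (0 + h) - f 0 - 0) / norm h) \<le> C * norm h"
      using eventually_neq_at_within[of 0]
      by eventually_elim (simp add: f0 power2_eq_square field_simps)
    show "((\<lambda>h::'a. C * norm h) \<longlongrightarrow> 0) (at 0)"
      by (rule tendsto_mult_right_zero[OF tendsto_norm_zero[OF tendsto_ident_at]])
  qed
  then show ?thesis by (simp add: has_derivative_at)
qed

text \<open>A map differentiable at \<open>0\<close> satisfies \<open>|\<psi> w| = O(|w|)\<close>.\<close>

lemma vanishes_compose:
  fixes \<psi> :: "'b::real_normed_vector \<Rightarrow> 'a::real_normed_vector"
  assumes f: "vanishes m f" and \<psi>: "(\<psi> has_derivative \<psi>') (at 0)" "\<psi> 0 = 0"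
  shows "vanishes m (\<lambda>w. f (\<psi> w))"
proof -
  obtain C where C: "\<forall>\<^sub>F z in nhds 0. norm (f z) \<le> C * norm z ^ m"
    using f by (auto simp: vanishes_def)
  have bl: "bounded_linear \<psi>'" using \<psi>(1) by (rule has_derivative_bounded_linear)
  obtain B where B: "\<And>w. norm (\<psi>' w) \<le> norm w * B" "B > 0"
    using bounded_linear.pos_bounded[OF bl] by blast
  have "\<exists>\<delta>>0. \<forall>w. norm (w - 0) < \<delta> \<longrightarrow> norm (\<psi> w - \<psi> 0 - \<psi>' (w - 0)) \<le> 1 * norm (w - 0)"
    using \<psi>(1) unfolding has_derivative_at_alt by (metis zero_less_one)
  then obtain \<delta> where \<delta>: "\<delta> > 0" "\<And>w. norm w < \<delta> \<Longrightarrow> norm (\<psi> w - \<psi>' w) \<le> norm w"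
    using \<psi>(2) by auto
  have "\<forall>\<^sub>F w in nhds 0. norm (\<psi> w) \<le> (B + 1) * norm w"
    unfolding eventually_nhds_metric
  proof (intro exI conjI allI impI)
    fix w :: 'b assume "dist w 0 < \<delta>"
    then have "norm (\<psi> w - \<psi>' w) \<le> norm w" using \<delta>(2) by simp
    then show "norm (\<psi> w) \<le> (B + 1) * norm w"
      using norm_triangle_sub[of "\<psi> w" "\<psi>' w"] B(1)[of w] by (simp add: algebra_simps)
  qed (rule \<delta>(1))
  moreover have "filterlim \<psi> (nhds 0) (nhds 0)"
    using isCont_filterlim_nhds[OF has_derivative_continuous[OF \<psi>(1)]] \<psi>(2) by simp
  then have "\<forall>\<^sub>F w in nhds 0. norm (f (\<psi> w)) \<le> C * norm (\<psi> w) ^ m"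
    by (rule eventually_compose_filterlim[OF C])
  ultimately have "\<forall>\<^sub>F w in nhds 0. norm (f (\<psi> w)) \<le> (\<bar>C\<bar> * (B + 1) ^ m) * norm w ^ m"
  proof eventually_elim
    case (elim w)
    have "norm (f (\<psi> w)) \<le> \<bar>C\<bar> * norm (\<psi> w) ^ m"
      using elim(2) by (smt (verit) mult_right_mono norm_ge_zero zero_le_power)
    also have "\<dots> \<le> \<bar>C\<bar> * ((B + 1) * norm w) ^ m"
      using elim(1) by (intro mult_left_mono power_mono) auto
    finally show ?case by (simp add: power_mult_distrib)
  qed
  then show ?thesis by (rule vanishesI_bound)
qed

lemma trunc_pd_form:
  fixes \<alpha> :: "nat^'n"
  assumes \<alpha>: "\<alpha> \<noteq> 0"
  shows "trunc (1 + k * mdeg \<alpha>) (pd_form lam \<alpha> a) y $ s =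
    (\<Sum>l\<le>k. (if l = 0 then lam $ s else a l s) * (y $ s * monom_at y \<alpha> ^ l))"
proof -
  let ?e = "\<lambda>l. axis s 1 + l *s \<alpha>"
  have pos: "mdeg \<alpha> > 0" using \<alpha> by (simp add: neq0_conv[symmetric] del: neq0_conv)
  have deg: "mdeg (?e l) = 1 + l * mdeg \<alpha>" for l by (simp add: mdeg_add mdeg_smult)
  have "trunc (1 + k * mdeg \<alpha>) (pd_form lam \<alpha> a) y $ s = (\<Sum>Q\<in>?e ` {..k}. monom_at y Q * pd_form lam \<alpha> a Q $ s)"
    unfolding trunc_nth
  proof (rule sum.mono_neutral_right[OF finite_mdeg_le])
    show "?e ` {..k} \<subseteq> {Q. mdeg Q \<le> 1 + k * mdeg \<alpha>}" using deg by auto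
    show "\<forall>Q\<in>{Q. mdeg Q \<le> 1 + k * mdeg \<alpha>} - ?e ` {..k}. monom_at y Q * pd_form lam \<alpha> a Q $ s = 0"
    proof
      fix Q assume Q: "Q \<in> {Q. mdeg Q \<le> 1 + k * mdeg \<alpha>} - ?e ` {..k}"
      have "Q \<notin> range ?e"
      proof
        assume "Q \<in> range ?e"
        then obtain l where l: "Q = ?e l" by blast
        then have "1 + l * mdeg \<alpha> \<le> 1 + k * mdeg \<alpha>" using Q deg[of l] by auto
        then have "l \<le> k" using pos by simp
        then show False using Q l by blast
      qed
      then show "monom_at y Q * pd_form lam \<alpha> a Q $ s = 0"
        using pd_form_resonant(2)[OF \<alpha>, of Q s lam a] by simp
    qed
  qed
  also have "\<dots> = (\<Sum>l\<le>k. monom_at y (?e l) * pd_form lam \<alpha> a (?e l) $ s)"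
    using inj_on_subset[OF pd_form_resonant(3)[OF \<alpha>, of s]] by (subst sum.reindex) auto
  also have "\<dots> = (\<Sum>l\<le>k. (if l = 0 then lam $ s else a l s) * (y $ s * monom_at y \<alpha> ^ l))"
    unfolding pd_form_resonant(1)[OF \<alpha>] by (intro sum.cong) (auto simp: monom_at_add monom_at_smult)
  finally show ?thesis .
qed

lemma trunc_tangent_to_id:
  fixes T :: "nat^'n \<Rightarrow> complex^'n"
  assumes T: "tangent_to_id T" and d: "d \<ge> 1"
  shows "vanishes 2 (\<lambda>z. trunc d T z $ s - z $ s)"
proof -
  let ?I = "{Q :: nat^'n. mdeg Q \<le> d}"
  have "trunc d T z $ s - z $ s = (\<Sum>Q\<in>?I. (T Q $ s - (if Q = axis s 1 then 1 else 0)) * monom_at z Q)" for z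
  proof -
    have "z $ s = (\<Sum>Q\<in>?I. (if Q = axis s 1 then 1 else 0) * monom_at z Q)"
      using d finite_mdeg_le by (subst sum.mono_neutral_right[where S = "{axis s 1}"]) auto
    then show ?thesis by (simp add: trunc_nth sum_subtractf algebra_simps)
  qed
  moreover have "vanishes 2 (\<lambda>z. \<Sum>Q\<in>?I. (T Q $ s - (if Q = axis s 1 then 1 else 0)) * monom_at z Q)"
  proof (rule vanishes_sum)
    fix Q :: "nat^'n"
    consider "mdeg Q = 0" | "mdeg Q = 1" | "2 \<le> mdeg Q" by linarith
    then show "vanishes 2 (\<lambda>z. (T Q $ s - (if Q = axis s 1 then 1 else 0)) * monom_at z Q)"
    proof cases
      case 1
      then have "Q \<noteq> axis s 1" by (metis mdeg_axis zero_neq_one)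
      moreover have "T Q = 0" using 1 T by (simp add: tangent_to_id_def)
      ultimately show ?thesis by simp
    next
      case 2
      then obtain h where h: "Q = axis h 1" by (rule mdeg_eq_1_imp_axis)
      then have "T Q $ s = axis h 1 $ s" using T by (simp add: tangent_to_id_def)
      also have "\<dots> = (if Q = axis s 1 then 1 else 0)" by (auto simp: h axis_def vec_eq_iff)
      finally show ?thesis by simp
    next
      case 3
      then show ?thesis by (intro vanishes_cmult vanishes_mono[OF vanishes_monom_at])
    qed
  qed
  ultimately show ?thesis by simp
qed

lemma has_derivative_vec_nth: "(f has_derivative f') F \<Longrightarrow> ((\<lambda>z. f z $ s) has_derivative (\<lambda>v. f' v $ s)) F"
  by (rule bounded_linear.has_derivative[OF bounded_linear_vec_nth])

lemma has_derivative_vecI: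
  fixes f :: "_ \<Rightarrow> complex^'n"
  assumes "\<And>s. ((\<lambda>z. f z $ s) has_derivative (\<lambda>v. f' v $ s)) (at x)"
  shows "(f has_derivative f') (at x)"
proof (rule has_derivative_componentwise_within[THEN iffD2], rule ballI)
  fix i :: "complex^'n" assume "i \<in> Basis"
  then obtain s b where i: "i = axis s b" by (auto simp: Basis_vec_def)
  have "((\<lambda>z. f z $ s \<bullet> b) has_derivative (\<lambda>v. f' v $ s \<bullet> b)) (at x)"
    by (rule has_derivative_inner_left[OF assms])
  then show "((\<lambda>x. f x \<bullet> i) has_derivative (\<lambda>x. f' x \<bullet> i)) (at x)" by (simp add: i inner_axis)
qed

lemma pd_form_derivative:
  assumes G: "has_taylor G (pd_form lam \<alpha> a)" and \<alpha>: "\<alpha> \<noteq> 0"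
  shows "(G has_derivative (\<lambda>z. \<chi> j. lam $ j * z $ j)) (at 0)"
proof (rule has_derivative_vecI)
  fix s
  have "vanishes 2 (\<lambda>z. G z $ s - lam $ s * z $ s)"
    using has_taylor_remainder[OF G, of 1 s] trunc_pd_form[OF \<alpha>, of 0 lam a _ s] by (simp add: numeral_2_eq_2)
  from vanishes_2_has_derivative_0[OF this]
  have "((\<lambda>z. (G z $ s - lam $ s * z $ s) + lam $ s * z $ s) has_derivative (\<lambda>v. 0 + lam $ s * v $ s)) (at 0)"
    by (intro has_derivative_add has_derivative_mult_right has_derivative_vec_nth has_derivative_ident)
  then show "((\<lambda>z. G z $ s) has_derivative (\<lambda>v. (\<chi> j. lam $ j * v $ j) $ s)) (at 0)" by simp
qed

text \<open>The pair \<open>(i, axis i 1 + \<alpha>)\<close> is resonant, which gives \<open>lam^\<alpha> = 1\<close>. If two eigenvalues coincided, then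
\<open>(i, axis j 1 + \<alpha>)\<close> would be a resonance as well, but its exponent is not of the form \<open>axis i 1 + k *s \<alpha>\<close>: compare the entries
at \<open>i\<close>.\<close>

lemma one_resonant_monomial:
  assumes res: "one_resonant lam \<alpha>" and nz: "\<And>j. lam $ j \<noteq> 0"
  shows "monom_at lam \<alpha> = 1" "lam $ i = lam $ j \<Longrightarrow> i = j"
proof -
  have eq: "(mdeg L \<ge> 2 \<and> lam $ j = monom_at lam L) \<longleftrightarrow> (\<exists>k\<ge>1. L = axis j 1 + k *s \<alpha>)" for j L
    using res unfolding one_resonant_def by (auto simp: set_eq_iff)
  have \<alpha>: "mdeg \<alpha> \<ge> 1" using res by (simp add: one_resonant_def Suc_le_eq neq0_conv[symmetric] del: neq0_conv)
  have "lam $ i = monom_at lam (axis i 1 + 1 *s \<alpha>)" using eq[of "axis i 1 + 1 *s \<alpha>" i] by blast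
  then show mon: "monom_at lam \<alpha> = 1" using nz[of i] by (simp add: monom_at_add monom_at_smult)
  assume ij: "lam $ i = lam $ j"
  show "i = j"
  proof (rule ccontr)
    assume "i \<noteq> j"
    have "mdeg (axis j 1 + \<alpha>) \<ge> 2" "lam $ i = monom_at lam (axis j 1 + \<alpha>)"
      using \<alpha> ij mon by (auto simp: mdeg_add monom_at_add)
    then obtain k where k: "k \<ge> 1" "axis j 1 + \<alpha> = axis i 1 + k *s \<alpha>" using eq[of "axis j 1 + \<alpha>" i] by blast
    then have "(axis j 1 + \<alpha>) $ i = (axis i 1 + k *s \<alpha>) $ i" by simp
    then have "\<alpha> $ i = Suc (k * \<alpha> $ i)" using \<open>i \<noteq> j\<close> by (simp add: axis_def)
    moreover have "1 * \<alpha> $ i \<le> k * \<alpha> $ i" using k(1) by (rule mult_right_mono) simp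
    ultimately show False by simp
  qed
qed

lemma biholo_germ_inverse:
  fixes \<phi> :: "complex^'n \<Rightarrow> complex^'n"
  assumes "biholo_germ \<phi> V"
  shows "open V" "0 \<in> V" "\<phi> 0 = 0" "open (\<phi> ` V)" "0 \<in> \<phi> ` V" "inv_into V \<phi> 0 = 0"
    "holo_on \<phi> V" "holo_on (inv_into V \<phi>) (\<phi> ` V)" "inj_on \<phi> V"
    "continuous_on V \<phi>" "continuous_on (\<phi> ` V) (inv_into V \<phi>)"
    "\<And>z. z \<in> V \<Longrightarrow> inv_into V \<phi> (\<phi> z) = z" "\<And>w. w \<in> \<phi> ` V \<Longrightarrow> \<phi> (inv_into V \<phi> w) = w"
    "\<And>w. w \<in> \<phi> ` V \<Longrightarrow> inv_into V \<phi> w \<in> V"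
proof -
  show *: "open V" "0 \<in> V" "\<phi> 0 = 0" "open (\<phi> ` V)" "holo_on \<phi> V" "holo_on (inv_into V \<phi>) (\<phi> ` V)" "inj_on \<phi> V"
    using assms by (auto simp: biholo_germ_def biholo_on_def holo_on_def)
  show "0 \<in> \<phi> ` V" using * by (metis imageI)
  show "inv_into V \<phi> 0 = 0" using * by (metis inv_into_f_f)
  have cont: "continuous_on U h" if "holo_on h U" for h :: "complex^'n \<Rightarrow> complex^'n" and U
    using that unfolding holo_on_def
    by (intro continuous_at_imp_continuous_on ballI) (meson has_derivative_continuous)
  show "continuous_on V \<phi>" "continuous_on (\<phi> ` V) (inv_into V \<phi>)" using * cont by auto
  show "\<And>z. z \<in> V \<Longrightarrow> inv_into V \<phi> (\<phi> z) = z" "\<And>w. w \<in> \<phi> ` V \<Longrightarrow> \<phi> (inv_into V \<phi> w) = w"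
    "\<And>w. w \<in> \<phi> ` V \<Longrightarrow> inv_into V \<phi> w \<in> V"
    using *(7) by (auto simp: f_inv_into_f inv_into_into)
qed

text \<open>The derivative of \<open>\<phi>\<close> commutes with a diagonal matrix whose entries are distinct.\<close>

lemma conjugation_derivative_diagonal:
  fixes F \<phi> :: "complex^'n \<Rightarrow> complex^'n"
  assumes F: "(F has_derivative (\<lambda>z. \<chi> j. lam $ j * z $ j)) (at 0)" "F 0 = 0"
    and G: "(G has_derivative (\<lambda>z. \<chi> j. lam $ j * z $ j)) (at 0)"
    and \<phi>: "biholo_germ \<phi> V"
    and conj: "\<forall>\<^sub>F z in nhds 0. \<phi> (F z) = G (\<phi> z)"
    and distinct: "\<And>i j. lam $ i = lam $ j \<Longrightarrow> i = j"
  obtains c where "\<And>s. c $ s \<noteq> 0"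
    "(\<phi> has_derivative (\<lambda>v. \<chi> s. c $ s * v $ s)) (at 0)"
    "(inv_into V \<phi> has_derivative (\<lambda>v. \<chi> s. v $ s / c $ s)) (at 0)"
proof -
  note g = biholo_germ_inverse[OF \<phi>]
  define \<psi> where "\<psi> = inv_into V \<phi>"
  define L where "L z = (\<chi> j. lam $ j * z $ j)" for z :: "complex^'n"
  obtain A :: "complex^'n^'n" where A: "(\<phi> has_derivative (\<lambda>v. A *v v)) (at 0)"
    using g(2,7) unfolding holo_on_def by blast
  obtain B :: "complex^'n^'n" where B: "(\<psi> has_derivative (\<lambda>v. B *v v)) (at 0)"
    using g(5,8) unfolding holo_on_def \<psi>_def by blast
  have "((\<lambda>z. \<phi> (F z)) has_derivative (\<lambda>v. A *v (L v))) (at 0)"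
    by (rule has_derivative_compose[where g = \<phi>]) (use F A in \<open>auto simp: L_def\<close>)
  moreover have "((\<lambda>z. G (\<phi> z)) has_derivative (\<lambda>v. L (A *v v))) (at 0)"
    by (rule has_derivative_compose[where g = G]) (use G A g in \<open>auto simp: L_def\<close>)
  then have "((\<lambda>z. \<phi> (F z)) has_derivative (\<lambda>v. L (A *v v))) (at 0)"
  proof (rule has_derivative_transform_eventually)
    show "\<forall>\<^sub>F z in at 0. G (\<phi> z) = \<phi> (F z)" using conj by (simp add: eventually_at_filter eventually_mono)
    show "G (\<phi> 0) = \<phi> (F 0)" using eventually_nhds_x_imp_x[OF conj] by simp
  qed simp
  ultimately have comm: "(\<lambda>v. A *v (L v)) = (\<lambda>v. L (A *v v))" by (rule has_derivative_unique)
  have col: "(A *v axis j x) $ i = A $ i $ j * x" for i j x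
    by (simp add: matrix_vector_mult_def axis_def if_distrib[of "\<lambda>x. _ * x"] cong: if_cong)
  have "A $ i $ j = 0" if "i \<noteq> j" for i j
  proof -
    have "L (axis j 1) = axis j (lam $ j)" by (auto simp: L_def axis_def vec_eq_iff)
    moreover have "(A *v (L (axis j 1))) $ i = L (A *v axis j 1) $ i" using comm by metis
    ultimately have "A $ i $ j * lam $ j = lam $ i * (A $ i $ j)" by (simp add: L_def col)
    then show ?thesis using distinct[of j i] that by auto
  qed
  then have diag: "A *v v = (\<chi> s. A $ s $ s * v $ s)" for v
  proof -
    have "(\<Sum>j\<in>UNIV. A $ s $ j * v $ j) = A $ s $ s * v $ s" for s
      by (subst sum.mono_neutral_right[where S = "{s}"]) (use \<open>\<And>i j. i \<noteq> j \<Longrightarrow> A $ i $ j = 0\<close> in auto)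
    then show ?thesis by (simp add: matrix_vector_mult_def)
  qed
  have "((\<lambda>z. \<psi> (\<phi> z)) has_derivative (\<lambda>v. B *v (A *v v))) (at 0)"
    by (rule has_derivative_compose[OF A]) (use B g in \<open>auto simp: \<psi>_def\<close>)
  moreover have "((\<lambda>z. \<psi> (\<phi> z)) has_derivative (\<lambda>v. v)) (at 0)"
    by (rule has_derivative_transform_within_open[OF has_derivative_ident g(1,2)]) (use g in \<open>auto simp: \<psi>_def\<close>)
  ultimately have BA: "(\<lambda>v. B *v (A *v v)) = (\<lambda>v. v)" by (rule has_derivative_unique)
  have nz: "A $ s $ s \<noteq> 0" for s
  proof
    assume "A $ s $ s = 0"
    then have "A *v axis s 1 = 0" by (auto simp: diag vec_eq_iff axis_def)
    then have "axis s 1 = (0 :: complex^'n)" using fun_cong[OF BA, of "axis s 1"] by simp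
    then show False by (simp add: axis_eq_0_iff)
  qed
  have Bv: "B *v v = (\<chi> s. v $ s / A $ s $ s)" for v
  proof -
    have "A *v (\<chi> s. v $ s / A $ s $ s) = v" using nz by (simp add: diag vec_eq_iff)
    then show ?thesis using fun_cong[OF BA, of "\<chi> s. v $ s / A $ s $ s"] by simp
  qed
  show ?thesis
    by (rule that[of "\<chi> s. A $ s $ s"]) (use nz A B in \<open>simp_all add: diag Bv \<psi>_def\<close>)
qed

text \<open>The map \<open>S\<close>, a truncated formal conjugation composed with the inverse of \<open>\<phi>\<close>, conjugates the convergent normal form to the formal
one up to the order that matters. The inverse is taken of \<open>\<phi>\<close>, where it is holomorphic by definition, and never of the formal series.\<close>

lemma normal_form_coefficients_proportional:
  fixes F \<phi> :: "complex^'n \<Rightarrow> complex^'n"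
  assumes F: "F 0 = 0" "isCont F 0" and f: "has_taylor F f"
    and T: "tangent_to_id T" "fcomp T f = fcomp (pd_form lam \<alpha> a) T"
    and G: "has_taylor G (pd_form lam \<alpha> a')"
    and \<phi>: "biholo_germ \<phi> V" and conj: "\<forall>\<^sub>F z in nhds 0. \<phi> (F z) = G (\<phi> z)"
    and c: "\<And>s. c $ s \<noteq> 0" "(inv_into V \<phi> has_derivative (\<lambda>v. \<chi> s. v $ s / c $ s)) (at 0)"
    and lam: "\<And>s. norm (lam $ s) = 1" "monom_at lam \<alpha> = 1" and \<alpha>: "\<alpha> \<noteq> 0"
    and k: "1 \<le> k" "\<And>l s. 1 \<le> l \<Longrightarrow> l < k \<Longrightarrow> a l s = 0" "\<And>l s. 1 \<le> l \<Longrightarrow> l < k \<Longrightarrow> a' l s = 0"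
  shows "a' k s = a k s * monom_at (\<chi> s. 1 / c $ s) \<alpha> ^ k"
proof -
  note g = biholo_germ_inverse[OF \<phi>]
  define \<psi> where "\<psi> = inv_into V \<phi>"
  define d where "d = 1 + k * mdeg \<alpha>"
  define S where "S w = trunc d T (\<psi> w)" for w
  define \<kappa> where "\<kappa> = (\<chi> s. 1 / c $ s)"
  have T0: "T 0 = 0" using T by (simp add: tangent_to_id_def)
  have \<psi>0: "\<psi> 0 = 0" using g by (simp add: \<psi>_def)
  have d\<psi>: "(\<psi> has_derivative (\<lambda>v. \<chi> s. v $ s / c $ s)) (at 0)" using c by (simp add: \<psi>_def)
  have d\<psi>s: "((\<lambda>w. \<psi> w $ s) has_derivative (\<lambda>v. \<kappa> $ s * v $ s)) (at 0)" for s
    using has_derivative_vec_nth[OF d\<psi>, of s] by (simp add: \<kappa>_def)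
  have lh: "line_holo (\<lambda>w. S w $ s) (\<phi> ` V)" for s
    unfolding S_def trunc_nth monom_at_def
    by (intro line_holo_sum line_holo_mult line_holo_prod line_holo_power line_holo_const line_holo_nth)
      (use g in \<open>simp add: \<psi>_def\<close>)
  have van: "vanishes 2 (\<lambda>w. S w $ s - \<psi> w $ s)" for s
    unfolding S_def using vanishes_compose[OF trunc_tangent_to_id[OF T(1), of d s] d\<psi> \<psi>0] by (simp add: d_def)
  have S0: "S 0 = 0"
    unfolding S_def \<psi>0 trunc_def by (intro sum.neutral) (simp add: monom_at_origin T0)
  have dS: "((\<lambda>w. S w $ s) has_derivative (\<lambda>v. \<kappa> $ s * v $ s)) (at 0)" for s
    using has_derivative_add[OF vanishes_2_has_derivative_0[OF van[of s]] d\<psi>s[of s]] by simp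
  have f0: "f 0 = 0" using has_taylor_at_0[OF f] F by simp
  obtain r g' where r: "r > 0" "\<And>s. g' s 0 = 0"
    "\<And>z s. (\<And>h. norm (z $ h) < r) \<Longrightarrow> G z $ s = lam $ s * z $ s + z $ s * g' s (monom_at z \<alpha>)"
    "\<forall>s. \<forall>k\<ge>1. (\<forall>l. 1 \<le> l \<longrightarrow> l < k \<longrightarrow> a' l s = 0) \<longrightarrow> ((\<lambda>u. g' s u / u ^ k) \<longlongrightarrow> a' k s) (at 0)"
    by (rule pd_form_power_series[OF G \<alpha>]; (assumption | rule that; (assumption | blast)))
  have tr: "trunc d (pd_form lam \<alpha> a) y $ s = lam $ s * y $ s + a k s * (y $ s * monom_at y \<alpha> ^ k)" for y s
  proof -
    have "(\<Sum>l\<le>k. (if l = 0 then lam $ s else a l s) * (y $ s * monom_at y \<alpha> ^ l)) =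
       (\<Sum>l\<in>{0,k}. (if l = 0 then lam $ s else a l s) * (y $ s * monom_at y \<alpha> ^ l))"
      using k by (intro sum.mono_neutral_right) auto
    then show ?thesis using k(1) by (simp add: d_def trunc_pd_form[OF \<alpha>, of k lam a y s, simplified])
  qed
  have "vanishes (Suc d) (\<lambda>w. S (G w) $ s - (lam $ s * S w $ s + a k s * (S w $ s * monom_at (S w) \<alpha> ^ k)))" for s
  proof -
    have "vanishes (Suc d) (\<lambda>z. trunc d T (F z) $ s - trunc d (fcomp T f) z $ s)"
      by (rule trunc_fcomp[OF f0 has_taylor_remainder[OF f]])
    moreover have "vanishes (Suc d) (\<lambda>z. trunc d (pd_form lam \<alpha> a) (trunc d T z) $ s - trunc d (fcomp T f) z $ s)"
      unfolding T(2) by (rule trunc_fcomp[where T = T and g = "trunc d T"]) (use T0 in simp_all)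
    ultimately have "vanishes (Suc d) (\<lambda>z. trunc d T (F z) $ s - trunc d (pd_form lam \<alpha> a) (trunc d T z) $ s)"
      using vanishes_diff by fastforce
    from vanishes_compose[OF this d\<psi> \<psi>0]
    have "vanishes (Suc d) (\<lambda>w. trunc d T (F (\<psi> w)) $ s - (lam $ s * S w $ s + a k s * (S w $ s * monom_at (S w) \<alpha> ^ k)))"
      by (simp add: tr S_def)
    then show ?thesis
    proof (rule vanishes_cong)
      have t\<psi>: "filterlim \<psi> (nhds 0) (nhds 0)"
        using isCont_filterlim_nhds[OF has_derivative_continuous[OF d\<psi>]] \<psi>0 by simp
      have tF: "filterlim F (nhds 0) (nhds 0)"
        using isCont_filterlim_nhds[OF F(2)] F(1) by simp
      have "\<forall>\<^sub>F z in nhds 0. F z \<in> V"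
        using eventually_nhds_in_open[OF g(1,2)] tF by (rule eventually_compose_filterlim)
      with conj have "\<forall>\<^sub>F z in nhds 0. \<phi> (F z) = G (\<phi> z) \<and> F z \<in> V" by (rule eventually_conj)
      then have "\<forall>\<^sub>F w in nhds 0. \<phi> (F (\<psi> w)) = G (\<phi> (\<psi> w)) \<and> F (\<psi> w) \<in> V"
        using t\<psi> by (rule eventually_compose_filterlim)
      moreover have "\<forall>\<^sub>F w in nhds 0. w \<in> \<phi> ` V" by (rule eventually_nhds_in_open[OF g(4,5)])
      ultimately show "\<forall>\<^sub>F w in nhds 0. trunc d T (F (\<psi> w)) $ s - (lam $ s * S w $ s + a k s * (S w $ s * monom_at (S w) \<alpha> ^ k)) =
        S (G w) $ s - (lam $ s * S w $ s + a k s * (S w $ s * monom_at (S w) \<alpha> ^ k))"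
      proof eventually_elim
        case (elim w)
        have "\<psi> (\<phi> (F (\<psi> w))) = F (\<psi> w)"
          unfolding \<psi>_def by (rule g(12)) (use elim in \<open>simp add: \<psi>_def\<close>)
        moreover have "\<phi> (\<psi> w) = w" unfolding \<psi>_def by (rule g(13)) (use elim in simp)
        ultimately show ?case using elim by (simp add: S_def)
      qed
    qed
  qed
  then show ?thesis
    using resonant_coefficient_transforms[OF g(4,5) lh S0 dS lam \<alpha> k(1) r(1,3) r(4)[rule_format, OF k(1) k(3)], where b = "a k s" and s = s]
    c(1) by (simp add: \<kappa>_def d_def)
qed

text \<open>Let \<open>k\<close> be the first index at which one of the two normal forms is nontrivial. There the coefficients are proportional, so \<open>k\<close> is the
weighted order of both. The proportionality factor cancels in the quotient of \<open>a k s / lam $ s\<close> by the shadow coefficient, and the condition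
\<open>H(v) = - v / k\<close> says that \<open>v ^ k = - 1 / (k A)\<close>, which turns the attracting inequality into the one below.\<close>

lemma convergent_normal_form_attracting:
  fixes F \<phi> :: "complex^'n \<Rightarrow> complex^'n"
  assumes F: "F 0 = 0" "(F has_derivative (\<lambda>z. \<chi> j. lam $ j * z $ j)) (at 0)"
    and res: "one_resonant lam \<alpha>" and lam: "\<And>s. norm (lam $ s) = 1"
    and att: "parabolically_attracting F lam \<alpha>"
    and G: "has_taylor G (pd_form lam \<alpha> a)"
    and \<phi>: "biholo_germ \<phi> V" and conj: "\<forall>\<^sub>F z in nhds 0. \<phi> (F z) = G (\<phi> z)"
  obtains k where "1 \<le> k" "\<And>l s. 1 \<le> l \<Longrightarrow> l < k \<Longrightarrow> a l s = 0" "shadow_coeff lam \<alpha> a k \<noteq> 0"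
    "\<And>s. Re (a k s / lam $ s / (of_nat k * shadow_coeff lam \<alpha> a k)) > 0"
proof -
  obtain a0 k0 v where pd: "pd_normal_form_of F lam \<alpha> a0" and wo: "weighted_order a0 k0"
    and A0: "shadow_coeff lam \<alpha> a0 k0 \<noteq> 0" and v: "v \<noteq> 0" "shadow_term lam \<alpha> a0 k0 v = - (1 / of_nat k0) * v"
      "\<And>j. Re (a0 k0 j / lam $ j * v ^ k0) < 0"
    using att unfolding parabolically_attracting_def by blast
  obtain f T where f: "has_taylor F f" "tangent_to_id T" "fcomp T f = fcomp (pd_form lam \<alpha> a0) T"
    using pd unfolding pd_normal_form_of_def by blast
  have \<alpha>: "\<alpha> \<noteq> 0" using res by (simp add: one_resonant_def)
  have nz: "lam $ s \<noteq> 0" for s using lam[of s] by auto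
  note mon = one_resonant_monomial[OF res nz]
  obtain c where c: "\<And>s. c $ s \<noteq> 0" and "(\<phi> has_derivative (\<lambda>v. \<chi> s. c $ s * v $ s)) (at 0)"
    and d\<psi>: "(inv_into V \<phi> has_derivative (\<lambda>v. \<chi> s. v $ s / c $ s)) (at 0)"
    by (rule conjugation_derivative_diagonal[OF F(2,1) pd_form_derivative[OF G \<alpha>] \<phi> conj mon(2)]; (assumption | rule that; (assumption | blast)))
  define m where "m = monom_at (\<chi> s. 1 / c $ s) \<alpha>"
  have m: "m \<noteq> 0" using c by (simp add: m_def monom_at_def)
  have k0: "1 \<le> k0" using wo by (simp add: weighted_order_def)
  define k where "k = (LEAST k. 1 \<le> k \<and> (\<exists>s. a0 k s \<noteq> 0 \<or> a k s \<noteq> 0))"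
  have ex: "1 \<le> k0 \<and> (\<exists>s. a0 k0 s \<noteq> 0 \<or> a k0 s \<noteq> 0)" using wo by (auto simp: weighted_order_def)
  have k: "1 \<le> k" "\<exists>s. a0 k s \<noteq> 0 \<or> a k s \<noteq> 0" using LeastI[of "\<lambda>k. 1 \<le> k \<and> (\<exists>s. a0 k s \<noteq> 0 \<or> a k s \<noteq> 0)", OF ex] by (auto simp: k_def)
  have kle: "k \<le> k0" unfolding k_def by (rule Least_le[where P = "\<lambda>k. 1 \<le> k \<and> (\<exists>s. a0 k s \<noteq> 0 \<or> a k s \<noteq> 0)", OF ex])
  have below: "a0 l s = 0" "a l s = 0" if "1 \<le> l" "l < k" for l s
    using not_less_Least[of l "\<lambda>k. 1 \<le> k \<and> (\<exists>s. a0 k s \<noteq> 0 \<or> a k s \<noteq> 0)"] that by (auto simp: k_def)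
  have proportional: "a k s = a0 k s * m ^ k" for s
    unfolding m_def
    by (rule normal_form_coefficients_proportional[OF F(1) has_derivative_continuous[OF F(2)] f G \<phi> conj c d\<psi> lam mon(1) \<alpha> k(1) below])
  then obtain s where "a0 k s \<noteq> 0" using k(2) by auto
  then have kk: "k0 = k" using wo k(1) kle unfolding weighted_order_def by (metis le_neq_implies_less)
  have sh: "shadow_coeff lam \<alpha> a k = shadow_coeff lam \<alpha> a0 k0 * m ^ k"
    unfolding shadow_coeff_def kk sum_distrib_right by (intro sum.cong) (simp_all add: proportional)
  have pos: "Re (a k s / lam $ s / (of_nat k * shadow_coeff lam \<alpha> a k)) > 0" for s
  proof -
    have "shadow_coeff lam \<alpha> a0 k0 * v ^ k0 * v = (- 1 / of_nat k0) * v"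
      using v(2) by (simp add: shadow_term_def algebra_simps)
    then have "shadow_coeff lam \<alpha> a0 k0 * v ^ k0 = - 1 / of_nat k0" using v(1) by (metis mult_right_cancel)
    then have "v ^ k0 = - (1 / (of_nat k0 * shadow_coeff lam \<alpha> a0 k0))" using A0 k0 by (simp add: field_simps)
    then have "a0 k0 s / lam $ s * v ^ k0 = - (a k s / lam $ s / (of_nat k * shadow_coeff lam \<alpha> a k))"
      using m by (simp add: sh proportional kk)
    then show ?thesis using v(3)[of s] by simp
  qed
  show ?thesis
  proof (rule that[of k])
    show "1 \<le> k" by (rule k(1))
    show "a l s = 0" if "1 \<le> l" "l < k" for l s using that by (rule below(2))
    show "shadow_coeff lam \<alpha> a k \<noteq> 0" using sh A0 m by simp
  qed (rule pos)
qed

section \<open>Invariant hypersurfaces\<close>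

lemma biholo_on_subset:
  assumes f: "biholo_on f V" and V': "open V'" "V' \<subseteq> V"
  shows "biholo_on f V'" "open (f ` V')"
proof -
  define h where "h = inv_into V f"
  have f': "holo_on f V" "inj_on f V" "holo_on h (f ` V)" "open (f ` V)"
    using f by (auto simp: biholo_on_def h_def holo_on_def)
  have hc: "continuous_on (f ` V) h"
    using f'(3) unfolding holo_on_def
    by (intro continuous_at_imp_continuous_on ballI) (meson has_derivative_continuous)
  have "f ` V' = f ` V \<inter> h -` V'"
    using f'(2) V' by (auto simp: h_def)
  then show op: "open (f ` V')" using continuous_open_preimage[OF hc f'(4) V'(1)] by simp
  have inj: "inj_on f V'" using f'(2) V'(2) by (rule inj_on_subset)
  have eq: "h y = inv_into V' f y" if "y \<in> f ` V'" for y
    using that inj f'(2) V' by (auto simp: h_def inv_into_f_f subset_iff)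
  have "\<exists>A :: complex^'a^'a. (inv_into V' f has_derivative (\<lambda>v. A *v v)) (at y)" if y: "y \<in> f ` V'" for y
  proof -
    obtain A :: "complex^'a^'a" where "(h has_derivative (\<lambda>v. A *v v)) (at y)"
      using f'(3) y V' unfolding holo_on_def by blast
    then have "(inv_into V' f has_derivative (\<lambda>v. A *v v)) (at y)"
      by (rule has_derivative_transform_within_open[OF _ op y]) (use eq in auto)
    then show ?thesis by blast
  qed
  then show "biholo_on f V'"
    using f'(1) inj op V' unfolding biholo_on_def holo_on_def by blast
qed

lemma subspace_coordinate_hyperplane: "vec.subspace {z :: complex^'n. z $ j = 0}"
  by (auto simp: vec.subspace_def)

lemma dim_coordinate_hyperplane: "vec.dim {z :: complex^'n. z $ j = 0} = CARD('n) - 1"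
proof (rule vec.dim_unique)
  let ?B = "(\<lambda>i. axis i 1) ` (UNIV - {j}) :: (complex^'n) set"
  show "?B \<subseteq> {z. z $ j = 0}" by (auto simp: axis_def)
  show "{z. z $ j = 0} \<subseteq> vec.span ?B"
  proof
    fix z :: "complex^'n" assume z: "z \<in> {z. z $ j = 0}"
    have "z = (\<Sum>i\<in>UNIV. z $ i *s axis i 1)" by (simp add: basis_expansion)
    also have "\<dots> = (\<Sum>i\<in>UNIV - {j}. z $ i *s axis i 1)"
      using z by (intro sum.mono_neutral_right) auto
    also have "\<dots> \<in> vec.span ?B" by (intro vec.span_sum vec.span_scale vec.span_base) auto
    finally show "z \<in> vec.span ?B" .
  qed
  show "vec.independent ?B"
    by (rule vec.independent_mono[OF independent_cart_basis]) (auto simp: cart_basis_def)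
  have "inj_on (\<lambda>i. axis i (1 :: complex)) (UNIV - {j})" by (auto simp: inj_on_def axis_eq_axis)
  then show "card ?B = CARD('n) - 1" by (simp add: card_image)
qed

lemma open_polydisc: "open {w :: complex^'n. \<forall>s. norm (w $ s) < \<epsilon>}"
  unfolding Collect_all_eq by (intro open_INT ballI open_Collect_less continuous_intros) simp

text \<open>In the coordinates \<open>\<phi>\<close> the set \<open>M\<close> is a polydisc in a coordinate hyperplane, on which \<open>F\<close> acts by the isometry \<open>Diag lam\<close>.
A diagonal derivative of \<open>\<phi>\<close> maps the hyperplane to itself, whence the tangent space.\<close>

lemma straightened_hypersurface:
  fixes \<phi> :: "complex^'n \<Rightarrow> complex^'n"
  assumes \<phi>: "biholo_germ \<phi> V" and \<epsilon>: "\<epsilon> > 0" and sub: "{w. \<forall>s. norm (w $ s) < \<epsilon>} \<subseteq> \<phi> ` V"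
    and d\<phi>: "(\<phi> has_derivative (\<lambda>v. \<chi> s. c $ s * v $ s)) (at 0)" and c: "\<And>s. c $ s \<noteq> 0"
    and d\<psi>: "(inv_into V \<phi> has_derivative (\<lambda>v. \<chi> s. v $ s / c $ s)) (at 0)"
    and M: "M = {z \<in> V. (\<forall>s. norm (\<phi> z $ s) < \<epsilon>) \<and> \<phi> z $ j = 0}"
    and F: "\<And>z. z \<in> M \<Longrightarrow> F z \<in> V" "\<And>z s. z \<in> M \<Longrightarrow> \<phi> (F z) $ s = lam $ s * \<phi> z $ s"
    and lam: "\<And>s. norm (lam $ s) = 1"
  shows "complex_submanifold (CARD('n) - 1) M" "0 \<in> M" "tangent_space M 0 = {z. z $ j = 0}"
    "F ` M \<subseteq> M" "linearizable_on F M"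
proof -
  note g = biholo_germ_inverse[OF \<phi>]
  define \<psi> where "\<psi> = inv_into V \<phi>"
  define B where "B = {w :: complex^'n. \<forall>s. norm (w $ s) < \<epsilon>}"
  define \<Omega> where "\<Omega> = {z \<in> V. \<phi> z \<in> B}"
  define S where "S = {z :: complex^'n. z $ j = 0}"
  have openB: "open B" unfolding B_def by (rule open_polydisc)
  have op\<Omega>: "open \<Omega>"
  proof -
    have "\<Omega> = V \<inter> \<phi> -` B" by (auto simp: \<Omega>_def)
    then show ?thesis using continuous_open_preimage[OF g(10) g(1) openB] by simp
  qed
  have im\<Omega>: "\<phi> ` \<Omega> = B" using sub by (auto simp: \<Omega>_def B_def)
  have M\<Omega>: "M = {z \<in> \<Omega>. \<phi> z \<in> S}" by (auto simp: M \<Omega>_def B_def S_def)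
  have bi: "biholo_on \<phi> V" using \<phi> by (simp add: biholo_germ_def)
  have bi\<Omega>: "biholo_on \<phi> \<Omega>" using biholo_on_subset(1)[OF bi op\<Omega>] by (auto simp: \<Omega>_def)
  have \<psi>: "\<psi> w \<in> V" "\<phi> (\<psi> w) = w" if "w \<in> B" for w
    using that sub g by (auto simp: \<psi>_def B_def)
  have sS: "vec.subspace S" unfolding S_def by (rule subspace_coordinate_hyperplane)
  show "complex_submanifold (CARD('n) - 1) M"
    unfolding complex_submanifold_def
  proof
    fix p assume "p \<in> M"
    show "\<exists>V \<Phi> S. p \<in> V \<and> biholo_on \<Phi> V \<and> vec.subspace S \<and> vec.dim S = CARD('n) - 1 \<and> \<Phi> ` (M \<inter> V) = S \<inter> \<Phi> ` V"
    proof (intro exI conjI)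
      show "p \<in> \<Omega>" using \<open>p \<in> M\<close> M\<Omega> by auto
      show "biholo_on \<phi> \<Omega>" by (rule bi\<Omega>)
      show "vec.subspace S" by (rule sS)
      show "vec.dim S = CARD('n) - 1" unfolding S_def by (rule dim_coordinate_hyperplane)
      show "\<phi> ` (M \<inter> \<Omega>) = S \<inter> \<phi> ` \<Omega>" by (auto simp: M\<Omega>)
    qed
  qed
  show "0 \<in> M" using g \<epsilon> by (simp add: M)
  show FM: "F ` M \<subseteq> M"
  proof
    fix y assume "y \<in> F ` M"
    then obtain z where z: "z \<in> M" "y = F z" by blast
    then show "y \<in> M" using F[OF z(1)] lam by (auto simp: M norm_mult)
  qed
  show "tangent_space M 0 = {z. z $ j = 0}"
  proof (intro equalityI subsetI)
    fix v assume "v \<in> tangent_space M 0"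
    then obtain \<gamma> where \<gamma>: "\<gamma> 0 = 0" "\<forall>\<^sub>F t in nhds 0. \<gamma> t \<in> M" "(\<gamma> has_vector_derivative v) (at 0)"
      by (auto simp: tangent_space_def)
    have "((\<lambda>t. \<phi> (\<gamma> t)) has_derivative (\<lambda>t. \<chi> s. c $ s * (t *\<^sub>R v) $ s)) (at 0)"
      by (rule has_derivative_compose[where g = \<phi>]) (use \<gamma> d\<phi> in \<open>auto simp: has_vector_derivative_def\<close>)
    from has_derivative_vec_nth[OF this, of j]
    have "((\<lambda>t. \<phi> (\<gamma> t) $ j) has_derivative (\<lambda>t. c $ j * (t *\<^sub>R v $ j))) (at 0)" by simp
    moreover have "((\<lambda>t. \<phi> (\<gamma> t) $ j) has_derivative (\<lambda>t. 0)) (at 0)"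
    proof (rule has_derivative_transform_eventually[OF has_derivative_const])
      show "\<forall>\<^sub>F t in at 0. 0 = \<phi> (\<gamma> t) $ j"
        using \<gamma>(2) unfolding eventually_at_filter by eventually_elim (simp add: M)
      show "0 = \<phi> (\<gamma> 0) $ j" using g \<gamma> by simp
    qed simp
    ultimately have "(\<lambda>t::real. c $ j * (t *\<^sub>R v $ j)) = (\<lambda>t. 0)" by (rule has_derivative_unique)
    from fun_cong[OF this, of 1] show "v \<in> {z. z $ j = 0}" using c by simp
  next
    fix v :: "complex^'n" assume v: "v \<in> {z. z $ j = 0}"
    define w where "w = (\<chi> s. c $ s * v $ s)"
    define \<gamma> where "\<gamma> t = \<psi> (t *\<^sub>R w)" for t :: real
    have "((\<lambda>t. t *\<^sub>R w) has_derivative (\<lambda>t. t *\<^sub>R w)) (at (0::real))"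
      by (auto intro!: derivative_eq_intros)
    then have "(\<gamma> has_derivative (\<lambda>t. \<chi> s. (t *\<^sub>R w) $ s / c $ s)) (at 0)"
      unfolding \<gamma>_def by (rule has_derivative_compose[where g = \<psi>]) (use d\<psi> in \<open>simp add: \<psi>_def\<close>)
    also have "(\<lambda>t. \<chi> s. (t *\<^sub>R w) $ s / c $ s) = (\<lambda>t::real. t *\<^sub>R v)"
      using c by (auto simp: fun_eq_iff vec_eq_iff w_def scaleR_conv_of_real)
    finally have "(\<gamma> has_vector_derivative v) (at 0)" by (simp add: has_vector_derivative_def)
    moreover have "\<gamma> 0 = 0" using g by (simp add: \<gamma>_def \<psi>_def)
    moreover have "\<forall>\<^sub>F t in nhds 0. \<gamma> t \<in> M"
    proof -
      have "isCont (\<lambda>t::real. t *\<^sub>R w) 0" by (intro continuous_intros)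
      then have "filterlim (\<lambda>t::real. t *\<^sub>R w) (nhds 0) (nhds 0)"
        using isCont_filterlim_nhds[where f = "\<lambda>t::real. t *\<^sub>R w" and x = 0] by simp
      moreover have "\<forall>\<^sub>F y in nhds 0. y \<in> B"
        using openB \<epsilon> by (intro eventually_nhds_in_open) (auto simp: B_def)
      ultimately have "\<forall>\<^sub>F t in nhds (0::real). t *\<^sub>R w \<in> B" by (rule eventually_compose_filterlim[rotated])
      then show ?thesis
      proof eventually_elim
        case (elim t)
        then show ?case using \<psi>[OF elim] v by (simp add: \<gamma>_def M B_def w_def)
      qed
    qed
    ultimately show "v \<in> tangent_space M 0" by (auto simp: tangent_space_def)
  qed
  show "linearizable_on F M"
    unfolding linearizable_on_def
  proof (intro exI conjI)
    let ?A = "\<chi> i k. if i = k then lam $ i else 0"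
    have A: "?A *v w = (\<chi> s. lam $ s * w $ s)" for w
      by (simp add: matrix_vector_mult_def if_distrib[of "\<lambda>x. x * _"] cong: if_cong)
    show "openin (top_of_set M) M" by simp
    show "0 \<in> M" by fact
    show "vec.subspace S" by (rule sS)
    show "openin (top_of_set S) (S \<inter> B)" using openB by (rule openin_open_Int)
    show "homeomorphism M (S \<inter> B) \<phi> \<psi>"
    proof (rule homeomorphismI)
      show "continuous_on M \<phi>" using g(10) by (rule continuous_on_subset) (auto simp: M)
      show "continuous_on (S \<inter> B) \<psi>" unfolding \<psi>_def using g(11) by (rule continuous_on_subset) (use sub in \<open>auto simp: B_def\<close>)
      show "\<phi> ` M \<subseteq> S \<inter> B" by (auto simp: M\<Omega> \<Omega>_def)
      show "\<psi> ` (S \<inter> B) \<subseteq> M" using \<psi> by (auto simp: M\<Omega> \<Omega>_def)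
    qed (use g \<psi> in \<open>auto simp: M \<psi>_def\<close>)
    show "holo_on_sub \<phi> M" unfolding holo_on_sub_def using g(7) by (auto simp: M intro!: exI[of _ V] exI[of _ \<phi>])
    show "holo_on_sub \<psi> (S \<inter> B)"
      unfolding holo_on_sub_def using g(8) sub
      by (intro ballI exI[of _ "\<phi> ` V"] exI[of _ \<psi>]) (auto simp: B_def \<psi>_def)
    show "\<phi> 0 = 0" by (rule g(3))
    show "\<forall>w\<in>S. ?A *v w \<in> S" by (auto simp: A S_def)
    have "F z \<in> M \<and> \<phi> (F z) = ?A *v \<phi> z" if "z \<in> M" for z
      using that FM F(2)[OF that] by (auto simp: A vec_eq_iff)
    then show "\<forall>\<^sub>F z in at 0 within M. F z \<in> M \<and> \<phi> (F z) = ?A *v \<phi> z"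
      by (auto simp: eventually_at_filter)
  qed
qed

section \<open>Dynamics of a convergent normal form\<close>

text \<open>The factor by which the normal form multiplies the resonant monomial \<open>u\<close>.\<close>

definition monomial_multiplier where "monomial_multiplier lam \<alpha> g u = (\<Prod>s\<in>UNIV. (1 + g s u / lam $ s) ^ (\<alpha> $ s))"
  for lam :: "complex^'n" and \<alpha> :: "nat^'n" and g :: "'n \<Rightarrow> complex \<Rightarrow> complex" and u :: complex

text \<open>Because \<open>lam^\<alpha> = 1\<close>, the linear part drops out, and the new value of the monomial depends on the old value only.\<close>

lemma monom_at_normal_form:
  assumes "\<And>s. lam $ s \<noteq> 0" "monom_at lam \<alpha> = 1"
    and G: "\<And>s. w' $ s = lam $ s * w $ s + w $ s * g s (monom_at w \<alpha>)"
  shows "monom_at w' \<alpha> = monom_at w \<alpha> * monomial_multiplier lam \<alpha> g (monom_at w \<alpha>)"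
proof -
  have "w' = (\<chi> s. lam $ s * (\<chi> s. w $ s * (1 + g s (monom_at w \<alpha>) / lam $ s)) $ s)"
    using assms(1) by (simp add: vec_eq_iff G field_simps)
  then have "monom_at w' \<alpha> = monom_at lam \<alpha> * monom_at (\<chi> s. w $ s * (\<chi> s. 1 + g s (monom_at w \<alpha>) / lam $ s) $ s) \<alpha>"
    using monom_at_mult[of lam "\<chi> s. w $ s * (1 + g s (monom_at w \<alpha>) / lam $ s)" \<alpha>] by simp
  then show ?thesis
    using assms(2) unfolding monom_at_mult by (simp add: monomial_multiplier_def monom_at_def)
qed

lemma monomial_multiplier_increment:
  assumes k: "1 \<le> k" and g: "\<And>s. ((\<lambda>u. g s u / u ^ k) \<longlongrightarrow> a s) (at 0)"
  shows "((\<lambda>u. (monomial_multiplier lam \<alpha> g u - 1) / u ^ k) \<longlongrightarrow> (\<Sum>s\<in>UNIV. of_nat (\<alpha> $ s) * (a s / lam $ s))) (at 0)"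
  unfolding monomial_multiplier_def
proof (rule relative_increment_prod[OF _ relative_increment_power power_filter_0[OF k]])
  fix s
  show "((\<lambda>u. (1 + g s u / lam $ s - 1) / u ^ k) \<longlongrightarrow> a s / lam $ s) (at 0)"
    using tendsto_mult_right[OF g[of s], of "1 / lam $ s"] by (simp add: field_simps)
qed (use power_filter_0[OF k] in auto)

lemma biholo_on_open_image:
  assumes "biholo_on F D" "open S" "S \<subseteq> D" shows "open (F ` S)"
  using biholo_on_subset[OF assms] by simp

lemma eventually_at_0_norm: "\<forall>\<^sub>F u in at 0. P u \<Longrightarrow> \<exists>\<eta>>0. \<forall>u. u \<noteq> 0 \<longrightarrow> norm u < \<eta> \<longrightarrow> P u" for P :: "complex \<Rightarrow> bool"
  by (auto simp: eventually_at)

text \<open>All estimates are limits in the single variable \<open>u\<close>, hence hold for \<open>0 < |u| < \<eta>\<close>. The half-planes of the Fatou coordinate are cut at \<open>-1\<close> and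
not at \<open>0\<close>, so that the forward and the backward sets are open and still cover everything.\<close>

lemma basins_of_convergent_normal_form:
  fixes F \<phi> :: "complex^'n \<Rightarrow> complex^'n" and lam :: "complex^'n" and \<alpha> :: "nat^'n"
  assumes F: "biholo_germ F D" and \<phi>: "biholo_germ \<phi> V"
    and r: "r > 0" "\<And>s. g s 0 = 0"
    and G: "\<And>z s. (\<And>h. norm (z $ h) < r) \<Longrightarrow> G z $ s = lam $ s * z $ s + z $ s * g s (monom_at z \<alpha>)"
    and g: "\<And>s. ((\<lambda>u. g s u / u ^ k) \<longlongrightarrow> a s) (at 0)"
    and conj: "\<forall>\<^sub>F z in nhds 0. \<phi> (F z) = G (\<phi> z)"
    and lam: "\<And>s. norm (lam $ s) = 1" "monom_at lam \<alpha> = 1" and \<alpha>: "\<alpha> \<noteq> 0" and k: "1 \<le> k"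
    and A: "A = (\<Sum>s\<in>UNIV. of_nat (\<alpha> $ s) * (a s / lam $ s))" "A \<noteq> 0"
    and \<beta>: "\<And>s. Re (a s / lam $ s / (of_nat k * A)) > 0"
  obtains \<epsilon> \<U> where "\<epsilon> > 0" "{w. \<forall>s. norm (w $ s) < \<epsilon>} \<subseteq> \<phi> ` V"
    "\<forall>z\<in>V. (\<forall>s. norm (\<phi> z $ s) < \<epsilon>) \<longrightarrow> z \<in> D \<and> F z \<in> V \<and>
      (\<forall>s. \<phi> (F z) $ s = lam $ s * \<phi> z $ s + \<phi> z $ s * g s (monom_at (\<phi> z) \<alpha>))"
    "\<forall>U\<in>\<U>. (attracting_basin F D U \<or> repelling_basin F D U) \<and> U \<subseteq> {z \<in> V. monom_at (\<phi> z) \<alpha> \<noteq> 0}"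
    "\<forall>z\<in>V. (\<forall>s. norm (\<phi> z $ s) < \<epsilon>) \<longrightarrow> monom_at (\<phi> z) \<alpha> \<noteq> 0 \<longrightarrow> z \<in> \<Union>\<U>"
proof -
  note p = biholo_germ_inverse[OF \<phi>]
  note f = biholo_germ_inverse[OF F]
  define \<psi> where "\<psi> = inv_into V \<phi>"
  define Fi where "Fi = inv_into D F"
  define h where "h = monomial_multiplier lam \<alpha> g"
  define \<beta>' where "\<beta>' s = a s / lam $ s / (of_nat k * A)" for s
  have nz: "lam $ s \<noteq> 0" for s using lam(1)[of s] by auto
  obtain \<delta> R K where ctrl: "0 < \<delta>" "1 \<le> K" "\<And>s. drift_control \<delta> R K (\<beta>' s)"
    using drifting_contraction_uniform[of \<beta>'] \<beta> unfolding \<beta>'_def by metis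
  have hA: "((\<lambda>u. (h u - 1) / u ^ k) \<longlongrightarrow> A) (at 0)" unfolding h_def A(1) by (rule monomial_multiplier_increment[OF k g])
  have gl: "((\<lambda>u. (g s u / lam $ s) / u ^ k) \<longlongrightarrow> a s / lam $ s) (at 0)" for s
    using tendsto_mult_right[OF g[of s], of "1 / lam $ s"] by (simp add: field_simps)
  have close: "\<forall>\<^sub>F u in at 0. norm (q u - l) \<le> \<delta>" if "(q \<longlongrightarrow> l) (at 0)" for q :: "complex \<Rightarrow> complex" and l
    using tendstoD[OF that ctrl(1)] by eventually_elim (simp add: dist_norm less_imp_le)
  have "\<forall>\<^sub>F u in at 0. norm (fatou_coord k A (u * h u) - fatou_coord k A u - 1) \<le> \<delta> \<and> R \<le> norm (fatou_coord k A u) \<and>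
      (\<forall>s. norm (- fatou_coord k A u * (g s u / lam $ s) - \<beta>' s) \<le> \<delta>) \<and>
      (\<forall>s. norm (- fatou_coord k A (u * h u) * (1 - 1 / (1 + g s u / lam $ s)) - \<beta>' s) \<le> \<delta>) \<and>
      (\<forall>s. 1 + g s u / lam $ s \<noteq> 0)"
  proof (intro eventually_conj eventually_all_finite)
    show "\<forall>\<^sub>F u in at 0. norm (fatou_coord k A (u * h u) - fatou_coord k A u - 1) \<le> \<delta>"
      by (rule close[OF fatou_translation[OF k A(2) hA]])
    show "\<forall>\<^sub>F u in at 0. R \<le> norm (fatou_coord k A u)" by (rule fatou_large[OF k A(2)])
    fix s
    show "\<forall>\<^sub>F u in at 0. norm (- fatou_coord k A u * (g s u / lam $ s) - \<beta>' s) \<le> \<delta>"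
      using close[OF tendsto_minus[OF fatou_multiplier[OF k A(2) gl[of s]]]] by (simp add: \<beta>'_def)
    show "\<forall>\<^sub>F u in at 0. norm (- fatou_coord k A (u * h u) * (1 - 1 / (1 + g s u / lam $ s)) - \<beta>' s) \<le> \<delta>"
      using close[OF fatou_inverse_multiplier(1)[OF k A(2) hA gl[of s]]] by (simp add: \<beta>'_def)
    show "\<forall>\<^sub>F u in at 0. 1 + g s u / lam $ s \<noteq> 0"
      by (rule fatou_inverse_multiplier(2)[OF k A(2) hA gl])
  qed
  then obtain \<eta> where \<eta>: "\<eta> > 0"
    and tr: "\<And>u. u \<noteq> 0 \<Longrightarrow> norm u < \<eta> \<Longrightarrow> norm (fatou_coord k A (u * h u) - fatou_coord k A u - 1) \<le> \<delta>"
    and far: "\<And>u. u \<noteq> 0 \<Longrightarrow> norm u < \<eta> \<Longrightarrow> R \<le> norm (fatou_coord k A u)"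
    and mf: "\<And>u s. u \<noteq> 0 \<Longrightarrow> norm u < \<eta> \<Longrightarrow> norm (- fatou_coord k A u * (g s u / lam $ s) - \<beta>' s) \<le> \<delta>"
    and mb: "\<And>u s. u \<noteq> 0 \<Longrightarrow> norm u < \<eta> \<Longrightarrow> norm (- fatou_coord k A (u * h u) * (1 - 1 / (1 + g s u / lam $ s)) - \<beta>' s) \<le> \<delta>"
    and ne: "\<And>u s. u \<noteq> 0 \<Longrightarrow> norm u < \<eta> \<Longrightarrow> 1 + g s u / lam $ s \<noteq> 0"
    using eventually_at_0_norm by (smt (verit, ccfv_threshold))
  have h_ne: "h u \<noteq> 0" if "u \<noteq> 0" "norm u < \<eta>" for u
    using ne[OF that] by (simp add: h_def monomial_multiplier_def)
  have fatou_ne: "fatou_coord k A u \<noteq> 0" if "u \<noteq> 0" for u using that k A(2) by (simp add: fatou_coord_def)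
  \<comment> \<open>below radius \<open>1\<close> the monomial is bounded by the radius, as \<open>mdeg \<alpha> \<ge> 1\<close>\<close>
  define \<sigma> where "\<sigma> = min (min r (\<eta> / 2)) 1"
  have \<sigma>: "\<sigma> > 0" "\<sigma> \<le> r" "\<sigma> \<le> 1" "\<sigma> < \<eta>" using r \<eta> by (auto simp: \<sigma>_def)
  have um: "norm (monom_at w \<alpha>) < \<eta>" if "\<And>s. norm (w $ s) < \<sigma>" for w
  proof -
    have "norm (monom_at w \<alpha>) \<le> \<sigma> ^ mdeg \<alpha>" using that by (intro norm_monom_at_le less_imp_le)
    also have "\<dots> \<le> \<sigma> ^ 1" using \<sigma> \<alpha> by (intro power_decreasing) (auto simp: Suc_le_eq neq0_conv[symmetric] simp del: neq0_conv)
    also have "\<dots> < \<eta>" using \<sigma> by simp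
    finally show ?thesis .
  qed
  \<comment> \<open>the second line concerns \<open>z\<close> as an image point: its preimage has to lie in the region where the normal form is valid\<close>
  define good where "good z \<longleftrightarrow> (z \<in> D \<and> F z \<in> V \<and> \<phi> (F z) = G (\<phi> z)) \<and>
      (z \<in> F ` D \<and> Fi z \<in> V \<and> \<phi> z = G (\<phi> (Fi z)) \<and> (\<forall>s. norm (\<phi> (Fi z) $ s) < \<sigma>))" for z
  have t_at_0: "filterlim q (nhds 0) (nhds 0)" if "continuous_on U q" "open U" "0 \<in> U" "q 0 = 0" for q :: "complex^'n \<Rightarrow> complex^'n" and U
    using isCont_filterlim_nhds[where f = q and x = 0] that by (simp add: continuous_on_eq_continuous_at)
  have tF: "filterlim F (nhds 0) (nhds 0)" by (rule t_at_0[OF f(10,1,2,3)])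
  have tFi: "filterlim Fi (nhds 0) (nhds 0)" unfolding Fi_def by (rule t_at_0[OF f(11,4,5,6)])
  have t\<phi>: "filterlim \<phi> (nhds 0) (nhds 0)" by (rule t_at_0[OF p(10,1,2,3)])
  have t\<psi>: "filterlim \<psi> (nhds 0) (nhds 0)" unfolding \<psi>_def by (rule t_at_0[OF p(11,4,5,6)])
  have evV: "\<forall>\<^sub>F z in nhds 0. z \<in> V" by (rule eventually_nhds_in_open[OF p(1,2)])
  have evFD: "\<forall>\<^sub>F z in nhds 0. z \<in> F ` D" by (rule eventually_nhds_in_open[OF f(4,5)])
  have "\<forall>\<^sub>F z in nhds 0. good z"
    unfolding good_def
  proof (intro eventually_conj)
    show "\<forall>\<^sub>F z in nhds 0. z \<in> D" by (rule eventually_nhds_in_open[OF f(1,2)])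
    show "\<forall>\<^sub>F z in nhds 0. F z \<in> V" by (rule eventually_compose_filterlim[OF evV tF])
    show "\<forall>\<^sub>F z in nhds 0. \<phi> (F z) = G (\<phi> z)" by (rule conj)
    show "\<forall>\<^sub>F z in nhds 0. z \<in> F ` D" by (rule evFD)
    show "\<forall>\<^sub>F z in nhds 0. Fi z \<in> V" by (rule eventually_compose_filterlim[OF evV tFi])
    have "\<forall>\<^sub>F z in nhds 0. \<phi> (F (Fi z)) = G (\<phi> (Fi z))" by (rule eventually_compose_filterlim[OF conj tFi])
    with evFD show "\<forall>\<^sub>F z in nhds 0. \<phi> z = G (\<phi> (Fi z))"
      by eventually_elim (use f in \<open>auto simp: Fi_def\<close>)
    have "\<forall>\<^sub>F w in nhds 0. w \<in> {w :: complex^'n. \<forall>s. norm (w $ s) < \<sigma>}"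
      using \<sigma> by (intro eventually_nhds_in_open open_polydisc) auto
    then have "\<forall>\<^sub>F w in nhds 0. \<forall>s. norm ((w :: complex^'n) $ s) < \<sigma>" by simp
    from eventually_compose_filterlim[OF eventually_compose_filterlim[OF this t\<phi>] tFi]
    show "\<forall>\<^sub>F z in nhds 0. \<forall>s. norm (\<phi> (Fi z) $ s) < \<sigma>" .
  qed
  then have "\<forall>\<^sub>F w in nhds 0. good (\<psi> w)" using t\<psi> by (rule eventually_compose_filterlim)
  moreover have "\<forall>\<^sub>F w in nhds 0. w \<in> \<phi> ` V" by (rule eventually_nhds_in_open[OF p(4,5)])
  ultimately have "\<forall>\<^sub>F w in nhds 0. good (\<psi> w) \<and> w \<in> \<phi> ` V" by (rule eventually_conj)
  then obtain e where e: "e > 0" "\<And>w. norm w < e \<Longrightarrow> good (\<psi> w) \<and> w \<in> \<phi> ` V"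
    unfolding eventually_nhds_metric by (auto simp: dist_norm)
  define \<rho> where "\<rho> = min \<sigma> (e / (2 * real CARD('n)))"
  have \<rho>: "\<rho> > 0" "\<rho> \<le> \<sigma>" using \<sigma> e by (auto simp: \<rho>_def)
  have poly: "good (\<psi> w) \<and> w \<in> \<phi> ` V" if "\<And>s. norm (w $ s) < \<rho>" for w
  proof -
    have "norm w \<le> real CARD('n) * \<rho>" using that by (intro norm_le_card_times less_imp_le)
    also have "\<dots> \<le> real CARD('n) * (e / (2 * real CARD('n)))" by (intro mult_left_mono) (auto simp: \<rho>_def)
    also have "\<dots> < e" using e by simp
    finally show ?thesis by (rule e(2))
  qed
  define Y where "Y = {z \<in> V. monom_at (\<phi> z) \<alpha> \<noteq> 0}"
  define P where "P = {z \<in> Y. \<forall>s. norm (\<phi> z $ s) < \<rho>}"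
  define \<zeta> where "\<zeta> z = fatou_coord k A (monom_at (\<phi> z) \<alpha>)" for z
  have good: "good z" if "z \<in> V" "\<And>s. norm (\<phi> z $ s) < \<rho>" for z
    using poly[of "\<phi> z"] that p by (simp add: \<psi>_def)
  have goodP: "good z" if "z \<in> P" for z using good that by (auto simp: P_def Y_def)
  have formF: "\<phi> (F z) $ s = lam $ s * \<phi> z $ s + \<phi> z $ s * g s (monom_at (\<phi> z) \<alpha>)"
    if "z \<in> V" "\<And>s. norm (\<phi> z $ s) < \<rho>" for z s
  proof -
    have "G (\<phi> z) $ s = lam $ s * \<phi> z $ s + \<phi> z $ s * g s (monom_at (\<phi> z) \<alpha>)"
      by (rule G) (use that(2) \<rho> \<sigma> in \<open>meson less_le_trans\<close>)
    moreover have "\<phi> (F z) = G (\<phi> z)" using good[OF that] by (simp only: good_def)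
    ultimately show ?thesis by simp
  qed
  have formFi: "\<phi> z $ s = lam $ s * \<phi> (Fi z) $ s + \<phi> (Fi z) $ s * g s (monom_at (\<phi> (Fi z)) \<alpha>)"
    if "good z" for z s
    using that G[of "\<phi> (Fi z)" s] \<sigma> unfolding good_def by (metis less_le_trans)
  have uP: "monom_at (\<phi> z) \<alpha> \<noteq> 0" "norm (monom_at (\<phi> z) \<alpha>) < \<eta>" if "z \<in> P" for z
    using that um[of "\<phi> z"] \<rho> by (auto simp: P_def Y_def intro: less_le_trans)
  have mult: "norm (lam $ s * x + x * y) = norm x * norm (1 + y / lam $ s)" for s x y
  proof -
    have "lam $ s * x + x * y = lam $ s * (x * (1 + y / lam $ s))" using nz by (simp add: field_simps)
    then show ?thesis by (simp add: norm_mult lam(1))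
  qed
  have uF: "monom_at (\<phi> (F z)) \<alpha> = monom_at (\<phi> z) \<alpha> * h (monom_at (\<phi> z) \<alpha>)" if "z \<in> P" for z
    unfolding h_def
    by (rule monom_at_normal_form[where w' = "\<phi> (F z)" and w = "\<phi> z" and g = g, OF nz lam(2)], rule formF)
      (use that in \<open>auto simp: P_def Y_def\<close>)
  have uFi: "monom_at (\<phi> z) \<alpha> = monom_at (\<phi> (Fi z)) \<alpha> * h (monom_at (\<phi> (Fi z)) \<alpha>)" if "z \<in> P" for z
    unfolding h_def
    by (rule monom_at_normal_form[where w' = "\<phi> z" and w = "\<phi> (Fi z)" and g = g, OF nz lam(2)], rule formFi[OF goodP[OF that]])
  have uPi: "monom_at (\<phi> (Fi z)) \<alpha> \<noteq> 0" "norm (monom_at (\<phi> (Fi z)) \<alpha>) < \<eta>" if "z \<in> P" for z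
    using uFi[OF that] uP(1)[OF that] um[of "\<phi> (Fi z)"] goodP[OF that] by (auto simp: good_def)
  have conv: "x \<longlonglongrightarrow> 0" if x: "\<And>l. x l \<in> P" "\<And>s. (\<lambda>l. norm (\<phi> (x l) $ s)) \<longlonglongrightarrow> 0" for x :: "nat \<Rightarrow> complex^'n"
  proof -
    have "(\<lambda>l. \<phi> (x l)) \<longlonglongrightarrow> 0"
      by (rule vec_tendstoI) (use tendsto_norm_zero_cancel[OF x(2)] in simp)
    from filterlim_compose[OF t\<psi> this]
    show ?thesis using x(1) p by (simp add: \<psi>_def P_def Y_def)
  qed
  have op: "open {z \<in> V. (\<forall>s. norm (\<phi> z $ s) < \<rho> / K) \<and> monom_at (\<phi> z) \<alpha> \<noteq> 0 \<and> Re (c * \<zeta> z) > -1}" for c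
  proof -
    let ?u = "\<lambda>z. monom_at (\<phi> z) \<alpha>"
    have cu: "continuous_on V ?u"
      unfolding monom_at_def by (intro continuous_intros p(10))
    define V1 where "V1 = V \<inter> (\<phi> -` {w. \<forall>s. norm (w $ s) < \<rho> / K})"
    have V1: "open V1" unfolding V1_def by (rule continuous_open_preimage[OF p(10,1) open_polydisc])
    have V2: "open (V1 \<inter> ?u -` (- {0}))"
      by (rule continuous_open_preimage[OF _ V1]) (auto intro: continuous_on_subset[OF cu] simp: V1_def)
    have c\<zeta>: "continuous_on (V1 \<inter> ?u -` (- {0})) (\<lambda>z. Re (c * \<zeta> z))"
      unfolding \<zeta>_def fatou_coord_def
      by (intro continuous_intros continuous_on_subset[OF cu]) (use k A(2) in \<open>auto simp: V1_def\<close>)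
    have "open ((V1 \<inter> ?u -` (- {0})) \<inter> (\<lambda>z. Re (c * \<zeta> z)) -` {-1<..})"
      by (rule continuous_open_preimage[OF c\<zeta> V2]) simp
    also have "(V1 \<inter> ?u -` (- {0})) \<inter> (\<lambda>z. Re (c * \<zeta> z)) -` {-1<..} =
        {z \<in> V. (\<forall>s. norm (\<phi> z $ s) < \<rho> / K) \<and> monom_at (\<phi> z) \<alpha> \<noteq> 0 \<and> Re (c * \<zeta> z) > -1}"
      by (auto simp: V1_def)
    finally show ?thesis .
  qed
  define X where "X c = {z \<in> V. (\<forall>s. norm (\<phi> z $ s) < \<rho> / K) \<and> monom_at (\<phi> z) \<alpha> \<noteq> 0 \<and> Re (c * \<zeta> z) > -1}" for c
  have openX: "open (X c)" for c unfolding X_def by (rule op)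
  have forward: "\<exists>U. attracting_basin F D U \<and> X 1 \<subseteq> U \<and> U \<subseteq> P" if "X 1 \<noteq> {}"
  proof (rule basin_of_half_plane[where H = F and w = \<phi> and Z = \<zeta> and \<rho> = \<rho> and Y = Y and Dom = D and X = "X 1", folded P_def, OF ctrl(3,2)])
    fix z assume z: "z \<in> P"
    let ?u = "monom_at (\<phi> z) \<alpha>"
    show "F z \<in> Y" using goodP[OF z] uF[OF z] uP[OF z] h_ne by (simp add: Y_def good_def)
    show "R \<le> norm (\<zeta> z)" unfolding \<zeta>_def using far uP[OF z] by blast
    show "norm (\<zeta> (F z) - \<zeta> z - 1) \<le> \<delta>" unfolding \<zeta>_def uF[OF z] using tr uP[OF z] by blast
    fix s
    show "shrinks \<delta> (\<beta>' s) (\<zeta> z) (norm (\<phi> z $ s)) (norm (\<phi> (F z) $ s))"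
      unfolding shrinks_def
    proof (intro exI conjI)
      show "norm (- fatou_coord k A ?u * (g s ?u / lam $ s) - \<beta>' s) \<le> \<delta>" using mf uP[OF z] by blast
      have "norm (\<phi> (F z) $ s) = norm (\<phi> z $ s) * norm (1 + g s ?u / lam $ s)"
        using formF[of z s] z mult by (simp add: P_def Y_def)
      also have "1 + g s ?u / lam $ s = 1 - (- fatou_coord k A ?u * (g s ?u / lam $ s)) / \<zeta> z"
        using fatou_ne[OF uP(1)[OF z]] by (simp add: \<zeta>_def)
      finally show "norm (\<phi> (F z) $ s) \<le> norm (\<phi> z $ s) * norm (1 - (- fatou_coord k A ?u * (g s ?u / lam $ s)) / \<zeta> z)" by simp
    qed
  next
    show "open (F ` S)" if "open S" "S \<subseteq> P" for S
      using F that goodP by (intro biholo_on_open_image[of F D]) (auto simp: biholo_germ_def good_def)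
    show "P \<subseteq> D" using goodP by (auto simp: good_def)
    show "X 1 \<subseteq> {z \<in> Y. (\<forall>s. norm (\<phi> z $ s) < \<rho> / K) \<and> - 1 < Re (\<zeta> z)}" by (auto simp: X_def Y_def)
  qed (use conv openX that in blast)+
  have backward: "\<exists>U. attracting_basin Fi (F ` D) U \<and> X (-1) \<subseteq> U \<and> U \<subseteq> P" if "X (-1) \<noteq> {}"
  proof (rule basin_of_half_plane[where H = Fi and w = \<phi> and Z = "\<lambda>z. - \<zeta> z" and \<rho> = \<rho> and Y = Y and Dom = "F ` D" and X = "X (-1)", folded P_def, OF ctrl(3,2)])
    fix z assume z: "z \<in> P"
    let ?u = "monom_at (\<phi> (Fi z)) \<alpha>"
    show "Fi z \<in> Y" using goodP[OF z] uPi[OF z] by (simp add: Y_def good_def)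
    show "R \<le> norm (- \<zeta> z)" unfolding \<zeta>_def norm_minus_cancel using far uP[OF z] by blast
    have "norm (\<zeta> z - \<zeta> (Fi z) - 1) \<le> \<delta>" unfolding \<zeta>_def uFi[OF z] using tr uPi[OF z] by blast
    then show "norm (- \<zeta> (Fi z) - - \<zeta> z - 1) \<le> \<delta>" by simp
    fix s
    show "shrinks \<delta> (\<beta>' s) (- \<zeta> z) (norm (\<phi> z $ s)) (norm (\<phi> (Fi z) $ s))"
      unfolding shrinks_def
    proof (intro exI conjI)
      show "norm (- fatou_coord k A (?u * h ?u) * (1 - 1 / (1 + g s ?u / lam $ s)) - \<beta>' s) \<le> \<delta>" using mb uPi[OF z] by blast
      have n0: "norm (1 + g s ?u / lam $ s) \<noteq> 0" using ne[OF uPi[OF z]] by simp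
      have "norm (\<phi> z $ s) = norm (\<phi> (Fi z) $ s) * norm (1 + g s ?u / lam $ s)"
        using formFi[OF goodP[OF z], of s] mult by simp
      then have "norm (\<phi> (Fi z) $ s) = norm (\<phi> z $ s) * norm (1 / (1 + g s ?u / lam $ s))"
        using n0 by (simp add: norm_divide)
      also have "1 / (1 + g s ?u / lam $ s) = 1 - (- fatou_coord k A (?u * h ?u) * (1 - 1 / (1 + g s ?u / lam $ s))) / (- \<zeta> z)"
        using fatou_ne[OF uP(1)[OF z]] by (simp add: \<zeta>_def uFi[OF z, symmetric])
      finally show "norm (\<phi> (Fi z) $ s) \<le> norm (\<phi> z $ s) * norm (1 - (- fatou_coord k A (?u * h ?u) * (1 - 1 / (1 + g s ?u / lam $ s))) / (- \<zeta> z))" by simp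
    qed
  next
    show "open (Fi ` S)" if S: "open S" "S \<subseteq> P" for S
    proof -
      have "S \<subseteq> F ` D" using S goodP by (auto simp: good_def)
      then have 1: "Fi y \<in> D" "F (Fi y) = y" if "y \<in> S" for y using that f(13,14) by (auto simp: Fi_def)
      have 2: "Fi (F x) = x" if "x \<in> D" for x using that f(12) by (simp add: Fi_def)
      have "Fi ` S = D \<inter> F -` S"
      proof (intro equalityI subsetI)
        fix x assume "x \<in> D \<inter> F -` S"
        then show "x \<in> Fi ` S" using 2[of x] by (intro image_eqI[of _ _ "F x"]) auto
      qed (use 1 in auto)
      then show ?thesis using continuous_open_preimage[OF f(10,1) S(1)] by simp
    qed
    show "P \<subseteq> F ` D" using goodP by (auto simp: good_def)
    show "X (-1) \<subseteq> {z \<in> Y. (\<forall>s. norm (\<phi> z $ s) < \<rho> / K) \<and> - 1 < Re (- \<zeta> z)}" by (auto simp: X_def Y_def)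
  qed (use conv openX that in blast)+
  define \<U> where "\<U> = {U. (attracting_basin F D U \<or> repelling_basin F D U) \<and> U \<subseteq> P}"
  have "X 1 \<subseteq> \<Union>\<U>" using forward unfolding \<U>_def by blast
  moreover have "X (-1) \<subseteq> \<Union>\<U>" using backward unfolding \<U>_def repelling_basin_def Fi_def by blast
  ultimately have cover: "z \<in> \<Union>\<U>" if "z \<in> V" "\<And>s. norm (\<phi> z $ s) < \<rho> / K" "monom_at (\<phi> z) \<alpha> \<noteq> 0" for z
  proof -
    have "z \<in> X 1 \<or> z \<in> X (-1)" using that by (auto simp: X_def)
    then show ?thesis using \<open>X 1 \<subseteq> \<Union>\<U>\<close> \<open>X (-1) \<subseteq> \<Union>\<U>\<close> by blast
  qed
  have \<epsilon>: "\<rho> / K > 0" "\<rho> / K \<le> \<rho>" using \<rho> ctrl(2) by (auto simp: divide_le_eq mult_le_cancel_left1)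
  show ?thesis
  proof (rule that[of "\<rho> / K" \<U>])
    show "{w. \<forall>s. norm (w $ s) < \<rho> / K} \<subseteq> \<phi> ` V" using poly \<epsilon>(2) by (auto intro: less_le_trans)
    show "\<forall>z\<in>V. (\<forall>s. norm (\<phi> z $ s) < \<rho> / K) \<longrightarrow> z \<in> D \<and> F z \<in> V \<and>
      (\<forall>s. \<phi> (F z) $ s = lam $ s * \<phi> z $ s + \<phi> z $ s * g s (monom_at (\<phi> z) \<alpha>))"
    proof (intro ballI impI)
      fix z assume z: "z \<in> V" "\<forall>s. norm (\<phi> z $ s) < \<rho> / K"
      have z': "norm (\<phi> z $ s) < \<rho>" for s using z(2) \<epsilon>(2) less_le_trans by blast
      show "z \<in> D \<and> F z \<in> V \<and> (\<forall>s. \<phi> (F z) $ s = lam $ s * \<phi> z $ s + \<phi> z $ s * g s (monom_at (\<phi> z) \<alpha>))"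
        using good[OF z(1) z'] formF[OF z(1) z'] by (auto simp: good_def)
    qed
    show "\<forall>z\<in>V. (\<forall>s. norm (\<phi> z $ s) < \<rho> / K) \<longrightarrow> monom_at (\<phi> z) \<alpha> \<noteq> 0 \<longrightarrow> z \<in> \<Union>\<U>"
      using cover by blast
    show "\<rho> / K > 0" by (rule \<epsilon>(1))
    show "\<forall>U\<in>\<U>. (attracting_basin F D U \<or> repelling_basin F D U) \<and> U \<subseteq> {z \<in> V. monom_at (\<phi> z) \<alpha> \<noteq> 0}"
      unfolding \<U>_def P_def Y_def by blast
  qed
qed

theorem theorem5p3:
  fixes F :: "complex^'n \<Rightarrow> complex^'n"
    and D :: "(complex^'n) set"
    and lam :: "complex^'n"
    and \<alpha> :: "nat^'n"
  assumes "biholo_germ F D"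
    and "(F has_derivative (\<lambda>z. \<chi> j. lam $ j * z $ j)) (at 0)"
    and "one_resonant lam \<alpha>"
    and "holo_conj_to_pd F lam \<alpha>"
    and "\<forall>j. norm (lam $ j) = 1"
    and "parabolically_attracting F lam \<alpha>"
  shows "\<exists>M W.
    (\<forall>j. \<alpha> $ j \<noteq> 0 \<longrightarrow>
       complex_submanifold (CARD('n) - 1) (M j) \<and> 0 \<in> M j \<and> M j \<subseteq> D \<and>
       tangent_space (M j) 0 = {z. z $ j = 0} \<and>
       F ` M j \<subseteq> M j \<and> linearizable_on F (M j)) \<and>
    open W \<and> 0 \<in> W \<and>
    (\<exists>\<U>. (\<forall>U\<in>\<U>. attracting_basin F D U \<or> repelling_basin F D U) \<and>
         W - (\<Union>j\<in>{j. \<alpha> $ j \<noteq> 0}. M j) = \<Union>\<U>)"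
proof -
  have lam: "norm (lam $ s) = 1" for s using assms(5) by blast
  have nz: "lam $ s \<noteq> 0" for s using lam[of s] by auto
  have \<alpha>: "\<alpha> \<noteq> 0" using assms(3) by (simp add: one_resonant_def)
  note mon = one_resonant_monomial[OF assms(3) nz]
  obtain a G \<phi> V where G: "has_taylor G (pd_form lam \<alpha> a)" and \<phi>: "biholo_germ \<phi> V"
    and conj: "\<forall>\<^sub>F z in nhds 0. \<phi> (F z) = G (\<phi> z)"
    using assms(4) unfolding holo_conj_to_pd_def by blast
  have F0: "F 0 = 0" using assms(1) by (simp add: biholo_germ_def)
  note p = biholo_germ_inverse[OF \<phi>]
  obtain c where c: "\<And>s. c $ s \<noteq> 0" "(\<phi> has_derivative (\<lambda>v. \<chi> s. c $ s * v $ s)) (at 0)"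
    "(inv_into V \<phi> has_derivative (\<lambda>v. \<chi> s. v $ s / c $ s)) (at 0)"
    by (rule conjugation_derivative_diagonal[OF assms(2) F0 pd_form_derivative[OF G \<alpha>] \<phi> conj mon(2)]; (assumption | rule that; (assumption | blast)))
  obtain k where k: "1 \<le> k" "\<And>l s. 1 \<le> l \<Longrightarrow> l < k \<Longrightarrow> a l s = 0" "shadow_coeff lam \<alpha> a k \<noteq> 0"
    "\<And>s. Re (a k s / lam $ s / (of_nat k * shadow_coeff lam \<alpha> a k)) > 0"
    by (rule convergent_normal_form_attracting[OF F0 assms(2,3) lam assms(6) G \<phi> conj]; (assumption | rule that; (assumption | blast)))
  obtain r g where g: "r > 0" "\<And>s. g s 0 = 0"
    "\<And>z s. (\<And>h. norm (z $ h) < r) \<Longrightarrow> G z $ s = lam $ s * z $ s + z $ s * g s (monom_at z \<alpha>)"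
    "\<forall>s. \<forall>k\<ge>1. (\<forall>l. 1 \<le> l \<longrightarrow> l < k \<longrightarrow> a l s = 0) \<longrightarrow> ((\<lambda>u. g s u / u ^ k) \<longlongrightarrow> a k s) (at 0)"
    by (rule pd_form_power_series[OF G \<alpha>]; (assumption | rule that; (assumption | blast)))
  obtain \<epsilon> \<U> where \<epsilon>: "\<epsilon> > 0" "{w. \<forall>s. norm (w $ s) < \<epsilon>} \<subseteq> \<phi> ` V"
    and form: "\<forall>z\<in>V. (\<forall>s. norm (\<phi> z $ s) < \<epsilon>) \<longrightarrow> z \<in> D \<and> F z \<in> V \<and>
      (\<forall>s. \<phi> (F z) $ s = lam $ s * \<phi> z $ s + \<phi> z $ s * g s (monom_at (\<phi> z) \<alpha>))"
    and basins: "\<forall>U\<in>\<U>. (attracting_basin F D U \<or> repelling_basin F D U) \<and> U \<subseteq> {z \<in> V. monom_at (\<phi> z) \<alpha> \<noteq> 0}"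
    and cover: "\<forall>z\<in>V. (\<forall>s. norm (\<phi> z $ s) < \<epsilon>) \<longrightarrow> monom_at (\<phi> z) \<alpha> \<noteq> 0 \<longrightarrow> z \<in> \<Union>\<U>"
    by (rule basins_of_convergent_normal_form[OF assms(1) \<phi> g(1-3) g(4)[rule_format, OF k(1,2)] conj lam mon(1) \<alpha> k(1) shadow_coeff_def k(3,4)]; (assumption | rule that; (assumption | blast)))
  define \<Omega> where "\<Omega> = {z \<in> V. \<forall>s. norm (\<phi> z $ s) < \<epsilon>}"
  define M where "M j = {z \<in> V. (\<forall>s. norm (\<phi> z $ s) < \<epsilon>) \<and> \<phi> z $ j = 0}" for j
  have mon0: "monom_at w \<alpha> = 0 \<longleftrightarrow> (\<exists>j. \<alpha> $ j \<noteq> 0 \<and> w $ j = 0)" for w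
    by (auto simp: monom_at_def)
  have hyper: "complex_submanifold (CARD('n) - 1) (M j) \<and> 0 \<in> M j \<and> M j \<subseteq> D \<and>
       tangent_space (M j) 0 = {z. z $ j = 0} \<and> F ` M j \<subseteq> M j \<and> linearizable_on F (M j)" if j: "\<alpha> $ j \<noteq> 0" for j
  proof -
    have FV: "F z \<in> V" if "z \<in> M j" for z using form that by (auto simp: M_def)
    have lin: "\<phi> (F z) $ s = lam $ s * \<phi> z $ s" if "z \<in> M j" for z s
    proof -
      have "monom_at (\<phi> z) \<alpha> = 0" using that j by (auto simp: M_def mon0)
      then show ?thesis using form that g(2) by (auto simp: M_def)
    qed
    have "M j \<subseteq> D" using form by (auto simp: M_def)
    with straightened_hypersurface[OF \<phi> \<epsilon> c(2,1,3) M_def FV lin lam] show ?thesis by blast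
  qed
  have "\<Omega> = V \<inter> \<phi> -` {w. \<forall>s. norm (w $ s) < \<epsilon>}" by (auto simp: \<Omega>_def)
  then have "open \<Omega>" using continuous_open_preimage[OF p(10,1) open_polydisc] by simp
  moreover have "open U" if "U \<in> \<U>" for U
    using basins that by (auto simp: attracting_basin_def repelling_basin_def)
  ultimately have W: "open (\<Omega> \<union> \<Union>\<U>)" by blast
  have zero: "0 \<in> \<Omega>" using p \<epsilon> by (simp add: \<Omega>_def)
  have diff: "(\<Omega> \<union> \<Union>\<U>) - (\<Union>j\<in>{j. \<alpha> $ j \<noteq> 0}. M j) = \<Union>\<U>"
  proof (intro equalityI subsetI)
    fix z assume "z \<in> (\<Omega> \<union> \<Union>\<U>) - (\<Union>j\<in>{j. \<alpha> $ j \<noteq> 0}. M j)"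
    then have z: "z \<in> \<Union>\<U> \<or> z \<in> \<Omega>" "\<And>j. \<alpha> $ j \<noteq> 0 \<Longrightarrow> z \<notin> M j" by blast+
    have "z \<in> \<Union>\<U>" if "z \<in> \<Omega>"
    proof -
      have "monom_at (\<phi> z) \<alpha> \<noteq> 0" unfolding mon0 using z(2) that unfolding M_def \<Omega>_def by blast
      then show ?thesis using cover that unfolding \<Omega>_def by blast
    qed
    then show "z \<in> \<Union>\<U>" using z(1) by blast
  next
    fix z assume z: "z \<in> \<Union>\<U>"
    then have "monom_at (\<phi> z) \<alpha> \<noteq> 0" using basins by blast
    then have "z \<notin> (\<Union>j\<in>{j. \<alpha> $ j \<noteq> 0}. M j)" using mon0[of "\<phi> z"] by (auto simp: M_def)
    then show "z \<in> (\<Omega> \<union> \<Union>\<U>) - (\<Union>j\<in>{j. \<alpha> $ j \<noteq> 0}. M j)" using z by blast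
  qed
  show ?thesis
  proof (rule exI[of _ M], rule exI[of _ "\<Omega> \<union> \<Union>\<U>"], intro conjI)
    show "0 \<in> \<Omega> \<union> \<Union>\<U>" using zero by blast
    show "\<exists>\<U>'. (\<forall>U\<in>\<U>'. attracting_basin F D U \<or> repelling_basin F D U) \<and>
        \<Omega> \<union> \<Union>\<U> - (\<Union>j\<in>{j. \<alpha> $ j \<noteq> 0}. M j) = \<Union>\<U>'"
      by (rule exI[of _ \<U>], rule conjI[OF _ diff]) (use basins in blast)
  qed (use hyper W in blast)+
qed

end
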